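(* Let $\Omega\subset\mathbb{R}^n$ be a bounded domain, let $p\ge 2$ and $2n<\alpha p<n+p$. Then the first eigenvalue $\lambda_1$ of $\Omega$ is isolated, i.e. it is an isolated point of the set of all eigenvalues of $\Omega$.
   Context: Put $s=\alpha-n/p\in(0,1)$. $W^{s,p}_0(\Omega)$ is the closure of $C_0^\infty(\Omega)$ in the fractional Sobolev norm of $W^{s,p}(\Omega)$, given by $\|u\|^p=\iint \frac{|u(y)-u(x)|^p}{|y-x|^{n+sp}}\,dx\,dy+\int|u|^p\,dx$; note $n+sp=\alpha p$. Functions in $W^{s,p}_0(\Omega)$ are extended by zero to $\mathbb{R}^n$. A function $u\in W^{s,p}_0(\Omega)$, $u\not\equiv0$, is an eigenfunction of $\Omega$ with eigenvalue $\lambda$ if $$\int_{\mathbb{R}^n}\int_{\mathbb{R}^n}\frac{|u(y)-u(x)|^{p-2}(u(y)-u(x))(\phi(y)-\phi(x))}{|y-x|^{\alpha p}}\,dx\,dy=\lambda\int_{\mathbb{R}^n}|u|^{p-2}u\,\phi\,dx$$ for all $\phi\in C_0^\infty(\Omega)$; such $\lambda$ is called an eigenvalue of $\Omega$. The first eigenvalue $\lambda_1$ is the infimum over all $\phi\in C_0^\infty(\Omega)$, $\phi\not\equiv0$, of $\int_{\mathbb{R}^n}\int_{\mathbb{R}^n}\frac{|\phi(y)-\phi(x)|^p}{|y-x|^{\alpha p}}\,dx\,dy\big/\int_{\mathbb{R}^n}|\phi|^p\,dx$. *)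

theory Defs
  imports "HOL-Analysis.Analysis"
begin

(* iter_deriv [v1, ..., vk] f is the iterated directional derivative of f, taken first along vk
   and last along v1. *)
primrec iter_deriv ::
  "'a list \<Rightarrow> ('a::euclidean_space \<Rightarrow> real) \<Rightarrow> 'a \<Rightarrow> real" where
  "iter_deriv [] f = f"
| "iter_deriv (v # vs) f = (\<lambda>x. frechet_derivative (iter_deriv vs f) (at x) v)"

(* Differentiability of all iterated derivatives makes each of them continuous,
   so this is C-infinity. *)
definition smooth :: "('a::euclidean_space \<Rightarrow> real) \<Rightarrow> bool" where
  "smooth f \<longleftrightarrow> (\<forall>vs x. iter_deriv vs f differentiable (at x))"

definition test_functions :: "'a::euclidean_space set \<Rightarrow> ('a \<Rightarrow> real) set" where
  "test_functions \<Omega> = {\<phi>. smooth \<phi> \<and>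
     compact (closure {x. \<phi> x \<noteq> 0}) \<and> closure {x. \<phi> x \<noteq> 0} \<subseteq> \<Omega>}"

(* On the diagonal x = y the quotient is 0, because 0 powr a = 0 and division by 0 gives 0;
   the diagonal is a null set. *)
definition diff_quotient ::
  "real \<Rightarrow> real \<Rightarrow> ('a::euclidean_space \<Rightarrow> real) \<Rightarrow> 'a \<times> 'a \<Rightarrow> real" where
  "diff_quotient r p u = (\<lambda>(x, y). \<bar>u y - u x\<bar> powr p / norm (y - x) powr r)"

(* Elements are Borel representatives; every Lebesgue measurable class has one. *)
definition frac_sobolev ::
  "'a::euclidean_space set \<Rightarrow> real \<Rightarrow> real \<Rightarrow> ('a \<Rightarrow> real) set" where
  "frac_sobolev \<Omega> s p = {u. u \<in> borel_measurable borel \<and>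
     set_integrable (lborel \<Otimes>\<^sub>M lborel) (\<Omega> \<times> \<Omega>)
       (diff_quotient (real DIM('a) + s * p) p u) \<and>
     set_integrable lborel \<Omega> (\<lambda>x. \<bar>u x\<bar> powr p)}"

definition frac_sobolev_norm ::
  "'a::euclidean_space set \<Rightarrow> real \<Rightarrow> real \<Rightarrow> ('a \<Rightarrow> real) \<Rightarrow> real" where
  "frac_sobolev_norm \<Omega> s p u =
     (set_lebesgue_integral (lborel \<Otimes>\<^sub>M lborel) (\<Omega> \<times> \<Omega>)
        (diff_quotient (real DIM('a) + s * p) p u)
      + set_lebesgue_integral lborel \<Omega> (\<lambda>x. \<bar>u x\<bar> powr p)) powr (1 / p)"

(* The closure of the test functions, each element being extended by zero outside \<Omega>. *)
definition frac_sobolev_0 ::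
  "'a::euclidean_space set \<Rightarrow> real \<Rightarrow> real \<Rightarrow> ('a \<Rightarrow> real) set" where
  "frac_sobolev_0 \<Omega> s p = {u \<in> frac_sobolev \<Omega> s p. (\<forall>x. x \<notin> \<Omega> \<longrightarrow> u x = 0) \<and>
     (\<exists>\<phi>. (\<forall>k::nat. \<phi> k \<in> test_functions \<Omega>) \<and>
        (\<lambda>k. frac_sobolev_norm \<Omega> s p (\<lambda>x. u x - \<phi> k x)) \<longlonglongrightarrow> 0)}"

(* |t|^(p-2) t; for t = 0 the value is 0, also when p = 2. *)
definition signed_powr :: "real \<Rightarrow> real \<Rightarrow> real" where
  "signed_powr p t = \<bar>t\<bar> powr (p - 2) * t"

definition is_eigenfunction ::
  "'a::euclidean_space set \<Rightarrow> real \<Rightarrow> real \<Rightarrow> ('a \<Rightarrow> real) \<Rightarrow> real \<Rightarrow> bool" where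
  "is_eigenfunction \<Omega> \<alpha> p u lam \<longleftrightarrow>
     u \<in> frac_sobolev_0 \<Omega> (\<alpha> - real DIM('a) / p) p \<and>
     \<not> (AE x in lborel. u x = 0) \<and>
     (\<forall>\<phi> \<in> test_functions \<Omega>.
        (\<integral>(x, y). signed_powr p (u y - u x) * (\<phi> y - \<phi> x) / norm (y - x) powr (\<alpha> * p)
           \<partial>(lborel \<Otimes>\<^sub>M lborel))
        = lam * (\<integral>x. signed_powr p (u x) * \<phi> x \<partial>lborel))"

definition eigenvalues :: "'a::euclidean_space set \<Rightarrow> real \<Rightarrow> real \<Rightarrow> real set" where
  "eigenvalues \<Omega> \<alpha> p = {lam. \<exists>u. is_eigenfunction \<Omega> \<alpha> p u lam}"

definition rayleigh_quotient ::
  "real \<Rightarrow> real \<Rightarrow> ('a::euclidean_space \<Rightarrow> real) \<Rightarrow> real" where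
  "rayleigh_quotient \<alpha> p \<phi> =
     (\<integral>z. diff_quotient (\<alpha> * p) p \<phi> z \<partial>(lborel \<Otimes>\<^sub>M lborel))
     / (\<integral>x. \<bar>\<phi> x\<bar> powr p \<partial>lborel)"

definition first_eigenvalue :: "'a::euclidean_space set \<Rightarrow> real \<Rightarrow> real \<Rightarrow> real" where
  "first_eigenvalue \<Omega> \<alpha> p =
     Inf (rayleigh_quotient \<alpha> p ` {\<phi> \<in> test_functions \<Omega>. \<exists>x. \<phi> x \<noteq> 0})"

end

theory Submission
  imports Defs "HOL-Complex_Analysis.Great_Picard"
begin

text \<open>Let \<open>u\<^sub>k\<close> be normalised eigenfunctions with eigenvalues \<open>\<lambda>\<^sub>k \<noteq> \<lambda>\<^sub>1\<close> tending to \<open>\<lambda>\<^sub>1\<close>. They form a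
  minimising sequence of the Rayleigh quotient. As \<open>\<alpha> p > 2 n\<close>, Morrey's inequality makes it equicontinuous,
  and Clarkson's inequality turns uniform convergence of a subsequence into convergence in energy; the limit
  \<open>f\<close> is a first eigenfunction. Comparing the energies of \<open>f\<close> and \<open>|f|\<close> shows that \<open>f\<close> does not change
  sign, and Picone's inequality shows that it vanishes only on a null set of \<open>\<Omega>\<close>. Picone's inequality
  also bounds the eigenvalue of every eigenfunction of constant sign by \<open>\<lambda>\<^sub>1\<close>, so each \<open>u\<^sub>k\<close> takes
  the sign opposite to \<open>f\<close>. Testing the equation with that part of \<open>u\<^sub>k\<close>, Morrey's inequality bounds the
  measure of the set where it lives from below by a constant depending on \<open>\<lambda>\<^sub>k\<close> only, against the convergence
  of \<open>u\<^sub>k\<close> to \<open>f\<close>.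

  The norm of \<open>W\<^sub>0\<close> integrates over \<open>\<Omega> \<times> \<Omega>\<close>, the equation over the whole space. On test functions the
  two energies are comparable by a fractional Hardy inequality, which for \<open>\<alpha> p > 2 n\<close> holds on every
  bounded open set.\<close>

subsection \<open>Smooth functions and test functions\<close>

text \<open>The obstacle is that the equation is given for test functions only, whereas the argument
  tests it with negative parts and with Picone quotients and compares a minimiser with its absolute
  value. Each of these is reached from test functions: \<open>|a|\<close> is replaced by
  \<open>sqrt (a^2 + d^2) - d\<close>, which is smooth, vanishes with \<open>a\<close> and does not
  increase differences, and the equation survives pointwise limits of test functions with bounded
  energy. The weak convergence behind this is derived from Young's inequality and dominated
  convergence instead of duality.

  The condition \<open>2 n < \<alpha> p\<close> also makes all functions continuous, so that sets
  such as {f > 0} are open and an open null set is empty. The condition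
  \<open>\<alpha> p < n + p\<close> gives Lipschitz functions finite energy, and
  \<open>p \<ge> 2\<close> reduces Clarkson's inequality to the convexity of \<open>t^(p/2)\<close>.
  Positivity comes from nonlocality: a point where f is positive and a point where it vanishes
  interact directly through the kernel, however far apart they are.\<close>

definition flat :: "nat \<Rightarrow> real \<Rightarrow> real" where
  "flat k t = (if t \<le> 0 then 0 else exp (- 1 / t) / t ^ k)"

lemma flat_pos_iff: "flat k t > 0 \<longleftrightarrow> t > 0"
  by (auto simp: flat_def)

lemma flat_tendsto_0: "(flat k \<longlongrightarrow> 0) (at 0)"
proof -
  have "((\<lambda>t. (inverse t) ^ k / exp (inverse t)) \<longlongrightarrow> (0::real)) (at_right 0)"
    by (rule filterlim_compose[OF tendsto_power_div_exp_0 filterlim_inverse_at_top_right])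
  then have "(flat k \<longlongrightarrow> 0) (at_right 0)"
    by (rule Lim_transform_eventually)
      (auto simp: flat_def eventually_at_filter exp_minus field_simps inverse_eq_divide)
  moreover have "(flat k \<longlongrightarrow> 0) (at_left 0)"
    by (rule Lim_transform_eventually[OF tendsto_const]) (auto simp: flat_def eventually_at_filter)
  ultimately show ?thesis
    by (simp add: filterlim_split_at)
qed

text \<open>Derivatives of \<open>exp (-1/t)\<close> bring in powers of \<open>1/t\<close>. The
  index \<open>k\<close> makes the family closed under differentiation up to linear
  combinations.\<close>

lemma flat_has_derivative:
  "(flat k has_real_derivative flat (k + 2) t - real k * flat (k + 1) t) (at t)"
proof -
  consider "t < 0" | "t = 0" | "t > 0" by linarith
  then show ?thesis
  proof cases
    case 1
    have "((\<lambda>t. 0) has_real_derivative 0) (at t)" by simp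
    then have "(flat k has_real_derivative 0) (at t)"
      by (rule has_field_derivative_transform_within_open[where S="{..<0}"])
        (use 1 in \<open>auto simp: flat_def\<close>)
    with 1 show ?thesis by (simp add: flat_def)
  next
    case 2
    \<comment> \<open>Away from 0 the difference quotient of \<open>flat k\<close> at 0 is again a
      member of the family, \<open>flat (Suc k)\<close>.\<close>
    have "((\<lambda>h. (flat k (0 + h) - flat k 0) / h) \<longlongrightarrow> 0) (at 0)"
      by (rule Lim_transform_eventually[OF flat_tendsto_0[of "Suc k"]])
        (auto simp: flat_def eventually_at_filter)
    then show ?thesis using 2 by (simp add: DERIV_def flat_def)
  next
    case 3
    have e: "((\<lambda>t. exp (- 1 / t)) has_real_derivative exp (- 1 / t) / t\<^sup>2) (at t)"
      using 3 by (auto intro!: derivative_eq_intros simp: field_simps power2_eq_square)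
    have "((\<lambda>t. t ^ k) has_real_derivative real k * t ^ k / t) (at t)"
      by (rule DERIV_cong[OF DERIV_pow]) (use 3 in \<open>cases k; simp\<close>)
    from DERIV_divide[OF e this]
    have "((\<lambda>t. exp (- 1 / t) / t ^ k) has_real_derivative
        exp (- 1 / t) / t ^ (k + 2) - real k * (exp (- 1 / t) / t ^ (k + 1))) (at t)"
      by (rule DERIV_cong) (use 3 in \<open>simp_all add: field_simps power2_eq_square\<close>)
    then have "(flat k has_real_derivative
        exp (- 1 / t) / t ^ (k + 2) - real k * (exp (- 1 / t) / t ^ (k + 1))) (at t)"
      by (rule has_field_derivative_transform_within_open[where S="{0<..}"])
        (use 3 in \<open>auto simp: flat_def\<close>)
    with 3 show ?thesis by (simp add: flat_def)
  qed
qed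

text \<open>A class of differentiable functions that is closed under directional derivatives consists of
  smooth functions; this one also contains the composites needed below.\<close>

inductive smooth_term :: "('a::euclidean_space \<Rightarrow> real) \<Rightarrow> bool" where
  of_smooth: "smooth f \<Longrightarrow> smooth_term f"
| const: "smooth_term (\<lambda>x. c)"
| inner: "smooth_term (\<lambda>x. x \<bullet> v)"
| add: "smooth_term f \<Longrightarrow> smooth_term g \<Longrightarrow> smooth_term (\<lambda>x. f x + g x)"
| mult: "smooth_term f \<Longrightarrow> smooth_term g \<Longrightarrow> smooth_term (\<lambda>x. f x * g x)"
| powr: "smooth_term f \<Longrightarrow> (\<And>x. f x > 0) \<Longrightarrow> smooth_term (\<lambda>x. f x powr a)"
| flat: "smooth_term f \<Longrightarrow> smooth_term (\<lambda>x. flat k (f x))"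

lemma iter_deriv_append: "iter_deriv (vs @ ws) f = iter_deriv vs (iter_deriv ws f)"
  by (induction vs) auto

lemma smooth_differentiable: "smooth f \<Longrightarrow> f differentiable (at x)"
  unfolding smooth_def by (metis iter_deriv.simps(1))

lemma smooth_frechet_derivative:
  assumes "smooth f"
  shows "smooth (\<lambda>x. frechet_derivative f (at x) v)"
proof -
  have "iter_deriv vs (\<lambda>x. frechet_derivative f (at x) v) = iter_deriv (vs @ [v]) f" for vs
    by (simp add: iter_deriv_append)
  with assms show ?thesis unfolding smooth_def by metis
qed

lemma smooth_term_derivative:
  fixes f :: "'a::euclidean_space \<Rightarrow> real"
  assumes "smooth_term f"
  shows "\<exists>f'. (\<forall>x. (f has_derivative f' x) (at x)) \<and> (\<forall>v. smooth_term (\<lambda>x. f' x v))"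
  using assms
proof induction
  case (of_smooth f)
  then show ?case
    using smooth_differentiable[of f] smooth_frechet_derivative[of f]
    by (intro exI[of _ "\<lambda>x. frechet_derivative f (at x)"])
      (auto simp: frechet_derivative_works intro: smooth_term.of_smooth)
next
  case (const c)
  show ?case by (intro exI[of _ "\<lambda>x v. 0"]) (auto intro: smooth_term.const)
next
  case (inner v)
  show ?case
    by (intro exI[of _ "\<lambda>x w. w \<bullet> v"]) (auto intro!: smooth_term.const derivative_eq_intros)
next
  case (add f g)
  then obtain f' g' where
    "\<forall>x. (f has_derivative f' x) (at x)" "\<forall>v. smooth_term (\<lambda>x. f' x v)"
    "\<forall>x. (g has_derivative g' x) (at x)" "\<forall>v. smooth_term (\<lambda>x. g' x v)" by blast
  then show ?case
    by (intro exI[of _ "\<lambda>x v. f' x v + g' x v"])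
      (simp add: smooth_term.add has_derivative_add)
next
  case (mult f g)
  then obtain f' g' where
    "\<forall>x. (f has_derivative f' x) (at x)" "\<forall>v. smooth_term (\<lambda>x. f' x v)"
    "\<forall>x. (g has_derivative g' x) (at x)" "\<forall>v. smooth_term (\<lambda>x. g' x v)" by blast
  with mult.hyps show ?case
    by (intro exI[of _ "\<lambda>x v. f x * g' x v + f' x v * g x"])
      (simp add: smooth_term.add smooth_term.mult has_derivative_mult)
next
  case (powr f a)
  then obtain f' where f':
    "\<And>x. (f has_derivative f' x) (at x)" "\<And>v. smooth_term (\<lambda>x. f' x v)" by blast
  have "((\<lambda>t. t powr a) has_derivative (\<lambda>h. h * (a * f x powr (a - 1)))) (at (f x))" for x
    using has_real_derivative_powr[of "f x" a] powr.hyps(2)[of x]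
    by (simp add: has_field_derivative_def mult_commute_abs)
  from has_derivative_compose[OF f'(1) this]
  have "((\<lambda>x. f x powr a) has_derivative (\<lambda>v. f' x v * (a * f x powr (a - 1)))) (at x)" for x .
  moreover have "smooth_term (\<lambda>x. f' x v * (a * f x powr (a - 1)))" for v
    by (intro smooth_term.mult smooth_term.const smooth_term.powr f'(2) powr.hyps)
  ultimately show ?case
    by (intro exI[of _ "\<lambda>x v. f' x v * (a * f x powr (a - 1))"]) simp
next
  case (flat f k)
  then obtain f' where f':
    "\<And>x. (f has_derivative f' x) (at x)" "\<And>v. smooth_term (\<lambda>x. f' x v)" by blast
  have "(flat k has_derivative
      (\<lambda>h. h * (flat (k + 2) (f x) + (- real k) * flat (k + 1) (f x)))) (at (f x))" for x
    using flat_has_derivative[of k "f x"]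
    by (simp add: has_field_derivative_def mult_commute_abs)
  from has_derivative_compose[OF f'(1) this]
  have "((\<lambda>x. flat k (f x)) has_derivative
      (\<lambda>v. f' x v * (flat (k + 2) (f x) + (- real k) * flat (k + 1) (f x)))) (at x)" for x .
  moreover have "smooth_term
      (\<lambda>x. f' x v * (flat (k + 2) (f x) + (- real k) * flat (k + 1) (f x)))" for v
    by (intro smooth_term.add smooth_term.mult smooth_term.const smooth_term.flat f'(2) flat.hyps)
  ultimately show ?case
    by (intro exI[of _ "\<lambda>x v. f' x v * (flat (k + 2) (f x) + (- real k) * flat (k + 1) (f x))"])
      simp
qed

lemma smooth_term_imp_smooth:
  fixes f :: "'a::euclidean_space \<Rightarrow> real"
  assumes "smooth_term f"
  shows "smooth f"
proof -
  have "smooth_term (iter_deriv vs f)" for vs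
  proof (induction vs)
    case Nil
    then show ?case using assms by simp
  next
    case (Cons v vs)
    from smooth_term_derivative[OF Cons.IH] obtain f' where f':
      "\<And>x. (iter_deriv vs f has_derivative f' x) (at x)" "\<And>v. smooth_term (\<lambda>x. f' x v)" by blast
    have "frechet_derivative (iter_deriv vs f) (at x) = f' x" for x
      using frechet_derivative_at[OF f'(1)] by simp
    with f'(2) show ?case by simp
  qed
  from smooth_term_derivative[OF this] show ?thesis
    unfolding smooth_def differentiable_def by meson
qed

text \<open>Cited by position below: 1 constants, 2 linear forms, 3 sums, 4 products, 5 real powers
  of positive functions, 6 composition with \<open>flat k\<close>.\<close>

lemmas smooth_intros =
  smooth_term_imp_smooth[OF smooth_term.const]
  smooth_term_imp_smooth[OF smooth_term.inner]
  smooth_term_imp_smooth[OF smooth_term.add[OF smooth_term.of_smooth smooth_term.of_smooth]]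
  smooth_term_imp_smooth[OF smooth_term.mult[OF smooth_term.of_smooth smooth_term.of_smooth]]
  smooth_term_imp_smooth[OF smooth_term.powr[OF smooth_term.of_smooth]]
  smooth_term_imp_smooth[OF smooth_term.flat[OF smooth_term.of_smooth]]

lemma smooth_diff: "smooth f \<Longrightarrow> smooth g \<Longrightarrow> smooth (\<lambda>x. f x - g x)"
  using smooth_intros(3)[of f "\<lambda>x. - 1 * g x"] smooth_intros(4)[OF smooth_intros(1)[of "-1"], of g]
  by simp

lemma smooth_power2: "smooth f \<Longrightarrow> smooth (\<lambda>x. (f x)\<^sup>2)"
  unfolding power2_eq_square by (rule smooth_intros)

lemma smooth_continuous_on: "smooth f \<Longrightarrow> continuous_on S f"
  by (meson smooth_differentiable differentiable_imp_continuous_within continuous_at_imp_continuous_on)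

text \<open>Where both \<phi> and \<psi> vanish, so does \<open>w\<close>; hence its support lies in
  the union of two compact subsets of \<Omega>. Only smoothness then remains to be checked for sums,
  multiples and the regularised operations used later.\<close>

lemma test_functions_bin:
  assumes "smooth w" and "\<phi> \<in> test_functions \<Omega>" and "\<psi> \<in> test_functions \<Omega>"
    and "\<And>x. \<phi> x = 0 \<Longrightarrow> \<psi> x = 0 \<Longrightarrow> w x = 0"
  shows "w \<in> test_functions \<Omega>"
proof -
  let ?c = "closure {x. \<phi> x \<noteq> 0} \<union> closure {x. \<psi> x \<noteq> 0}"
  have "closure {x. w x \<noteq> 0} \<subseteq> closure ({x. \<phi> x \<noteq> 0} \<union> {x. \<psi> x \<noteq> 0})"
    using assms(4) by (intro closure_mono) auto
  then have s: "closure {x. w x \<noteq> 0} \<subseteq> ?c" by (simp add: closure_Un)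
  have "compact ?c" "?c \<subseteq> \<Omega>" using assms(2,3) unfolding test_functions_def by auto
  then have "compact (closure {x. w x \<noteq> 0})" "closure {x. w x \<noteq> 0} \<subseteq> \<Omega>"
    using s by (metis closed_closure compact_Int_closed inf.absorb_iff2, auto)
  with assms(1) show ?thesis unfolding test_functions_def by auto
qed

lemma test_functionsI:
  assumes "smooth w" and "\<phi> \<in> test_functions \<Omega>" and "\<And>x. \<phi> x = 0 \<Longrightarrow> w x = 0"
  shows "w \<in> test_functions \<Omega>"
  using assms by (intro test_functions_bin[of w \<phi> \<Omega> \<phi>]) auto

lemma test_functions_smooth: "\<phi> \<in> test_functions \<Omega> \<Longrightarrow> smooth \<phi>"
  by (simp add: test_functions_def)

lemma test_functions_outside: "\<phi> \<in> test_functions \<Omega> \<Longrightarrow> x \<notin> \<Omega> \<Longrightarrow> \<phi> x = 0"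
  unfolding test_functions_def using closure_subset[of "{x. \<phi> x \<noteq> 0}"] by auto

lemma test_functions_diff:
  "\<phi> \<in> test_functions \<Omega> \<Longrightarrow> \<psi> \<in> test_functions \<Omega> \<Longrightarrow> (\<lambda>x. \<phi> x - \<psi> x) \<in> test_functions \<Omega>"
  by (rule test_functions_bin[of _ \<phi> _ \<psi>]) (auto intro: smooth_diff test_functions_smooth)

lemma test_functions_add:
  "\<phi> \<in> test_functions \<Omega> \<Longrightarrow> \<psi> \<in> test_functions \<Omega> \<Longrightarrow> (\<lambda>x. \<phi> x + \<psi> x) \<in> test_functions \<Omega>"
  by (rule test_functions_bin[of _ \<phi> _ \<psi>]) (auto intro: smooth_intros(3) test_functions_smooth)

lemma test_functions_scale:
  "\<phi> \<in> test_functions \<Omega> \<Longrightarrow> (\<lambda>x. c * \<phi> x) \<in> test_functions \<Omega>"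
  by (rule test_functionsI[of _ \<phi>]) (auto intro: smooth_intros(1,4) test_functions_smooth)

lemma bump_exists:
  fixes c :: "'a::euclidean_space"
  assumes "open \<Omega>" and "c \<in> \<Omega>"
  obtains \<phi> e where "\<phi> \<in> test_functions \<Omega>" and "e > 0" and "\<And>x. \<phi> x \<ge> 0"
    and "{x. \<phi> x > 0} = ball c e"
proof -
  obtain e where e: "e > 0" "cball c e \<subseteq> \<Omega>"
    using assms open_contains_cball by blast
  \<comment> \<open>The squared distance to \<open>c\<close>, written through linear forms because
    smooth terms are generated by these.\<close>
  define q where "q = (\<lambda>x. \<Sum>i\<in>Basis. ((x - c) \<bullet> i)\<^sup>2)"
  have sum: "smooth (\<lambda>x. \<Sum>i\<in>A. ((x - c) \<bullet> i)\<^sup>2)" if "finite A" for A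
    using that
  proof induction
    case empty
    show ?case using smooth_intros(1) by simp
  next
    case (insert i A)
    then show ?case
      by (simp add: inner_diff_left)
        (intro smooth_intros(3) smooth_power2 smooth_diff smooth_intros(1,2))
  qed
  have q: "q x = (dist c x)\<^sup>2" for x
    unfolding q_def dist_norm norm_minus_commute[of c]
    by (subst power2_norm_eq_inner, subst euclidean_inner) (simp add: power2_eq_square)
  define \<phi> where "\<phi> = (\<lambda>x. flat 0 (e\<^sup>2 - q x))"
  have sm: "smooth \<phi>"
    unfolding \<phi>_def
    by (intro smooth_intros(6) smooth_diff smooth_intros(1)) (simp add: q_def sum)
  have "(dist c x)\<^sup>2 < e\<^sup>2 \<longleftrightarrow> dist c x < e" for x
    using e(1) power_strict_mono[of "dist c x" e 2] power2_less_imp_less[of "dist c x" e] by auto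
  then have pos: "\<phi> x > 0 \<longleftrightarrow> x \<in> ball c e" for x
    unfolding \<phi>_def flat_pos_iff q by simp
  have nn: "\<phi> x \<ge> 0" for x by (simp add: \<phi>_def flat_def)
  then have "{x. \<phi> x \<noteq> 0} = ball c e" using pos less_le by fastforce
  then have "\<phi> \<in> test_functions \<Omega>"
    unfolding test_functions_def using sm e by auto
  moreover have "{x. \<phi> x > 0} = ball c e" using pos by blast
  ultimately show ?thesis using that e(1) nn by blast
qed

text \<open>The partial derivatives are continuous and vanish off the compact support, so they are
  bounded; the sum of their bounds over the basis controls the operator norm of the derivative. One
  constant serves both estimates.\<close>

lemma test_functions_bounded_lipschitz:
  fixes \<phi> :: "'a::euclidean_space \<Rightarrow> real"
  assumes "\<phi> \<in> test_functions \<Omega>"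
  obtains B where "B > 0" and "\<And>x. \<bar>\<phi> x\<bar> \<le> B" and "\<And>x y. \<bar>\<phi> x - \<phi> y\<bar> \<le> B * norm (x - y)"
proof -
  let ?K = "closure {x. \<phi> x \<noteq> 0}"
  have sm: "smooth \<phi>" and cK: "compact ?K" using assms unfolding test_functions_def by auto
  let ?D = "\<lambda>v x. frechet_derivative \<phi> (at x) v"
  have hd: "(\<phi> has_derivative (\<lambda>v. ?D v x)) (at x)" for x
    using smooth_differentiable[OF sm, of x] by (simp add: frechet_derivative_works)
  have D0: "?D v x = 0" if "x \<notin> ?K" for x v
  proof -
    have "((\<lambda>x. 0) has_derivative (\<lambda>v. 0)) (at x)" by simp
    then have "(\<phi> has_derivative (\<lambda>v. 0)) (at x)"
      by (rule has_derivative_transform_within_open[where s="- ?K"])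
        (use that closure_subset[of "{x. \<phi> x \<noteq> 0}"] in auto)
    from has_derivative_unique[OF hd this] show ?thesis by meson
  qed
  have bnd: "\<exists>C. \<forall>x. \<bar>f x\<bar> \<le> C"
    if "continuous_on UNIV f" "\<And>x. x \<notin> ?K \<Longrightarrow> f x = 0" for f :: "'a \<Rightarrow> real"
  proof -
    have "compact (f ` ?K)"
      using cK that(1) by (meson compact_continuous_image continuous_on_subset subset_UNIV)
    then obtain C where C: "\<forall>x\<in>?K. \<bar>f x\<bar> \<le> C"
      by (metis bounded_iff compact_imp_bounded image_eqI real_norm_def)
    then have "\<bar>f x\<bar> \<le> \<bar>C\<bar>" for x
      using that(2)[of x] by (cases "x \<in> ?K") (force, simp)
    then show ?thesis by blast
  qed
  have "\<exists>C. \<forall>x. \<bar>?D v x\<bar> \<le> C" for v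
    by (intro bnd smooth_continuous_on smooth_frechet_derivative sm D0)
  then obtain C where C: "\<And>v x. \<bar>?D v x\<bar> \<le> C v" by metis
  obtain C0 where C0: "\<And>x. \<bar>\<phi> x\<bar> \<le> C0"
    using bnd[OF smooth_continuous_on[OF sm]] closure_subset[of "{x. \<phi> x \<noteq> 0}"] by blast
  let ?L = "\<Sum>b\<in>Basis. C b"
  have lin: "linear (\<lambda>v. ?D v x)" for x using hd has_derivative_linear by blast
  have on: "onorm (\<lambda>v. ?D v x) \<le> ?L" for x
  proof (rule onorm_le)
    fix v :: 'a
    have "?D v x = ?D (\<Sum>b\<in>Basis. (v \<bullet> b) *\<^sub>R b) x"
      by (simp add: euclidean_representation)
    also have "\<dots> = (\<Sum>b\<in>Basis. (v \<bullet> b) * ?D b x)"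
      by (simp add: linear_sum[OF lin] linear_scale[OF lin])
    also have "norm \<dots> \<le> (\<Sum>b\<in>Basis. norm v * C b)"
      by (rule sum_norm_le) (auto simp: abs_mult intro!: mult_mono C Basis_le_norm)
    finally show "norm (?D v x) \<le> ?L * norm v" by (simp add: sum_distrib_left mult.commute)
  qed
  have lip: "norm (\<phi> x - \<phi> y) \<le> ?L * norm (x - y)" for x y
    by (rule differentiable_bound[OF convex_UNIV]) (use hd on in auto)
  define B where "B = max 1 (max C0 ?L)"
  show ?thesis
  proof (rule that[of B])
    show "\<bar>\<phi> x - \<phi> y\<bar> \<le> B * norm (x - y)" for x y
    proof -
      have "?L * norm (x - y) \<le> B * norm (x - y)" by (intro mult_right_mono) (auto simp: B_def)
      with lip[of x y] show ?thesis by simp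
    qed
    show "\<bar>\<phi> x\<bar> \<le> B" for x using C0[of x] by (auto simp: B_def)
  qed (auto simp: B_def)
qed

subsection \<open>Integrals of \<open>p\<close>-th powers\<close>

text \<open>Convexity up to the endpoint 0, where it reduces to \<open>s powr p \<le> s\<close> on
  the unit interval.\<close>

lemma convex_on_powr_nonneg:
  assumes "p \<ge> 1"
  shows "convex_on {0..} (\<lambda>x::real. x powr p)"
proof (rule convex_onI)
  fix t x y :: real
  assume t: "0 < t" "t < 1" and xy: "x \<in> {0..}" "y \<in> {0..}"
  have le: "s powr p \<le> s" if "0 < s" "s < 1" for s :: real
    using powr_mono'[OF assms, of s] that by simp
  show "((1 - t) *\<^sub>R x + t *\<^sub>R y) powr p \<le> (1 - t) * x powr p + t * y powr p"
  proof (cases "x = 0 \<or> y = 0")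
    case True
    then show ?thesis
      using le[of t] le[of "1 - t"] t xy assms by (auto simp: powr_mult intro!: mult_right_mono)
  next
    case False
    then show ?thesis
      using convex_onD[OF powr_convex[OF assms], of t x y] t xy by auto
  qed
qed simp

text \<open>Convexity at the points \<open>|a| / (1 - \<theta>)\<close> and
  \<open>|b| / \<theta>\<close>. The free weight matters: as \<theta> tends to 0 the coefficient of
  \<open>|a|^p\<close> tends to 1, and with \<theta> a quotient of function values this becomes
  Picone's inequality.\<close>

lemma powr_abs_sum_le:
  fixes a b :: real
  assumes "p \<ge> 1" and "0 < \<theta>" and "\<theta> < 1"
  shows "\<bar>a + b\<bar> powr p \<le> (1 - \<theta>) powr (1 - p) * \<bar>a\<bar> powr p + \<theta> powr (1 - p) * \<bar>b\<bar> powr p"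
proof -
  have conv: "convex_on {0..} (\<lambda>x::real. x powr p)"
    using convex_on_powr_nonneg[OF assms(1)] .
  let ?A = "\<bar>a\<bar> / (1 - \<theta>)" and ?B = "\<bar>b\<bar> / \<theta>"
  have "\<bar>a + b\<bar> powr p \<le> (\<bar>a\<bar> + \<bar>b\<bar>) powr p"
    using assms by (intro powr_mono2) auto
  also have "\<bar>a\<bar> + \<bar>b\<bar> = (1 - \<theta>) *\<^sub>R ?A + \<theta> *\<^sub>R ?B" using assms by simp
  also have "\<dots> powr p \<le> (1 - \<theta>) * ?A powr p + \<theta> * ?B powr p"
    using convex_onD[OF conv, of \<theta> ?A ?B] assms by simp
  also have "\<dots> = (1 - \<theta>) powr (1 - p) * \<bar>a\<bar> powr p + \<theta> powr (1 - p) * \<bar>b\<bar> powr p"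
    using assms by (simp add: powr_divide powr_diff)
  finally show ?thesis .
qed

lemma powr_abs_sum_le2:
  fixes a b :: real
  assumes "p \<ge> 1"
  shows "\<bar>a + b\<bar> powr p \<le> 2 powr p * (\<bar>a\<bar> powr p + \<bar>b\<bar> powr p)"
proof -
  have "\<bar>a + b\<bar> powr p \<le> (1/2) powr (1 - p) * (\<bar>a\<bar> powr p + \<bar>b\<bar> powr p)"
    using powr_abs_sum_le[OF assms, of "1/2" a b] by (simp add: distrib_left)
  also have "(1/2 :: real) powr (1 - p) = 2 powr (p - 1)"
    by (simp add: powr_divide powr_diff)
  also have "(2::real) powr (p - 1) * (\<bar>a\<bar> powr p + \<bar>b\<bar> powr p) \<le> 2 powr p * (\<bar>a\<bar> powr p + \<bar>b\<bar> powr p)"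
    by (intro mult_right_mono) auto
  finally show ?thesis .
qed

text \<open>By homogeneity one may take \<open>x + y = 1\<close>, where each power is at most its
  base.\<close>

lemma powr_superadd:
  fixes x y :: real
  assumes "q \<ge> 1" "x \<ge> 0" "y \<ge> 0"
  shows "x powr q + y powr q \<le> (x + y) powr q"
proof (cases "x + y = 0")
  case True
  then have "x = 0" "y = 0" using assms by linarith+
  then show ?thesis using assms by simp
next
  case False
  then have pos: "x + y > 0" using assms by linarith
  have le: "t powr q \<le> t" if "0 \<le> t" "t \<le> 1" for t :: real
    using powr_mono'[OF assms(1) that] that by simp
  have "(x / (x + y)) powr q + (y / (x + y)) powr q \<le> x / (x + y) + y / (x + y)"
    using pos assms by (intro add_mono le) auto
  also have "\<dots> = 1" using pos by (simp add: add_divide_distrib[symmetric])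
  finally show ?thesis using pos assms by (simp add: powr_divide add_divide_distrib[symmetric])
qed

text \<open>With \<open>|t|^p = (t^2)^(p/2)\<close>, superadditivity merges the two terms on the
  left, the parallelogram identity evaluates the sum of squares, and convexity of
  \<open>t^(p/2)\<close> separates them again.\<close>

lemma clarkson_powr:
  fixes a b :: real
  assumes "p \<ge> 2"
  shows "\<bar>(a + b) / 2\<bar> powr p + \<bar>(a - b) / 2\<bar> powr p \<le> (\<bar>a\<bar> powr p + \<bar>b\<bar> powr p) / 2"
proof -
  have sq: "\<bar>t\<bar> powr p = (t\<^sup>2) powr (p / 2)" for t :: real
    by (metis abs_ge_zero power2_abs powr_numeral powr_powr mult.commute nonzero_mult_div_cancel_right
        times_divide_eq_right zero_neq_numeral)
  have conv: "convex_on {0..} (\<lambda>x::real. x powr (p / 2))"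
    using assms by (intro convex_on_powr_nonneg) auto
  have "\<bar>(a + b) / 2\<bar> powr p + \<bar>(a - b) / 2\<bar> powr p
      \<le> (((a + b) / 2)\<^sup>2 + ((a - b) / 2)\<^sup>2) powr (p / 2)"
    unfolding sq using assms by (intro powr_superadd) auto
  also have "((a + b) / 2)\<^sup>2 + ((a - b) / 2)\<^sup>2 = (1 - 1/2) *\<^sub>R a\<^sup>2 + (1/2) *\<^sub>R b\<^sup>2"
    by (simp add: field_simps power2_eq_square)
  also have "\<dots> powr (p / 2) \<le> (1 - 1/2) * (a\<^sup>2) powr (p / 2) + 1/2 * (b\<^sup>2) powr (p / 2)"
    by (rule convex_onD[OF conv]) auto
  finally show ?thesis unfolding sq by simp
qed

section \<open>The odd power \<open>|t|^(p-2) t\<close> and Young's inequality\<close>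

lemma signed_powr_mult_self:
  "p > 0 \<Longrightarrow> signed_powr p a * a = \<bar>a\<bar> powr p"
proof (cases "a = 0")
  case False
  have "\<bar>a\<bar> powr p = \<bar>a\<bar> powr (p - 2) * \<bar>a\<bar> powr 2"
    by (simp only: powr_add[symmetric]) simp
  also have "\<bar>a\<bar> powr 2 = a * a" using False by (simp add: power2_eq_square[symmetric])
  finally show ?thesis by (simp add: signed_powr_def mult.assoc)
qed (simp add: signed_powr_def)

lemma abs_signed_powr:
  "p > 1 \<Longrightarrow> \<bar>signed_powr p a\<bar> = \<bar>a\<bar> powr (p - 1)"
proof (cases "a = 0")
  case False
  have "\<bar>a\<bar> powr (p - 1) = \<bar>a\<bar> powr (p - 2) * \<bar>a\<bar> powr 1"
    by (simp only: powr_add[symmetric]) simp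
  then show ?thesis using False by (simp add: signed_powr_def abs_mult)
qed (simp add: signed_powr_def)

lemma signed_powr_scale: "signed_powr p (c * a) = signed_powr p c * signed_powr p a"
  by (simp add: signed_powr_def abs_mult powr_mult)

lemma signed_powr_minus: "signed_powr p (- a) = - signed_powr p a"
  by (simp add: signed_powr_def)

lemma signed_powr_nonneg: "p > 1 \<Longrightarrow> a \<ge> 0 \<Longrightarrow> signed_powr p a = a powr (p - 1)"
  using abs_signed_powr[of p a] by (simp add: signed_powr_def)

lemma signed_powr_measurable[measurable]:
  "f \<in> borel_measurable M \<Longrightarrow> (\<lambda>x. signed_powr p (f x)) \<in> borel_measurable M"
  unfolding signed_powr_def by measurable

text \<open>Distinguish whether \<open>|b|\<close> exceeds \<open>K |a|\<close>; each case is
  bounded by one of the two terms. A large \<open>K\<close> makes the coefficient of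
  \<open>|b|^p\<close> small, at the price of the fixed majorant \<open>K |a|^p\<close>.\<close>

lemma young_powr:
  fixes a b :: real
  assumes "p > 1" and "K > 0"
  shows "\<bar>a\<bar> powr (p - 1) * \<bar>b\<bar> \<le> K * \<bar>a\<bar> powr p + K powr (1 - p) * \<bar>b\<bar> powr p"
proof (cases "\<bar>b\<bar> \<le> K * \<bar>a\<bar>")
  case True
  have "\<bar>a\<bar> powr (p - 1) * \<bar>b\<bar> \<le> \<bar>a\<bar> powr (p - 1) * (K * \<bar>a\<bar> powr 1)"
    using True by (intro mult_left_mono) auto
  also have "\<dots> = K * (\<bar>a\<bar> powr (p - 1) * \<bar>a\<bar> powr 1)" by (simp add: mult_ac)
  also have "\<dots> = K * \<bar>a\<bar> powr p"
    by (simp only: powr_add[symmetric]) simp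
  finally show ?thesis by (simp add: add_increasing2)
next
  case False
  then have "\<bar>a\<bar> \<le> \<bar>b\<bar> / K" using assms by (simp add: field_simps)
  then have "\<bar>a\<bar> powr (p - 1) \<le> (\<bar>b\<bar> / K) powr (p - 1)"
    using assms by (intro powr_mono2) auto
  also have "\<dots> = K powr (1 - p) * \<bar>b\<bar> powr (p - 1)"
    using assms by (simp add: powr_divide powr_diff)
  finally have "\<bar>a\<bar> powr (p - 1) * \<bar>b\<bar> \<le> K powr (1 - p) * \<bar>b\<bar> powr (p - 1) * \<bar>b\<bar> powr 1"
    by (simp add: mult_right_mono)
  also have "\<dots> = K powr (1 - p) * \<bar>b\<bar> powr p"
    by (simp only: powr_add[symmetric] mult.assoc) simp
  finally show ?thesis using assms by (simp add: add_increasing)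
qed

section \<open>Functions with integrable p-th power over an arbitrary measure\<close>

definition Lpow :: "'z measure \<Rightarrow> real \<Rightarrow> ('z \<Rightarrow> real) \<Rightarrow> bool" where
  "Lpow N p a \<longleftrightarrow> a \<in> borel_measurable N \<and> integrable N (\<lambda>z. \<bar>a z\<bar> powr p)"

definition Jpow :: "'z measure \<Rightarrow> real \<Rightarrow> ('z \<Rightarrow> real) \<Rightarrow> real" where
  "Jpow N p a = (\<integral>z. \<bar>a z\<bar> powr p \<partial>N)"

lemma Jpow_nonneg: "Jpow N p a \<ge> 0"
  by (simp add: Jpow_def)

lemma LpowD:
  assumes "Lpow N p a"
  shows "a \<in> borel_measurable N" and "integrable N (\<lambda>z. \<bar>a z\<bar> powr p)"
  using assms by (auto simp: Lpow_def)

lemma Lpow_bound: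
  assumes "Lpow N p b" and "a \<in> borel_measurable N"
    and "\<And>z. \<bar>a z\<bar> powr p \<le> c * \<bar>b z\<bar> powr p"
  shows "Lpow N p a" and "Jpow N p a \<le> c * Jpow N p b"
proof -
  note [measurable] = assms(2)
  have i: "integrable N (\<lambda>z. c * \<bar>b z\<bar> powr p)" using LpowD(2)[OF assms(1)] by simp
  have "integrable N (\<lambda>z. \<bar>a z\<bar> powr p)"
    by (rule Bochner_Integration.integrable_bound[OF i]) (use assms(3) in \<open>auto intro: order.trans[OF _ abs_ge_self]\<close>)
  then show "Lpow N p a" using assms(2) by (simp add: Lpow_def)
  show "Jpow N p a \<le> c * Jpow N p b"
    unfolding Jpow_def integral_mult_right_zero[symmetric]
    by (rule integral_mono) (use i assms(3) \<open>integrable N (\<lambda>z. \<bar>a z\<bar> powr p)\<close> in auto)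
qed

lemma Lpow_contract:
  assumes "Lpow N p b" and "a \<in> borel_measurable N" and "\<And>z. \<bar>a z\<bar> \<le> \<bar>b z\<bar>" and "p \<ge> 0"
  shows "Lpow N p a" and "Jpow N p a \<le> Jpow N p b"
  using Lpow_bound[OF assms(1,2), of 1] powr_mono2[OF assms(4) abs_ge_zero assms(3)] by auto

lemma Lpow_scale:
  assumes "Lpow N p a"
  shows "Lpow N p (\<lambda>z. c * a z)" and "Jpow N p (\<lambda>z. c * a z) = \<bar>c\<bar> powr p * Jpow N p a"
  using assms by (auto simp: Lpow_def Jpow_def abs_mult powr_mult)

lemma Lpow_add:
  assumes "Lpow N p a" and "Lpow N p b" and "p \<ge> 1"
  shows "Lpow N p (\<lambda>z. a z + b z)"
    and "0 < \<theta> \<Longrightarrow> \<theta> < 1 \<Longrightarrow>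
      Jpow N p (\<lambda>z. a z + b z) \<le> (1 - \<theta>) powr (1 - p) * Jpow N p a + \<theta> powr (1 - p) * Jpow N p b"
    and "Jpow N p (\<lambda>z. a z + b z) \<le> 2 powr p * (Jpow N p a + Jpow N p b)"
proof -
  note [measurable] = LpowD(1)[OF assms(1)] LpowD(1)[OF assms(2)]
  note ab = LpowD(2)[OF assms(1)] LpowD(2)[OF assms(2)]
  have i: "integrable N (\<lambda>z. 2 powr p * (\<bar>a z\<bar> powr p + \<bar>b z\<bar> powr p))" using ab by simp
  have j: "integrable N (\<lambda>z. \<bar>a z + b z\<bar> powr p)"
    by (rule Bochner_Integration.integrable_bound[OF i])
      (use powr_abs_sum_le2[OF assms(3)] in \<open>auto intro: order.trans[OF _ abs_ge_self]\<close>)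
  then show "Lpow N p (\<lambda>z. a z + b z)" by (simp add: Lpow_def)
  have "Jpow N p (\<lambda>z. a z + b z) \<le> (\<integral>z. 2 powr p * (\<bar>a z\<bar> powr p + \<bar>b z\<bar> powr p) \<partial>N)"
    unfolding Jpow_def by (rule integral_mono[OF j i]) (rule powr_abs_sum_le2[OF assms(3)])
  with ab show "Jpow N p (\<lambda>z. a z + b z) \<le> 2 powr p * (Jpow N p a + Jpow N p b)"
    by (simp add: Jpow_def)
  assume t: "0 < \<theta>" "\<theta> < 1"
  have "Jpow N p (\<lambda>z. a z + b z) \<le>
      (\<integral>z. (1 - \<theta>) powr (1 - p) * \<bar>a z\<bar> powr p + \<theta> powr (1 - p) * \<bar>b z\<bar> powr p \<partial>N)"
    unfolding Jpow_def by (rule integral_mono[OF j])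
      (use ab powr_abs_sum_le[OF assms(3) t] in auto)
  with ab show "Jpow N p (\<lambda>z. a z + b z) \<le> (1 - \<theta>) powr (1 - p) * Jpow N p a + \<theta> powr (1 - p) * Jpow N p b"
    by (simp add: Jpow_def)
qed

lemma Lpow_diff:
  assumes "Lpow N p a" and "Lpow N p b" and "p \<ge> 1"
  shows "Lpow N p (\<lambda>z. a z - b z)"
    and "Jpow N p (\<lambda>z. a z - b z) \<le> 2 powr p * (Jpow N p a + Jpow N p b)"
  using Lpow_add[OF assms(1) Lpow_scale(1)[OF assms(2), of "-1"] assms(3)]
    Lpow_scale(2)[OF assms(2), of "-1"] by auto

text \<open>The bounds may depend on \<open>k\<close> and only their limit survives, as is needed
  for minimising sequences. Integrability of the limit is part of the conclusion.\<close>

lemma Fatou_bounded: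
  fixes f :: "nat \<Rightarrow> 'z \<Rightarrow> real"
  assumes int: "\<And>k. integrable N (f k)" and nn: "\<And>k z. f k z \<ge> 0"
    and le: "\<And>k. (\<integral>z. f k z \<partial>N) \<le> M k" and M: "M \<longlonglongrightarrow> m"
    and lim: "AE z in N. (\<lambda>k. f k z) \<longlonglongrightarrow> g z" and [measurable]: "g \<in> borel_measurable N"
  shows "integrable N g" and "(\<integral>z. g z \<partial>N) \<le> m"
proof -
  have g0: "AE z in N. 0 \<le> g z" using lim by eventually_elim (auto intro: LIMSEQ_le_const nn)
  have m0: "0 \<le> m"
    using LIMSEQ_le_const[OF M, of 0] order.trans[OF Bochner_Integration.integral_nonneg[OF nn] le] by blast
  have "(\<integral>\<^sup>+z. ennreal (g z) \<partial>N) = (\<integral>\<^sup>+z. liminf (\<lambda>k. ennreal (f k z)) \<partial>N)"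
    by (rule nn_integral_cong_AE) (use lim in \<open>eventually_elim, auto intro!: lim_imp_Liminf[symmetric] tendsto_ennrealI\<close>)
  also have "\<dots> \<le> liminf (\<lambda>k. \<integral>\<^sup>+z. ennreal (f k z) \<partial>N)"
    by (rule nn_integral_liminf) (use int in \<open>auto simp: borel_measurable_integrable\<close>)
  also have "\<dots> \<le> liminf (\<lambda>k. ennreal (M k))"
    by (intro Liminf_mono always_eventually allI) (simp add: nn_integral_eq_integral int nn le ennreal_leI)
  also have "\<dots> = ennreal m"
    using M by (intro lim_imp_Liminf tendsto_ennrealI) auto
  finally have *: "(\<integral>\<^sup>+z. ennreal (g z) \<partial>N) \<le> ennreal m" .
  show "integrable N g"
    by (rule integrableI_nonneg) (use g0 * in \<open>auto intro: le_less_trans\<close>)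
  then have "ennreal (\<integral>z. g z \<partial>N) \<le> ennreal m" using * g0 by (simp add: nn_integral_eq_integral)
  then show "(\<integral>z. g z \<partial>N) \<le> m" using m0 by (simp add: ennreal_le_iff)
qed

lemma tendsto_abs_powr:
  "(f \<longlongrightarrow> a) F \<Longrightarrow> p > 0 \<Longrightarrow> ((\<lambda>x. \<bar>f x\<bar> powr p) \<longlongrightarrow> \<bar>a\<bar> powr p) F" for a :: real
  by (intro tendsto_powr' tendsto_intros) auto

lemma Lpow_Fatou:
  assumes "\<And>k. Lpow N p (c k)" and "\<And>k. Jpow N p (c k) \<le> M k" and "M \<longlonglongrightarrow> m"
    and "AE z in N. (\<lambda>k. c k z) \<longlonglongrightarrow> a z" and [measurable]: "a \<in> borel_measurable N" and "p > 0"
  shows "Lpow N p a" and "Jpow N p a \<le> m"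
proof -
  have "AE z in N. (\<lambda>k. \<bar>c k z\<bar> powr p) \<longlonglongrightarrow> \<bar>a z\<bar> powr p"
    using assms(4) by eventually_elim (intro tendsto_abs_powr assms(6))
  from Fatou_bounded[OF LpowD(2)[OF assms(1)] _ _ assms(3) this]
  show "Lpow N p a" "Jpow N p a \<le> m"
    using assms(2) by (auto simp: Jpow_def Lpow_def)
qed

lemma Lpow_clarkson:
  assumes "Lpow N p a" and "Lpow N p b" and "p \<ge> 2"
  shows "Jpow N p (\<lambda>z. (a z + b z) / 2) + Jpow N p (\<lambda>z. (a z - b z) / 2) \<le> (Jpow N p a + Jpow N p b) / 2"
proof -
  note ab = LpowD(2)[OF assms(1)] LpowD(2)[OF assms(2)]
  have "Lpow N p (\<lambda>z. (a z + b z) / 2)" "Lpow N p (\<lambda>z. (a z - b z) / 2)"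
    using Lpow_scale(1)[OF Lpow_add(1)[OF assms(1,2)], of "1/2"]
      Lpow_scale(1)[OF Lpow_diff(1)[OF assms(1,2)], of "1/2"] assms(3) by auto
  note i = LpowD(2)[OF this(1)] LpowD(2)[OF this(2)]
  have "Jpow N p (\<lambda>z. (a z + b z) / 2) + Jpow N p (\<lambda>z. (a z - b z) / 2)
     = (\<integral>z. \<bar>(a z + b z) / 2\<bar> powr p + \<bar>(a z - b z) / 2\<bar> powr p \<partial>N)"
    unfolding Jpow_def by (rule Bochner_Integration.integral_add[symmetric]) (use i in auto)
  also have "\<dots> \<le> (\<integral>z. (\<bar>a z\<bar> powr p + \<bar>b z\<bar> powr p) / 2 \<partial>N)"
    by (rule integral_mono) (use i ab clarkson_powr[OF assms(3)] in auto)
  also have "\<dots> = (Jpow N p a + Jpow N p b) / 2" using ab by (simp add: Jpow_def)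
  finally show ?thesis .
qed

lemma Lpow_pairing_integrable:
  assumes "Lpow N p a" and "Lpow N p b" and "p > 1"
  shows "integrable N (\<lambda>z. signed_powr p (a z) * b z)"
proof -
  note [measurable] = LpowD(1)[OF assms(1)] LpowD(1)[OF assms(2)]
  have i: "integrable N (\<lambda>z. \<bar>a z\<bar> powr p + \<bar>b z\<bar> powr p)"
    using LpowD(2)[OF assms(1)] LpowD(2)[OF assms(2)] by simp
  show ?thesis
    by (rule Bochner_Integration.integrable_bound[OF i])
      (use young_powr[OF assms(3), of 1] in \<open>auto simp: abs_mult abs_signed_powr assms(3)\<close>)
qed

text \<open>Pointwise convergence and bounded p-th powers give weak convergence against
  \<open>|a|^(p-1)\<close>. By Young's inequality, the part of the integrand exceeding
  \<open>K^(1-p) |c k - b|^p\<close> is dominated by \<open>K |a|^p\<close>, so its integral tends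
  to 0 for fixed \<open>K\<close>; the remaining part is at most a constant times
  \<open>K^(1-p)\<close>, uniformly in \<open>k\<close>.\<close>

lemma Lpow_weak_limit:
  assumes a: "Lpow N p a" and c: "\<And>k. Lpow N p (c k)" and M: "\<And>k. Jpow N p (c k) \<le> M"
    and lim: "AE z in N. (\<lambda>k. c k z) \<longlonglongrightarrow> b z" and bm[measurable]: "b \<in> borel_measurable N"
    and p: "p > 1"
  shows "Lpow N p b" and "(\<lambda>k. \<integral>z. signed_powr p (a z) * c k z \<partial>N) \<longlonglongrightarrow> (\<integral>z. signed_powr p (a z) * b z \<partial>N)"
proof -
  have b: "Lpow N p b" "Jpow N p b \<le> M"
    using Lpow_Fatou[OF c M tendsto_const lim bm] p by auto
  then show "Lpow N p b" by simp
  note [measurable] = LpowD(1)[OF a] LpowD(1)[OF c]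
  have d: "Lpow N p (\<lambda>z. c k z - b z)" "Jpow N p (\<lambda>z. c k z - b z) \<le> 2 powr p * (M + M)" for k
  proof -
    show "Lpow N p (\<lambda>z. c k z - b z)" using Lpow_diff[OF c b(1)] p by simp
    have "2 powr p * (Jpow N p (c k) + Jpow N p b) \<le> 2 powr p * (M + M)"
      using M[of k] b(2) by (intro mult_left_mono add_mono) auto
    then show "Jpow N p (\<lambda>z. c k z - b z) \<le> 2 powr p * (M + M)"
      using Lpow_diff(2)[OF c[of k] b(1)] p by linarith
  qed
  let ?C = "2 powr p * (M + M)"
  have C0: "?C \<ge> 0" using order.trans[OF Jpow_nonneg d(2)] .
  \<comment> \<open>The excess left by Young's inequality. It is nonnegative, at most
    \<open>K |a|^p\<close> and tends to 0 almost everywhere.\<close>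
  define R where "R K k z = max 0 (\<bar>signed_powr p (a z) * (c k z - b z)\<bar> - K powr (1 - p) * \<bar>c k z - b z\<bar> powr p)"
    for K :: real and k z
  have R: "R K k z \<le> K * \<bar>a z\<bar> powr p" if "K > 0" for K k z
    using young_powr[OF p that, of "a z" "c k z - b z"] that
    by (auto simp: R_def abs_mult abs_signed_powr p)
  have [measurable]: "R K k \<in> borel_measurable N" for K k unfolding R_def by measurable
  have R0: "(\<lambda>k. \<integral>z. R K k z \<partial>N) \<longlonglongrightarrow> (\<integral>z. 0 \<partial>N)" and Ri: "integrable N (R K k)" if K: "K > 0" for K k
  proof -
    have i: "integrable N (\<lambda>z. K * \<bar>a z\<bar> powr p)" using LpowD(2)[OF a] by simp
    have l: "AE z in N. (\<lambda>k. R K k z) \<longlonglongrightarrow> 0"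
      using lim
    proof eventually_elim
      case (elim z)
      have d0: "(\<lambda>k. c k z - b z) \<longlonglongrightarrow> 0" using elim by (simp add: LIM_zero)
      then have "(\<lambda>k. \<bar>c k z - b z\<bar> powr p) \<longlonglongrightarrow> \<bar>0\<bar> powr p"
        using p by (intro tendsto_abs_powr) auto
      with d0 have "(\<lambda>k. R K k z) \<longlonglongrightarrow> max 0 (\<bar>signed_powr p (a z) * 0\<bar> - K powr (1 - p) * \<bar>0\<bar> powr p)"
        unfolding R_def by (intro tendsto_max tendsto_diff tendsto_mult tendsto_const tendsto_rabs)
      then show ?case by simp
    qed
    have bd: "AE z in N. norm (R K k z) \<le> K * \<bar>a z\<bar> powr p" for k
      using R[OF K] by (auto simp: R_def)
    show "(\<lambda>k. \<integral>z. R K k z \<partial>N) \<longlonglongrightarrow> (\<integral>z. 0 \<partial>N)"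
      by (rule integral_dominated_convergence[OF _ _ i l bd]) auto
    show "integrable N (R K k)"
      by (rule Bochner_Integration.integrable_bound[OF i]) (use bd[of k] in auto)
  qed
  have main: "(\<lambda>k. (\<integral>z. signed_powr p (a z) * c k z \<partial>N) - (\<integral>z. signed_powr p (a z) * b z \<partial>N)) \<longlonglongrightarrow> 0"
  proof (rule LIMSEQ_I)
    fix e :: real assume e: "e > 0"
    \<comment> \<open>The parameter \<open>K\<close> is fixed before the index, so that the uniform
      term is below \<open>e / 2\<close> for all \<open>k\<close>.\<close>
    have "((\<lambda>K. K powr (1 - p) * ?C) \<longlongrightarrow> 0 * ?C) at_top"
      by (intro tendsto_mult tendsto_const) (use p in \<open>auto intro: tendsto_neg_powr filterlim_ident\<close>)
    then have "eventually (\<lambda>K. K powr (1 - p) * ?C < e / 2) at_top"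
      by (rule order_tendstoD(2)) (use e in simp)
    from eventually_happens[OF eventually_conj[OF eventually_gt_at_top[of 0] this]]
    obtain K where K: "K > 0" "K powr (1 - p) * ?C < e / 2"
      by auto
    have "eventually (\<lambda>k. (\<integral>z. R K k z \<partial>N) < e / 2) sequentially"
      using order_tendstoD(2)[OF R0[OF K(1)], of "e / 2"] e by simp
    then obtain k0 where k0: "\<And>k. k \<ge> k0 \<Longrightarrow> (\<integral>z. R K k z \<partial>N) < e / 2"
      by (auto simp: eventually_sequentially)
    show "\<exists>k0. \<forall>k\<ge>k0. norm ((\<integral>z. signed_powr p (a z) * c k z \<partial>N) - (\<integral>z. signed_powr p (a z) * b z \<partial>N) - 0) < e"
    proof (intro exI allI impI)
      fix k assume k: "k \<ge> k0"
      have "(\<integral>z. signed_powr p (a z) * c k z \<partial>N) - (\<integral>z. signed_powr p (a z) * b z \<partial>N)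
        = (\<integral>z. signed_powr p (a z) * c k z - signed_powr p (a z) * b z \<partial>N)"
        by (rule Bochner_Integration.integral_diff[symmetric]) (intro Lpow_pairing_integrable a b(1) c p)+
      also have "\<dots> = (\<integral>z. signed_powr p (a z) * (c k z - b z) \<partial>N)"
        by (simp add: right_diff_distrib)
      also have "norm \<dots> \<le> (\<integral>z. norm (signed_powr p (a z) * (c k z - b z)) \<partial>N)"
        by (rule integral_norm_bound)
      also have "\<dots> \<le> (\<integral>z. R K k z + K powr (1 - p) * \<bar>c k z - b z\<bar> powr p \<partial>N)"
        by (rule integral_mono)
          (use Ri[OF K(1), of k] LpowD(2)[OF d(1)] Lpow_pairing_integrable[OF a d(1) p]
            in \<open>auto simp: R_def\<close>)
      also have "\<dots> = (\<integral>z. R K k z \<partial>N) + K powr (1 - p) * Jpow N p (\<lambda>z. c k z - b z)"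
        using Ri[OF K(1), of k] LpowD(2)[OF d(1)[of k]] by (simp add: Jpow_def)
      also have "\<dots> < e / 2 + e / 2"
        using k0[OF k] K(2) mult_left_mono[OF d(2)[of k], of "K powr (1 - p)"] by auto
      finally show "norm ((\<integral>z. signed_powr p (a z) * c k z \<partial>N) - (\<integral>z. signed_powr p (a z) * b z \<partial>N) - 0) < e"
        by simp
    qed
  qed
  then show "(\<lambda>k. \<integral>z. signed_powr p (a z) * c k z \<partial>N) \<longlonglongrightarrow> (\<integral>z. signed_powr p (a z) * b z \<partial>N)"
    by (rule LIM_zero_cancel)
qed

lemma has_derivative_abs_powr:
  fixes a :: real
  assumes "p > 1"
  shows "((\<lambda>t. \<bar>t\<bar> powr p) has_real_derivative p * signed_powr p a) (at a)"
proof (cases "a = 0")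
  case True
  have "((\<lambda>h. \<bar>h\<bar> powr (p - 1)) \<longlongrightarrow> \<bar>0\<bar> powr (p - 1)) (at (0::real))"
    using assms by (intro tendsto_abs_powr tendsto_ident_at) auto
  then have "((\<lambda>h. \<bar>h\<bar> powr (p - 1)) \<longlongrightarrow> 0) (at (0::real))" by simp
  moreover have "eventually (\<lambda>h. \<bar>h\<bar> powr (p - 1) = \<bar>\<bar>h\<bar> powr p / h\<bar>) (at (0::real))"
    unfolding eventually_at_filter
    by (intro always_eventually allI impI) (simp add: powr_diff abs_divide)
  ultimately have "((\<lambda>h::real. \<bar>\<bar>h\<bar> powr p / h\<bar>) \<longlongrightarrow> 0) (at 0)"
    by (rule Lim_transform_eventually)
  then have "((\<lambda>h::real. \<bar>h\<bar> powr p / h) \<longlongrightarrow> 0) (at 0)"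
    by (rule tendsto_rabs_zero_cancel)
  with True show ?thesis by (simp add: DERIV_def signed_powr_def)
next
  case False
  have "((\<lambda>t. sgn a * t) has_real_derivative sgn a) (at a)"
    by (auto intro!: derivative_eq_intros)
  then have abs: "(abs has_real_derivative sgn a) (at a)"
    by (rule has_field_derivative_transform_within_open[where S="{t. 0 < sgn a * t}"])
      (use False in \<open>auto simp: sgn_if zero_less_mult_iff intro: open_Collect_less continuous_intros split: if_splits\<close>)
  have "((\<lambda>t. \<bar>t\<bar> powr p) has_real_derivative p * \<bar>a\<bar> powr (p - 1) * sgn a) (at a)"
    using DERIV_chain2[OF has_real_derivative_powr[of "\<bar>a\<bar>" p] abs] False by simp
  moreover have "\<bar>a\<bar> powr (p - 1) * sgn a = signed_powr p a"
  proof -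
    have "\<bar>a\<bar> powr (p - 1) = \<bar>a\<bar> powr (p - 2) * \<bar>a\<bar> powr 1"
      by (simp only: powr_add[symmetric]) simp
    then show ?thesis using False by (simp add: signed_powr_def abs_mult_sgn mult.assoc)
  qed
  ultimately show ?thesis by (simp add: mult.assoc)
qed

text \<open>The secant slopes of a convex function at \<open>a\<close> over steps
  \<open>t \<le> 1\<close> lie between those over the steps -1 and 1. This gives a majorant
  independent of \<open>t\<close> for differentiation under the integral.\<close>

lemma abs_powr_slope_bound:
  fixes a b t :: real
  assumes "p \<ge> 1" and "0 < t" and "t \<le> 1"
  shows "\<bar>(\<bar>a + t * b\<bar> powr p - \<bar>a\<bar> powr p) / t\<bar> \<le> \<bar>a + b\<bar> powr p + \<bar>a - b\<bar> powr p"
proof -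
  have conv: "convex_on UNIV (\<lambda>x::real. \<bar>x\<bar> powr p)"
  proof (rule convex_onI)
    fix s x y :: real assume s: "0 < s" "s < 1"
    show "\<bar>(1 - s) *\<^sub>R x + s *\<^sub>R y\<bar> powr p \<le> (1 - s) * \<bar>x\<bar> powr p + s * \<bar>y\<bar> powr p"
      using powr_abs_sum_le[OF assms(1) s, of "(1 - s) * x" "s * y"] s
      by (simp add: abs_mult powr_mult powr_diff)
  qed simp
  let ?h = "\<lambda>x::real. \<bar>x\<bar> powr p"
  have 1: "?h (a + t * b) \<le> (1 - t) * ?h a + t * ?h (a + b)"
    using convex_onD[OF conv, of t a "a + b"] assms by (simp add: algebra_simps)
  \<comment> \<open>For the lower bound, \<open>a\<close> is written as a convex combination of
    \<open>a + t b\<close> and \<open>a - b\<close>.\<close>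
  have "(1 / (1 + t)) *\<^sub>R (a + t * b) + (t / (1 + t)) *\<^sub>R (a - b) = ((1 + t) * a) / (1 + t)"
    by (simp only: real_scaleR_def times_divide_eq_left add_divide_distrib[symmetric]) (simp add: algebra_simps)
  also have "\<dots> = a" using assms by simp
  finally have eq: "(1 - t / (1 + t)) *\<^sub>R (a + t * b) + (t / (1 + t)) *\<^sub>R (a - b) = a"
    using assms by (simp add: field_simps)
  have "?h a \<le> (1 - t / (1 + t)) * ?h (a + t * b) + (t / (1 + t)) * ?h (a - b)"
    using convex_onD[OF conv, of "t / (1 + t)" "a + t * b" "a - b"] assms unfolding eq by simp
  then have "(1 + t) * ?h a \<le> (1 + t) * ((1 - t / (1 + t)) * ?h (a + t * b) + (t / (1 + t)) * ?h (a - b))"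
    using assms by (intro mult_left_mono) auto
  also have "\<dots> = ((1 + t) * (1 - t / (1 + t))) * ?h (a + t * b) + ((1 + t) * (t / (1 + t))) * ?h (a - b)"
    by (simp only: distrib_left mult.assoc)
  also have "(1 + t) * (1 - t / (1 + t)) = 1" using assms by (simp add: field_simps)
  also have "(1 + t) * (t / (1 + t)) = t" using assms by simp
  finally have 2: "?h a + t * ?h a \<le> ?h (a + t * b) + t * ?h (a - b)" by (simp add: algebra_simps)
  have nn: "0 \<le> t * ?h a" "0 \<le> t * ?h (a + b)" "0 \<le> t * ?h (a - b)" using assms by auto
  have "\<bar>?h (a + t * b) - ?h a\<bar> \<le> t * ?h (a + b) + t * ?h (a - b)"
    using 1 2 nn by (simp add: algebra_simps abs_le_iff)
  then have "\<bar>?h (a + t * b) - ?h a\<bar> \<le> (?h (a + b) + ?h (a - b)) * t"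
    by (simp add: algebra_simps)
  then show ?thesis using assms by (simp add: abs_divide pos_divide_le_eq)
qed

text \<open>First variation of the functional in direction \<open>b\<close>, along positive steps
  only; the direction \<open>- b\<close> supplies the other side where an equality is
  wanted.\<close>

lemma Jpow_slope_limit:
  assumes a: "Lpow N p a" and b: "Lpow N p b" and p: "p > 1"
  shows "(\<lambda>k. (Jpow N p (\<lambda>z. a z + 1 / real (Suc k) * b z) - Jpow N p a) / (1 / real (Suc k)))
    \<longlonglongrightarrow> p * (\<integral>z. signed_powr p (a z) * b z \<partial>N)"
proof -
  note [measurable] = LpowD(1)[OF a] LpowD(1)[OF b]
  define t where "t k = 1 / real (Suc k)" for k
  have t: "0 < t k" "t k \<le> 1" "t k \<noteq> 0" for k by (auto simp: t_def)
  have t0: "filterlim t (at 0) sequentially"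
    unfolding filterlim_at using LIMSEQ_inverse_real_of_nat t
    by (auto simp: t_def[abs_def] inverse_eq_divide)
  have i: "integrable N (\<lambda>z. \<bar>a z + b z\<bar> powr p + \<bar>a z - b z\<bar> powr p)"
    using LpowD(2)[OF Lpow_add(1)[OF a b]] LpowD(2)[OF Lpow_diff(1)[OF a b]] p by simp
  let ?s = "\<lambda>k z. (\<bar>a z + t k * b z\<bar> powr p - \<bar>a z\<bar> powr p) / t k"
  have lim: "(\<lambda>k. ?s k z) \<longlonglongrightarrow> p * (signed_powr p (a z) * b z)" for z
  proof -
    have "((\<lambda>s. \<bar>a z + s * b z\<bar> powr p) has_real_derivative p * signed_powr p (a z + 0 * b z) * b z) (at 0)"
      by (rule DERIV_chain2[OF has_derivative_abs_powr[OF p]]) (auto intro!: derivative_eq_intros)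
    then have "((\<lambda>h. (\<bar>a z + h * b z\<bar> powr p - \<bar>a z\<bar> powr p) / h) \<longlongrightarrow> p * (signed_powr p (a z) * b z)) (at 0)"
      by (simp add: DERIV_def mult.assoc)
    from filterlim_compose[OF this t0] show ?thesis .
  qed
  have "(\<lambda>k. \<integral>z. ?s k z \<partial>N) \<longlonglongrightarrow> (\<integral>z. p * (signed_powr p (a z) * b z) \<partial>N)"
  proof (rule integral_dominated_convergence[OF _ _ i])
    show "AE z in N. (\<lambda>k. ?s k z) \<longlonglongrightarrow> p * (signed_powr p (a z) * b z)" using lim by simp
    show "AE z in N. norm (?s k z) \<le> \<bar>a z + b z\<bar> powr p + \<bar>a z - b z\<bar> powr p" for k
      using abs_powr_slope_bound[of p "t k"] p t by simp
  qed auto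
  moreover have "(\<integral>z. ?s k z \<partial>N) = (Jpow N p (\<lambda>z. a z + t k * b z) - Jpow N p a) / t k" for k
  proof -
    have "integrable N (\<lambda>z. \<bar>a z + t k * b z\<bar> powr p)"
      using LpowD(2)[OF Lpow_add(1)[OF a Lpow_scale(1)[OF b]]] p by simp
    then show ?thesis using LpowD(2)[OF a] by (simp add: Jpow_def)
  qed
  ultimately show ?thesis by (simp add: t_def)
qed

subsection \<open>The Gagliardo energy\<close>

text \<open>On the diagonal the value is 0, since \<open>0 powr r\<close> is 0 and so is
  \<open>1 / 0\<close>. A statement that holds almost everywhere for this weight thus concerns pairs
  of distinct points only.\<close>

definition wt :: "real \<Rightarrow> 'a::euclidean_space \<times> 'a \<Rightarrow> real" where
  "wt r z = 1 / norm (snd z - fst z) powr r"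

definition dif :: "('a::euclidean_space \<Rightarrow> real) \<Rightarrow> 'a \<times> 'a \<Rightarrow> real" where
  "dif u z = u (snd z) - u (fst z)"

definition energy_on :: "('a::euclidean_space \<times> 'a) set \<Rightarrow> real \<Rightarrow> real \<Rightarrow> ('a \<Rightarrow> real) \<Rightarrow> ennreal" where
  "energy_on A r p u = (\<integral>\<^sup>+z. ennreal (wt r z * \<bar>dif u z\<bar> powr p) * indicator A z \<partial>lborel)"

lemma fst_borel[measurable]: "fst \<in> borel_measurable (borel :: ('a::euclidean_space \<times> 'b::euclidean_space) measure)"
  by (intro borel_measurable_continuous_onI continuous_intros)

lemma snd_borel[measurable]: "snd \<in> borel_measurable (borel :: ('a::euclidean_space \<times> 'b::euclidean_space) measure)"
  by (intro borel_measurable_continuous_onI continuous_intros)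

lemma wt_measurable[measurable]: "wt r \<in> borel_measurable borel"
  unfolding wt_def[abs_def] by measurable

lemma dif_measurable[measurable]: "u \<in> borel_measurable borel \<Longrightarrow> dif u \<in> borel_measurable borel"
  unfolding dif_def[abs_def]
  by (intro borel_measurable_diff measurable_compose[OF snd_borel] measurable_compose[OF fst_borel])

lemma wt_nonneg[simp]: "wt r z \<ge> 0"
  by (simp add: wt_def)

lemma nn_integral_pair:
  fixes f :: "'a::euclidean_space \<times> 'b::euclidean_space \<Rightarrow> ennreal"
  assumes f: "f \<in> borel_measurable borel"
  shows "(\<integral>\<^sup>+z. f z \<partial>lborel) = (\<integral>\<^sup>+x. \<integral>\<^sup>+y. f (x, y) \<partial>lborel \<partial>lborel)"
    and "(\<integral>\<^sup>+z. f z \<partial>lborel) = (\<integral>\<^sup>+y. \<integral>\<^sup>+x. f (x, y) \<partial>lborel \<partial>lborel)"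
proof -
  have f': "f \<in> borel_measurable (lborel \<Otimes>\<^sub>M lborel)" using f by (simp add: lborel_prod)
  show "(\<integral>\<^sup>+z. f z \<partial>lborel) = (\<integral>\<^sup>+x. \<integral>\<^sup>+y. f (x, y) \<partial>lborel \<partial>lborel)"
    using lborel.nn_integral_fst[OF f'] by (simp add: lborel_prod)
  show "(\<integral>\<^sup>+z. f z \<partial>lborel) = (\<integral>\<^sup>+y. \<integral>\<^sup>+x. f (x, y) \<partial>lborel \<partial>lborel)"
    using lborel_pair.nn_integral_snd[OF f'] by (simp add: lborel_prod)
qed

text \<open>With respect to this measure the Gagliardo energy of \<open>u\<close> over
  \<open>A\<close> is the integral of the p-th power of \<open>|dif u|\<close>, so the facts about
  \<open>Lpow\<close> and \<open>Jpow\<close> apply to energies and to Lebesgue norms alike. The set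
  \<open>A\<close> is the whole space for the equation and \<Omega> \<times> \<Omega> for the
  Sobolev norm.\<close>

definition kern_on :: "('a::euclidean_space \<times> 'a) set \<Rightarrow> real \<Rightarrow> ('a \<times> 'a) measure" where
  "kern_on A r = density lborel (\<lambda>z. ennreal (wt r z) * indicator A z)"

lemma sets_kern_on[simp, measurable_cong]: "sets (kern_on A r) = sets borel"
  by (simp add: kern_on_def)

lemma nn_integral_kern_on:
  assumes [measurable]: "u \<in> borel_measurable borel" "A \<in> sets borel"
  shows "(\<integral>\<^sup>+z. ennreal (\<bar>dif u z\<bar> powr p) \<partial>kern_on A r) = energy_on A r p u"
  unfolding energy_on_def kern_on_def
  by (subst nn_integral_density) (auto simp: ennreal_mult mult_ac)

lemma Lpow_kern_on_iff:
  assumes [measurable]: "u \<in> borel_measurable borel" "A \<in> sets borel"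
  shows "Lpow (kern_on A r) p (dif u) \<longleftrightarrow> energy_on A r p u < \<infinity>"
  unfolding Lpow_def by (simp add: integrable_iff_bounded nn_integral_kern_on)

lemma Jpow_kern_on:
  assumes "u \<in> borel_measurable borel" "A \<in> sets borel" and "Lpow (kern_on A r) p (dif u)"
  shows "ennreal (Jpow (kern_on A r) p (dif u)) = energy_on A r p u"
  unfolding Jpow_def nn_integral_kern_on[OF assms(1,2), symmetric]
  by (rule nn_integral_eq_integral[symmetric]) (use LpowD(2)[OF assms(3)] in auto)

abbreviation kern :: "real \<Rightarrow> ('a::euclidean_space \<times> 'a) measure" where
  "kern r \<equiv> kern_on UNIV r"

lemma kern_def: "kern r = density lborel (\<lambda>z. ennreal (wt r z))"
  by (simp add: kern_on_def)

lemmas Lpow_kern_iff = Lpow_kern_on_iff[where A = UNIV, OF _ sets.top[of borel, unfolded space_borel]]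
lemmas Jpow_kern = Jpow_kern_on[where A = UNIV, OF _ sets.top[of borel, unfolded space_borel]]

text \<open>Every positive value is charged to one ball of the sequence. The balls may overlap, so
  no decomposition into disjoint annuli has to be set up.\<close>

lemma nn_integral_shells:
  fixes f :: "'a::euclidean_space \<Rightarrow> real" and c \<rho> :: "nat \<Rightarrow> real"
  assumes f: "\<And>y. f y > 0 \<Longrightarrow> \<exists>k. y \<in> ball x (\<rho> k) \<and> f y \<le> c k"
    and nn: "\<And>k. c k \<ge> 0" "\<And>k. \<rho> k \<ge> 0"
    and S: "(\<lambda>k. c k * (unit_ball_vol DIM('a) * \<rho> k ^ DIM('a))) sums S"
  shows "(\<integral>\<^sup>+y. ennreal (f y) \<partial>lborel) \<le> ennreal S"
proof -
  have le: "ennreal (f y) \<le> (\<Sum>k. ennreal (c k) * indicator (ball x (\<rho> k)) y)" for y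
  proof (cases "f y > 0")
    case True
    then obtain k where k: "y \<in> ball x (\<rho> k)" "f y \<le> c k" using f by blast
    then have "ennreal (f y) \<le> ennreal (c k) * indicator (ball x (\<rho> k)) y" by (simp add: ennreal_leI)
    also have "\<dots> \<le> (\<Sum>k. ennreal (c k) * indicator (ball x (\<rho> k)) y)" (is "?g k \<le> suminf ?g")
    proof -
      have "sum ?g {k} \<le> suminf ?g" by (rule sum_le_suminf) auto
      then show ?thesis by (simp only: sum.insert sum.empty finite.emptyI empty_iff not_False_eq_True add_0_right)
    qed
    finally show ?thesis .
  qed (simp add: ennreal_neg)
  have "(\<integral>\<^sup>+y. ennreal (f y) \<partial>lborel) \<le> (\<integral>\<^sup>+y. (\<Sum>k. ennreal (c k) * indicator (ball x (\<rho> k)) y) \<partial>lborel)"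
    by (intro nn_integral_mono le)
  also have "\<dots> = (\<Sum>k. \<integral>\<^sup>+y. ennreal (c k) * indicator (ball x (\<rho> k)) y \<partial>lborel)"
    by (rule nn_integral_suminf) (intro borel_measurable_times_ennreal borel_measurable_const borel_measurable_indicator, simp)
  also have "\<dots> = (\<Sum>k. ennreal (c k * (unit_ball_vol DIM('a) * \<rho> k ^ DIM('a))))"
    using nn by (simp add: nn_integral_cmult_indicator emeasure_ball ennreal_mult)
  also have "\<dots> = ennreal S"
    using nn by (intro suminf_ennreal_eq S) auto
  finally show ?thesis .
qed

lemma power_powr_swap: "a > 0 \<Longrightarrow> (a ^ k) powr b = (a powr b) ^ k" for a :: real
  by (simp add: powr_power powr_realpow[symmetric] powr_powr mult.commute)

text \<open>Balls of radius \<open>2^(k+1) d\<close> give a geometric series with ratio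
  \<open>2^(n-r)\<close>, which is below 1 because \<open>r\<close> exceeds the dimension.\<close>

lemma tail_integral:
  fixes r :: real
  assumes r: "real DIM('a::euclidean_space) < r"
  obtains C where "C > 0" and "\<And>x::'a. \<And>d. d > 0 \<Longrightarrow>
    (\<integral>\<^sup>+y. ennreal (if d \<le> norm (y - x) then 1 / norm (y - x) powr r else 0) \<partial>lborel)
      \<le> ennreal (C * d powr (DIM('a) - r))"
proof -
  let ?n = "DIM('a)" let ?w = "unit_ball_vol (real ?n)"
  define q where "q = 2 powr (?n - r)"
  have "q < 2 powr 0" unfolding q_def by (rule powr_less_mono) (use r in auto)
  then have q: "0 < q" "q < 1" by (simp_all add: q_def)
  define C where "C = ?w * 2 ^ ?n * (1 / (1 - q))"
  show ?thesis
  proof (rule that[of C])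
    show "C > 0" using q by (simp add: C_def)
    fix x :: 'a and d :: real assume d: "d > 0"
    show "(\<integral>\<^sup>+y. ennreal (if d \<le> norm (y - x) then 1 / norm (y - x) powr r else 0) \<partial>lborel)
      \<le> ennreal (C * d powr (?n - r))"
    proof (rule nn_integral_shells[where x=x and c="\<lambda>k. (2 ^ k * d) powr (- r)" and \<rho>="\<lambda>k. 2 ^ (k + 1) * d"])
      fix y assume "0 < (if d \<le> norm (y - x) then 1 / norm (y - x) powr r else 0)"
      then have dy: "d \<le> norm (y - x)" by (auto split: if_splits)
      let ?P = "\<lambda>k. norm (y - x) < 2 ^ (k + 1) * d"
      obtain m where "norm (y - x) / d < 2 ^ m" using real_arch_pow[of 2] by auto
      then have "norm (y - x) < 2 ^ m * d" using d by (simp add: field_simps)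
      also have "\<dots> \<le> 2 ^ (m + 1) * d" using d by simp
      finally have "?P m" .
      then have P: "?P (LEAST k. ?P k)" by (rule LeastI)
      \<comment> \<open>Minimality yields the lower bound \<open>2^k d\<close> for the distance; for
        \<open>k = 0\<close> it is the cut-off itself.\<close>
      define k where "k = (LEAST k. ?P k)"
      have "2 ^ k * d \<le> norm (y - x)"
      proof (cases k)
        case 0
        then show ?thesis using dy by simp
      next
        case (Suc j)
        then have "\<not> ?P j" unfolding k_def using not_less_Least by (metis lessI)
        then show ?thesis using Suc by simp
      qed
      then have "1 / norm (y - x) powr r \<le> (2 ^ k * d) powr (- r)"
        unfolding powr_minus_divide
        by (intro divide_left_mono powr_mono2 mult_pos_pos) (use d dy r in auto)
      moreover have "y \<in> ball x (2 ^ (k + 1) * d)"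
        using P by (simp add: k_def dist_norm norm_minus_commute)
      ultimately show "\<exists>k. y \<in> ball x (2 ^ (k + 1) * d) \<and>
          (if d \<le> norm (y - x) then 1 / norm (y - x) powr r else 0) \<le> (2 ^ k * d) powr (- r)"
        using dy by auto
    next
      have "(2 ^ k * d) powr (- r) * (?w * (2 ^ (k + 1) * d) ^ ?n) = ?w * 2 ^ ?n * d powr (?n - r) * q ^ k" for k
      proof -
        have "(2 ^ k * d) powr (- r) * (?w * (2 ^ (k + 1) * d) ^ ?n)
            = ?w * 2 ^ ?n * ((2 ^ k * d) powr (- r) * (2 ^ k * d) ^ ?n)"
          by (simp add: power_mult_distrib mult_ac)
        also have "(2 ^ k * d) powr (- r) * (2 ^ k * d) ^ ?n = (2 ^ k * d) powr (?n - r)"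
          using d by (simp add: powr_realpow[symmetric] powr_add[symmetric] del: powr_realpow)
        also have "\<dots> = d powr (?n - r) * q ^ k"
          by (simp add: powr_mult power_powr_swap q_def)
        finally show ?thesis by (simp add: mult_ac)
      qed
      then have eq: "(\<lambda>k. (2 ^ k * d) powr (- r) * (?w * (2 ^ (k + 1) * d) ^ ?n)) = (\<lambda>k. ?w * 2 ^ ?n * d powr (?n - r) * q ^ k)"
        by blast
      have "(\<lambda>k. ?w * 2 ^ ?n * d powr (?n - r) * q ^ k) sums (?w * 2 ^ ?n * d powr (?n - r) * (1 / (1 - q)))"
        using q by (intro sums_mult geometric_sums) auto
      then show "(\<lambda>k. (2 ^ k * d) powr (- r) * (?w * (2 ^ (k + 1) * d) ^ ?n)) sums (C * d powr (?n - r))"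
        unfolding eq by (simp add: C_def mult_ac)
    qed (use d in auto)
  qed
qed

lemma near_integral:
  fixes q :: real
  assumes q: "0 < q" "q < real DIM('a::euclidean_space)"
  obtains C where "C > 0" and "\<And>x::'a.
    (\<integral>\<^sup>+y. ennreal (if norm (y - x) \<le> 1 then 1 / norm (y - x) powr q else 0) \<partial>lborel) \<le> ennreal C"
proof -
  let ?n = "DIM('a)" let ?w = "unit_ball_vol (real ?n)"
  define s where "s = (1 / 2 :: real) powr (?n - q)"
  have s: "0 < s" "s < 1" using q powr_less_mono[of 0 "?n - q" 2] by (auto simp: s_def powr_divide)
  define C where "C = ?w * 4 ^ ?n * s * (1 / (1 - s))"
  show ?thesis
  proof (rule that[of C])
    show "C > 0" using s by (simp add: C_def)
    fix x :: 'a
    show "(\<integral>\<^sup>+y. ennreal (if norm (y - x) \<le> 1 then 1 / norm (y - x) powr q else 0) \<partial>lborel) \<le> ennreal C"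
    \<comment> \<open>The k-th shell is given by \<open>(1/2)^(k+1) < |y - x| \<le> (1/2)^k\<close>.
      The factor 4, instead of 2, puts its closed outer boundary inside the open ball.\<close>
    proof (rule nn_integral_shells[where x=x and c="\<lambda>k. ((1/2) ^ (k + 1)) powr (- q)" and \<rho>="\<lambda>k. 4 * (1/2) ^ (k + 1)"])
      fix y assume *: "0 < (if norm (y - x) \<le> 1 then 1 / norm (y - x) powr q else 0)"
      then have y1: "norm (y - x) \<le> 1" and y0: "norm (y - x) > 0" by (auto split: if_splits)
      let ?P = "\<lambda>k. (1/2) ^ (k + 1) < norm (y - x)"
      obtain m where m: "(1/2) ^ m < norm (y - x)" using real_arch_pow_inv[OF y0, of "1/2"] by auto
      have "?P m" by (rule le_less_trans[OF _ m]) simp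
      then have P: "?P (LEAST k. ?P k)" by (rule LeastI)
      define k where "k = (LEAST k. ?P k)"
      have "norm (y - x) \<le> (1/2) ^ k"
      proof (cases k)
        case 0
        then show ?thesis using y1 by simp
      next
        case (Suc j)
        then have "\<not> ?P j" unfolding k_def using not_less_Least by (metis lessI)
        then show ?thesis using Suc by simp
      qed
      also have "(1/2) ^ k < (4 * (1/2) ^ (k + 1) :: real)" by simp
      finally have "y \<in> ball x (4 * (1/2) ^ (k + 1))" by (simp add: dist_norm norm_minus_commute)
      moreover have "1 / norm (y - x) powr q \<le> ((1/2) ^ (k + 1)) powr (- q)"
        unfolding powr_minus_divide
        by (intro divide_left_mono powr_mono2 mult_pos_pos) (use P q y0 in \<open>auto simp: k_def\<close>)
      ultimately show "\<exists>k. y \<in> ball x (4 * (1/2) ^ (k + 1)) \<and>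
          (if norm (y - x) \<le> 1 then 1 / norm (y - x) powr q else 0) \<le> ((1/2) ^ (k + 1)) powr (- q)"
        using y1 by auto
    next
      have "((1/2) ^ (k + 1)) powr (- q) * (?w * (4 * (1/2) ^ (k + 1)) ^ ?n) = ?w * 4 ^ ?n * s * s ^ k" for k
      proof -
        have "((1/2) ^ (k + 1)) powr (- q) * (?w * (4 * (1/2) ^ (k + 1)) ^ ?n)
          = ?w * 4 ^ ?n * (((1/2) ^ (k + 1)) powr (- q) * ((1/2) ^ (k + 1)) ^ ?n)"
          by (simp only: power_mult_distrib mult_ac)
        also have "((1/2) ^ (k + 1)) powr (- q) * ((1/2) ^ (k + 1)) ^ ?n = ((1/2::real) ^ (k + 1)) powr (?n - q)"
          by (subst powr_realpow[symmetric]) (simp_all add: powr_add[symmetric])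
        also have "\<dots> = s * s ^ k" by (simp only: power_powr_swap s_def) (simp add: power_powr_swap)
        finally show ?thesis by (simp add: mult_ac)
      qed
      then have eq: "(\<lambda>k. ((1/2) ^ (k + 1)) powr (- q) * (?w * (4 * (1/2) ^ (k + 1)) ^ ?n)) = (\<lambda>k. ?w * 4 ^ ?n * s * s ^ k)"
        by blast
      have "(\<lambda>k. ?w * 4 ^ ?n * s * s ^ k) sums (?w * 4 ^ ?n * s * (1 / (1 - s)))"
        using s by (intro sums_mult geometric_sums) auto
      then show "(\<lambda>k. ((1/2) ^ (k + 1)) powr (- q) * (?w * (4 * (1/2) ^ (k + 1)) ^ ?n)) sums C"
        unfolding C_def eq .
    qed auto
  qed
qed

text \<open>Near the diagonal the integrand is at most \<open>B^p |x - y|^(p-r)\<close>, integrable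
  since \<open>r - p\<close> is below the dimension; at distance above 1 boundedness and
  \<open>r\<close> above the dimension suffice. A nonzero difference has one of its points in
  \<Omega>, which has finite measure.\<close>

lemma lipschitz_finite_energy:
  fixes u :: "'a::euclidean_space \<Rightarrow> real" and p r :: real
  assumes \<Omega>[measurable]: "\<Omega> \<in> sets borel" and fin: "emeasure lborel \<Omega> < \<infinity>"
    and u[measurable]: "u \<in> borel_measurable borel" and out: "\<And>x. x \<notin> \<Omega> \<Longrightarrow> u x = 0"
    and B: "\<And>x. \<bar>u x\<bar> \<le> B" and L: "\<And>x y. \<bar>u x - u y\<bar> \<le> B * norm (x - y)"
    and p: "p \<ge> 1" and r: "real DIM('a) < r" "r < DIM('a) + p"
  shows "Lpow (kern r) p (dif u)"
proof -
  let ?n = "DIM('a)"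
  \<comment> \<open>The integral near a point is available for positive exponents only. For
    distances up to 1 a larger exponent enlarges the integrand, and \<open>1 / 2\<close> is below
    every dimension.\<close>
  define q where "q = max (r - p) (1 / 2)"
  have "?n \<ge> 1" using DIM_positive[where 'a='a] by linarith
  then have n1: "real ?n \<ge> 1" by linarith
  have q: "0 < q" "q < ?n" "r - p \<le> q"
    using r n1 unfolding q_def by linarith+
  obtain C1 where C1: "C1 > 0" "\<And>x::'a. (\<integral>\<^sup>+y. ennreal (if norm (y - x) \<le> 1 then 1 / norm (y - x) powr q else 0) \<partial>lborel) \<le> ennreal C1"
    using near_integral[OF q(1,2)] by blast
  obtain C2 where C2: "C2 > 0" "\<And>x::'a. \<And>d. d > 0 \<Longrightarrow> (\<integral>\<^sup>+y. ennreal (if d \<le> norm (y - x) then 1 / norm (y - x) powr r else 0) \<partial>lborel) \<le> ennreal (C2 * d powr (?n - r))"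
    using tail_integral[OF r(1)] by blast
  have B0: "B \<ge> 0" using B[of undefined] by linarith
  define F :: "'a \<times> 'a \<Rightarrow> ennreal" where "F z = ennreal (B powr p) * ennreal (if norm (snd z - fst z) \<le> 1 then 1 / norm (snd z - fst z) powr q else 0)
      + ennreal ((2 * B) powr p) * ennreal (if 1 \<le> norm (snd z - fst z) then 1 / norm (snd z - fst z) powr r else 0)" for z
  define K where "K = B powr p * C1 + (2 * B) powr p * C2"
  have [measurable]: "F \<in> borel_measurable borel" unfolding F_def by measurable
  have F1: "(\<integral>\<^sup>+y. F (x, y) \<partial>lborel) \<le> ennreal K" for x
  proof -
    have "(\<integral>\<^sup>+y. F (x, y) \<partial>lborel) = ennreal (B powr p) * (\<integral>\<^sup>+y. ennreal (if norm (y - x) \<le> 1 then 1 / norm (y - x) powr q else 0) \<partial>lborel)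
      + ennreal ((2 * B) powr p) * (\<integral>\<^sup>+y. ennreal (if 1 \<le> norm (y - x) then 1 / norm (y - x) powr r else 0) \<partial>lborel)"
      unfolding F_def fst_conv snd_conv by (simp add: nn_integral_add nn_integral_cmult)
    also have "\<dots> \<le> ennreal (B powr p) * ennreal C1 + ennreal ((2 * B) powr p) * ennreal C2"
      using C1(2)[of x] C2(2)[of 1 x] by (intro add_mono mult_left_mono) auto
    also have "\<dots> = ennreal K" using C1(1) C2(1) by (simp add: K_def ennreal_mult ennreal_plus)
    finally show ?thesis .
  qed
  have sym: "F (x, y) = F (y, x)" for x y unfolding F_def by (simp add: norm_minus_commute)
  have pt: "ennreal (wt r z * \<bar>dif u z\<bar> powr p) \<le> F z * indicator \<Omega> (fst z) + F z * indicator \<Omega> (snd z)" for z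
  proof (cases "fst z \<in> \<Omega> \<or> snd z \<in> \<Omega>")
    case False
    then show ?thesis using out by (simp add: dif_def)
  next
    case True
    let ?t = "norm (snd z - fst z)"
    have "ennreal (wt r z * \<bar>dif u z\<bar> powr p) \<le> F z"
    proof (cases "?t \<le> 1")
      case t: True
      have "\<bar>dif u z\<bar> powr p \<le> (B * ?t) powr p"
        using L[of "snd z" "fst z"] p unfolding dif_def by (intro powr_mono2) auto
      then have "wt r z * \<bar>dif u z\<bar> powr p \<le> wt r z * (B * ?t) powr p"
        by (intro mult_left_mono) auto
      also have "\<dots> = B powr p * (?t powr p / ?t powr r)"
        using B0 by (simp add: wt_def powr_mult)
      also have "\<dots> \<le> B powr p * (1 / ?t powr q)"
      proof (cases "?t = 0")
        case False
        then have "?t powr p / ?t powr r = ?t powr (p - r)" by (simp add: powr_diff)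
        also have "\<dots> \<le> ?t powr (- q)" using q(3) t by (intro powr_mono') auto
        also have "\<dots> = 1 / ?t powr q" by (simp add: powr_minus_divide)
        finally show ?thesis by (intro mult_left_mono) auto
      qed (use p in simp)
      finally have "ennreal (wt r z * \<bar>dif u z\<bar> powr p) \<le> ennreal (B powr p * (1 / ?t powr q))"
        by (rule ennreal_leI)
      also have "\<dots> = ennreal (B powr p) * ennreal (if ?t \<le> 1 then 1 / ?t powr q else 0)"
        using t by (simp add: ennreal_mult[symmetric])
      also have "\<dots> \<le> F z" unfolding F_def by simp
      finally show ?thesis .
    next
      case t: False
      have "\<bar>dif u z\<bar> powr p \<le> (2 * B) powr p"
        using B[of "snd z"] B[of "fst z"] p unfolding dif_def by (intro powr_mono2) auto
      then have "wt r z * \<bar>dif u z\<bar> powr p \<le> wt r z * (2 * B) powr p"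
        by (intro mult_left_mono) auto
      then have "ennreal (wt r z * \<bar>dif u z\<bar> powr p) \<le> ennreal ((2 * B) powr p * (1 / ?t powr r))"
        by (intro ennreal_leI) (simp add: wt_def)
      also have "\<dots> = ennreal ((2 * B) powr p) * ennreal (if 1 \<le> ?t then 1 / ?t powr r else 0)"
        using t by (simp add: ennreal_mult[symmetric])
      also have "\<dots> \<le> F z" unfolding F_def by simp
      finally show ?thesis .
    qed
    with True show ?thesis by (auto simp: indicator_def intro: add_increasing2)
  qed
  have "energy_on UNIV r p u \<le> (\<integral>\<^sup>+z. F z * indicator \<Omega> (fst z) + F z * indicator \<Omega> (snd z) \<partial>lborel)"
    unfolding energy_on_def using pt by (intro nn_integral_mono) simp
  also have "\<dots> = (\<integral>\<^sup>+z. F z * indicator \<Omega> (fst z) \<partial>lborel) + (\<integral>\<^sup>+z. F z * indicator \<Omega> (snd z) \<partial>lborel)"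
    by (rule nn_integral_add) auto
  also have "(\<integral>\<^sup>+z. F z * indicator \<Omega> (fst z) \<partial>lborel) = (\<integral>\<^sup>+x. (\<integral>\<^sup>+y. F (x, y) \<partial>lborel) * indicator \<Omega> x \<partial>lborel)"
    by (subst nn_integral_pair(1)) (auto simp: nn_integral_multc)
  also have "(\<integral>\<^sup>+z. F z * indicator \<Omega> (snd z) \<partial>lborel) = (\<integral>\<^sup>+y. (\<integral>\<^sup>+x. F (y, x) \<partial>lborel) * indicator \<Omega> y \<partial>lborel)"
    by (subst nn_integral_pair(2)) (auto simp: nn_integral_multc sym[of _ "_"])
  also have "(\<integral>\<^sup>+x. (\<integral>\<^sup>+y. F (x, y) \<partial>lborel) * indicator \<Omega> x \<partial>lborel) + (\<integral>\<^sup>+y. (\<integral>\<^sup>+x. F (y, x) \<partial>lborel) * indicator \<Omega> y \<partial>lborel)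
     \<le> (\<integral>\<^sup>+x. ennreal K * indicator \<Omega> x \<partial>lborel) + (\<integral>\<^sup>+x. ennreal K * indicator \<Omega> x \<partial>lborel)"
    by (intro add_mono nn_integral_mono mult_right_mono F1) auto
  also have "\<dots> < \<infinity>"
    using fin by (simp add: nn_integral_cmult_indicator ennreal_mult_less_top)
  finally show ?thesis by (simp add: Lpow_kern_iff)
qed

subsection \<open>Hardy's and Morrey's inequalities\<close>

lemma nn_integral_const_ball:
  fixes c :: "'a::euclidean_space"
  assumes "\<rho> \<ge> 0" and "a \<ge> 0"
  shows "(\<integral>\<^sup>+y. ennreal a * indicator (ball c \<rho>) y \<partial>lborel) = ennreal (a * (unit_ball_vol DIM('a) * \<rho> ^ DIM('a)))"
    and "(\<integral>\<^sup>+y. ennreal a * indicator (cball c \<rho>) y \<partial>lborel) = ennreal (a * (unit_ball_vol DIM('a) * \<rho> ^ DIM('a)))"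
  using assms by (simp_all add: nn_integral_cmult_indicator emeasure_ball emeasure_cball ennreal_mult)

lemma exists_powr_le:
  fixes a b :: real
  assumes "a > 0" and "b > 0"
  obtains \<tau> where "0 < \<tau>" and "\<tau> \<le> 1 / 2" and "\<tau> powr b \<le> a"
proof -
  let ?t = "min (1 / 2) (a powr (1 / b))"
  have "?t powr b \<le> (a powr (1 / b)) powr b"
    using assms by (intro powr_mono2) auto
  also have "\<dots> = a" using assms by (simp add: powr_powr)
  finally show ?thesis using assms by (intro that[of ?t]) auto
qed

text \<open>The centre lies on the segment from a nearest point of the complement to
  \<open>x\<close>, at the fraction \<tau> of its length. Staying within \<open>d x\<close> of
  \<open>x\<close> makes the kernel at \<open>(x, y)\<close> at least \<open>d x powr (- r)\<close>,
  while the values of \<open>d\<close> on the ball are comparable to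
  \<open>\<tau> * d x\<close>.\<close>

lemma nearest_point_ball:
  fixes x :: "'a::euclidean_space"
  assumes \<Omega>: "open \<Omega>" "x \<in> \<Omega>" "\<Omega> \<noteq> UNIV" and \<tau>: "0 < \<tau>" "\<tau> \<le> 1"
  defines "d \<equiv> \<lambda>y. infdist y (- \<Omega>)"
  obtains c where "\<And>y. y \<in> ball c (\<tau> * d x / 2) \<Longrightarrow>
    \<tau> * d x / 2 \<le> d y \<and> d y \<le> 3 / 2 * \<tau> * d x \<and> norm (y - x) \<le> d x"
proof -
  have "closed (- \<Omega>)" "- \<Omega> \<noteq> {}" using \<Omega> by auto
  then obtain z where z: "z \<in> - \<Omega>" "d x = dist x z"
    unfolding d_def using infdist_attains_inf by blast
  let ?c = "z + \<tau> *\<^sub>R (x - z)"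
  show ?thesis
  proof (rule that[of ?c])
    fix y assume "y \<in> ball ?c (\<tau> * d x / 2)"
    then have y: "norm (y - ?c) < \<tau> * d x / 2" by (simp add: dist_norm norm_minus_commute)
    have dx: "norm (x - z) = d x" using z(2) by (simp add: dist_norm)
    have "norm (y - z) \<le> norm (y - ?c) + norm (\<tau> *\<^sub>R (x - z))"
      using norm_triangle_ineq[of "y - ?c" "\<tau> *\<^sub>R (x - z)"] by (simp add: algebra_simps)
    also have "\<dots> \<le> 3 / 2 * \<tau> * d x" using y \<tau> dx by simp
    finally have 1: "norm (y - z) \<le> 3 / 2 * \<tau> * d x" .
    have 2: "d y \<le> norm (y - z)" unfolding d_def using infdist_le[OF z(1), of y] by (simp add: dist_norm)
    have "y - x = (y - ?c) + (\<tau> - 1) *\<^sub>R (x - z)" by (simp add: algebra_simps)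
    then have "norm (y - x) \<le> norm (y - ?c) + norm ((\<tau> - 1) *\<^sub>R (x - z))"
      using norm_triangle_ineq by metis
    also have "\<dots> \<le> \<tau> * d x / 2 + (1 - \<tau>) * d x" using y \<tau> dx by simp
    finally have 3: "norm (y - x) \<le> \<tau> * d x / 2 + (1 - \<tau>) * d x" .
    have 4: "d x \<le> d y + norm (y - x)"
      unfolding d_def using infdist_triangle[of x "- \<Omega>" y] by (simp add: dist_norm norm_minus_commute)
    have d0: "\<tau> * d x \<ge> 0" using \<tau> by (simp add: d_def infdist_nonneg)
    show "\<tau> * d x / 2 \<le> d y \<and> d y \<le> 3 / 2 * \<tau> * d x \<and> norm (y - x) \<le> d x"
      using 1 2 3 4 d0 by (auto simp: algebra_simps)
  qed
qed

text \<open>The weight \<open>dist^(n-r)\<close> is the bound that \<open>tail_integral\<close>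
  gives for the mass of the kernel around \<open>x\<close> over the complement of \<Omega>.\<close>

definition hardy_integral :: "'a::euclidean_space set \<Rightarrow> real \<Rightarrow> real \<Rightarrow> ('a \<Rightarrow> real) \<Rightarrow> ennreal" where
  "hardy_integral \<Omega> r p \<phi> =
    (\<integral>\<^sup>+x. ennreal (\<bar>\<phi> x\<bar> powr p * infdist x (- \<Omega>) powr (real DIM('a) - r)) * indicator \<Omega> x \<partial>lborel)"

lemma infdist_measurable[measurable]: "(\<lambda>x. infdist x A) \<in> borel_measurable borel"
  by (intro borel_measurable_continuous_onI continuous_on_infdist continuous_on_id)

lemma test_functions_measurable[measurable_dest]: "\<phi> \<in> test_functions \<Omega> \<Longrightarrow> \<phi> \<in> borel_measurable borel"
  by (intro borel_measurable_continuous_onI smooth_continuous_on test_functions_smooth)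

lemma bounded_emeasure_finite: "bounded \<Omega> \<Longrightarrow> emeasure lborel \<Omega> < \<infinity>" for \<Omega> :: "'a::euclidean_space set"
  by (rule emeasure_bounded_finite)

text \<open>On the support of a test function the distance to the complement has a positive lower
  bound. Finiteness is what permits absorbing a multiple of this integral in Hardy's
  inequality.\<close>

lemma hardy_integral_finite:
  fixes \<Omega> :: "'a::euclidean_space set" and r p :: real
  assumes \<Omega>: "open \<Omega>" "bounded \<Omega>" and p: "p > 0" and r: "real DIM('a) < r" and \<phi>: "\<phi> \<in> test_functions \<Omega>"
  shows "hardy_integral \<Omega> r p \<phi> < \<infinity>"
proof -
  let ?K = "closure {x. \<phi> x \<noteq> 0}" and ?d = "\<lambda>x. infdist x (- \<Omega>)"
  have K: "compact ?K" "?K \<subseteq> \<Omega>" using \<phi> by (auto simp: test_functions_def)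
  have ne: "- \<Omega> \<noteq> {}" using \<Omega>(2) not_bounded_UNIV by (metis Compl_empty_eq double_compl)
  have [measurable]: "\<Omega> \<in> sets borel" using \<Omega>(1) by simp
  obtain \<delta> where \<delta>: "\<delta> > 0" "\<And>x. x \<in> ?K \<Longrightarrow> \<delta> \<le> ?d x"
  proof (cases "?K = {}")
    case True
    then show ?thesis using that[of 1] by simp
  next
    case False
    obtain x0 where x0: "x0 \<in> ?K" "\<forall>y\<in>?K. ?d x0 \<le> ?d y"
      using continuous_attains_inf[OF K(1) False continuous_on_infdist[OF continuous_on_id]] by blast
    have "?d x0 > 0" using x0(1) K(2) \<Omega>(1) ne by (intro infdist_pos_not_in_closed) auto
    with x0(2) show ?thesis by (intro that[of "?d x0"]) auto
  qed
  obtain B where B: "B > 0" "\<And>x. \<bar>\<phi> x\<bar> \<le> B" "\<And>x y. \<bar>\<phi> x - \<phi> y\<bar> \<le> B * norm (x - y)"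
    by (rule test_functions_bounded_lipschitz[OF \<phi>]) (rule that)
  have "hardy_integral \<Omega> r p \<phi> \<le> (\<integral>\<^sup>+x. ennreal (B powr p * \<delta> powr (real DIM('a) - r)) * indicator \<Omega> x \<partial>lborel)"
    unfolding hardy_integral_def
  proof (intro nn_integral_mono mult_right_mono ennreal_leI)
    fix x
    show "\<bar>\<phi> x\<bar> powr p * ?d x powr (real DIM('a) - r) \<le> B powr p * \<delta> powr (DIM('a) - r)"
    proof (cases "x \<in> ?K")
      case True
      have "?d x powr (real DIM('a) - r) \<le> \<delta> powr (real DIM('a) - r)"
        using \<delta>(1) \<delta>(2)[OF True] r by (intro powr_mono2') auto
      moreover have "\<bar>\<phi> x\<bar> powr p \<le> B powr p"
        using B(2)[of x] p by (intro powr_mono2) auto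
      ultimately show ?thesis by (intro mult_mono) auto
    next
      case False
      then have "\<phi> x = 0" using closure_subset[of "{x. \<phi> x \<noteq> 0}"] by auto
      then show ?thesis using p by simp
    qed
  qed auto
  also have "\<dots> < \<infinity>" using bounded_emeasure_finite[OF \<Omega>(2)]
    by (simp add: nn_integral_cmult_indicator ennreal_mult_less_top)
  finally show ?thesis .
qed

text \<open>Compare \<open>\<phi> x\<close> with the values of \<open>\<phi>\<close> on a ball at distance about \<open>\<tau> d(x)\<close> from the boundary. Since
  \<open>r > 2 n\<close>, this reproduces the Hardy integral with a factor \<open>O(\<tau>\<^sup>r\<^sup>-\<^sup>2\<^sup>n)\<close>, which is absorbed for small \<open>\<tau>\<close>. The ball is
  replaced by the set \<open>M\<close> because the nearest boundary point need not depend measurably on \<open>x\<close>.\<close>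

lemma fractional_hardy:
  fixes \<Omega> :: "'a::euclidean_space set" and r p :: real
  assumes \<Omega>: "open \<Omega>" "bounded \<Omega>" and p: "p \<ge> 1" and r: "2 * real DIM('a) < r"
  obtains C where "C > 0" and
    "\<And>\<phi>. \<phi> \<in> test_functions \<Omega> \<Longrightarrow> hardy_integral \<Omega> r p \<phi> \<le> ennreal C * energy_on (\<Omega> \<times> \<Omega>) r p \<phi>"
proof -
  let ?n = "DIM('a)" and ?d = "\<lambda>x. infdist x (- \<Omega>)"
  let ?w = "unit_ball_vol (real ?n)"
  have ne: "\<Omega> \<noteq> UNIV" using \<Omega>(2) not_bounded_UNIV by metis
  have w: "?w > 0" by simp
  have dpos: "?d x > 0" if "x \<in> \<Omega>" for x
    using that \<Omega>(1) ne by (intro infdist_pos_not_in_closed) auto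
  have d0: "x \<in> \<Omega>" if "?d x > 0" for x using that by (metis ComplI infdist_zero less_irrefl)
  have [measurable]: "\<Omega> \<in> sets borel" using \<Omega>(1) by simp
  \<comment> \<open>Chosen so that \<open>A' = A * \<kappa> * \<tau> powr (r - 2 n)\<close> below;
    the power of 4 is the quotient of \<open>(2 / \<tau>)^n\<close> and
    \<open>(\<tau> / 2)^n\<close>, freed of \<tau>. The choice of \<tau> then makes
    \<open>A'\<close> at most half of \<kappa>.\<close>
  define A where "A = 2 powr p * 4 ^ ?n * (3 / 2) powr r"
  have A: "A > 0" by (simp add: A_def)
  obtain \<tau> where \<tau>: "0 < \<tau>" "\<tau> \<le> 1 / 2" "\<tau> powr (r - 2 * ?n) \<le> 1 / (2 * A)"
    using exists_powr_le[of "1 / (2 * A)" "r - 2 * ?n"] A r by auto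
  define \<kappa> where "\<kappa> = ?w * (\<tau> / 2) ^ ?n"
  have \<kappa>: "\<kappa> > 0" using \<tau> w by (simp add: \<kappa>_def)
  define A' where "A' = 2 powr p * (3 / 2) powr r * \<tau> powr r * (?w * (2 / \<tau>) ^ ?n)"
  have A': "A' \<le> \<kappa> / 2"
  proof -
    have "\<tau> powr r = \<tau> powr (r - 2 * ?n) * \<tau> ^ ?n * \<tau> ^ ?n"
      using \<tau> by (simp add: powr_realpow[symmetric] powr_add[symmetric])
    then have "A' = A * \<kappa> * \<tau> powr (r - 2 * ?n)"
      using \<tau> by (simp add: A'_def A_def \<kappa>_def power_divide field_simps power_mult_distrib[symmetric])
    also have "\<dots> \<le> A * \<kappa> * (1 / (2 * A))" using A \<kappa> \<tau>(3) by (intro mult_left_mono) auto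
    also have "\<dots> = \<kappa> / 2" using A by simp
    finally show ?thesis .
  qed
  define M where "M = {(x, y). x \<in> \<Omega> \<and> y \<in> \<Omega> \<and> ?d y \<le> 3 / 2 * \<tau> * ?d x \<and> \<tau> * ?d x / 2 \<le> ?d y \<and> norm (y - x) \<le> ?d x}"
  have M_eq: "M = {z \<in> space borel. fst z \<in> \<Omega> \<and> snd z \<in> \<Omega> \<and> ?d (snd z) \<le> 3 / 2 * \<tau> * ?d (fst z) \<and> \<tau> * ?d (fst z) / 2 \<le> ?d (snd z) \<and> norm (snd z - fst z) \<le> ?d (fst z)}"
    by (auto simp: M_def)
  have inf_m: "(\<lambda>z::'a \<times> 'a. ?d (fst z)) \<in> borel_measurable borel" "(\<lambda>z::'a \<times> 'a. ?d (snd z)) \<in> borel_measurable borel"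
    by (intro borel_measurable_continuous_onI continuous_intros)+
  note [measurable] = inf_m
  have [measurable]: "M \<in> sets borel" unfolding M_eq by measurable
  show ?thesis
  proof (rule that[of "2 powr p * (2 / \<kappa>)"])
    show "2 powr p * (2 / \<kappa>) > 0" using \<kappa> by simp
    fix \<phi> assume \<phi>: "\<phi> \<in> test_functions \<Omega>"
    note [measurable] = test_functions_measurable[OF \<phi>]
    have phm[measurable]: "(\<lambda>z::'a \<times> 'a. \<phi> (fst z)) \<in> borel_measurable borel" "(\<lambda>z::'a \<times> 'a. \<phi> (snd z)) \<in> borel_measurable borel"
      by (intro measurable_compose[OF fst_borel] measurable_compose[OF snd_borel] test_functions_measurable[OF \<phi>])+
    let ?H = "hardy_integral \<Omega> r p \<phi>" and ?E = "energy_on (\<Omega> \<times> \<Omega>) r p \<phi>"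
    \<comment> \<open>From \<open>|\<phi> x|^p \<le> 2^p (|\<phi> y|^p + |\<phi> x - \<phi>
      y|^p)\<close>: \<open>G1\<close> carries the value at \<open>y\<close> and returns a small
      multiple of the Hardy integral, \<open>G2\<close> carries the difference and returns the
      energy.\<close>
    define G1 :: "'a \<times> 'a \<Rightarrow> ennreal" where "G1 z = ennreal (2 powr p * \<bar>\<phi> (snd z)\<bar> powr p * ?d (fst z) powr (- r)) * indicator M z" for z
    define G2 :: "'a \<times> 'a \<Rightarrow> ennreal" where "G2 z = ennreal (2 powr p) * (ennreal (wt r z * \<bar>dif \<phi> z\<bar> powr p) * indicator (\<Omega> \<times> \<Omega>) z)" for z
    have [measurable]: "\<Omega> \<times> \<Omega> \<in> sets borel" using \<Omega>(1) by (simp add: open_Times)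
    have [measurable]: "G1 \<in> borel_measurable borel" "G2 \<in> borel_measurable borel"
      unfolding G1_def[abs_def] G2_def[abs_def] by measurable
    have pt: "ennreal (\<bar>\<phi> x\<bar> powr p * ?d x powr (?n - r) * \<kappa>) * indicator \<Omega> x \<le> (\<integral>\<^sup>+y. G1 (x, y) + G2 (x, y) \<partial>lborel)" for x
    proof (cases "x \<in> \<Omega>")
      case True
      have dx: "?d x > 0" using dpos True by simp
      obtain c where c: "\<And>y. y \<in> ball c (\<tau> * ?d x / 2) \<Longrightarrow>
          \<tau> * ?d x / 2 \<le> ?d y \<and> ?d y \<le> 3 / 2 * \<tau> * ?d x \<and> norm (y - x) \<le> ?d x"
        using nearest_point_ball[OF \<Omega>(1) True ne \<tau>(1)] \<tau>(2) by auto
      let ?B = "ball c (\<tau> * ?d x / 2)"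
      have eq: "\<bar>\<phi> x\<bar> powr p * ?d x powr (?n - r) * \<kappa> = (\<bar>\<phi> x\<bar> powr p * ?d x powr (- r)) * (?w * (\<tau> * ?d x / 2) ^ ?n)"
        using dx by (simp add: \<kappa>_def powr_diff powr_minus_divide powr_realpow power_mult_distrib power_divide)
      have "ennreal (\<bar>\<phi> x\<bar> powr p * ?d x powr (?n - r) * \<kappa>)
          = (\<integral>\<^sup>+y. ennreal (\<bar>\<phi> x\<bar> powr p * ?d x powr (- r)) * indicator ?B y \<partial>lborel)"
        unfolding eq by (rule nn_integral_const_ball(1)[symmetric]) (use dx \<tau> in auto)
      also have "\<dots> \<le> (\<integral>\<^sup>+y. G1 (x, y) + G2 (x, y) \<partial>lborel)"
      proof (rule nn_integral_mono)
        fix y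
        show "ennreal (\<bar>\<phi> x\<bar> powr p * ?d x powr (- r)) * indicator ?B y \<le> G1 (x, y) + G2 (x, y)"
        proof (cases "y \<in> ?B")
          case y: True
          have y\<Omega>: "y \<in> \<Omega>" using c[OF y] \<tau>(1) dx by (intro d0) (meson half_gt_zero less_le_trans mult_pos_pos)
          have inM: "(x, y) \<in> M" using c[OF y] True y\<Omega> by (simp add: M_def)
          have "\<bar>\<phi> x\<bar> powr p \<le> 2 powr p * (\<bar>\<phi> y\<bar> powr p + \<bar>dif \<phi> (x, y)\<bar> powr p)"
            using powr_abs_sum_le2[OF p, of "\<phi> y" "\<phi> x - \<phi> y"] by (simp add: dif_def abs_minus_commute)
          then have "\<bar>\<phi> x\<bar> powr p * ?d x powr (- r) \<le> 2 powr p * (\<bar>\<phi> y\<bar> powr p + \<bar>dif \<phi> (x, y)\<bar> powr p) * ?d x powr (- r)"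
            by (intro mult_right_mono) auto
          also have "\<dots> = 2 powr p * \<bar>\<phi> y\<bar> powr p * ?d x powr (- r) + 2 powr p * (?d x powr (- r) * \<bar>dif \<phi> (x, y)\<bar> powr p)"
            by (simp add: algebra_simps)
          also have "?d x powr (- r) * \<bar>dif \<phi> (x, y)\<bar> powr p \<le> wt r (x, y) * \<bar>dif \<phi> (x, y)\<bar> powr p"
          proof (cases "x = y")
            case False
            then have "?d x powr (- r) \<le> wt r (x, y)" unfolding wt_def powr_minus_divide fst_conv snd_conv
              using c[OF y] r by (intro divide_left_mono powr_mono2 mult_pos_pos) (use dx in auto)
            then show ?thesis by (intro mult_right_mono) auto
          qed (use p in \<open>simp add: dif_def\<close>)
          finally have "\<bar>\<phi> x\<bar> powr p * ?d x powr (- r) \<le> 2 powr p * \<bar>\<phi> y\<bar> powr p * ?d x powr (- r) + 2 powr p * (wt r (x, y) * \<bar>dif \<phi> (x, y)\<bar> powr p)"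
            by simp
          then have "ennreal (\<bar>\<phi> x\<bar> powr p * ?d x powr (- r)) \<le> ennreal (2 powr p * \<bar>\<phi> y\<bar> powr p * ?d x powr (- r) + 2 powr p * (wt r (x, y) * \<bar>dif \<phi> (x, y)\<bar> powr p))"
            by (rule ennreal_leI)
          also have "\<dots> = G1 (x, y) + G2 (x, y)"
            using inM True y\<Omega> by (simp add: G1_def G2_def ennreal_plus ennreal_mult)
          finally show ?thesis using y by simp
        qed simp
      qed
      finally show ?thesis using True by simp
    qed simp
    \<comment> \<open>Integrated in the other order: for fixed \<open>y\<close> the points
      \<open>x\<close> paired with it lie within \<open>2 d(y) / \<tau>\<close>, and
      \<open>d(x)\<close> is bounded below by a multiple of \<open>d(y) / \<tau>\<close>.\<close>
    have G1: "(\<integral>\<^sup>+x. G1 (x, y) \<partial>lborel) \<le> ennreal A' * (ennreal (\<bar>\<phi> y\<bar> powr p * ?d y powr (?n - r)) * indicator \<Omega> y)" for y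
    proof (cases "y \<in> \<Omega>")
      case True
      then have dy: "?d y > 0" using dpos by simp
      let ?c = "2 powr p * \<bar>\<phi> y\<bar> powr p * (?d y / (3 / 2 * \<tau>)) powr (- r)"
      have "(\<integral>\<^sup>+x. G1 (x, y) \<partial>lborel) \<le> (\<integral>\<^sup>+x. ennreal ?c * indicator (cball y (2 / \<tau> * ?d y)) x \<partial>lborel)"
      proof (rule nn_integral_mono)
        fix x
        show "G1 (x, y) \<le> ennreal ?c * indicator (cball y (2 / \<tau> * ?d y)) x"
        proof (cases "(x, y) \<in> M")
          case inM: True
          then have m: "?d y \<le> 3 / 2 * \<tau> * ?d x" "\<tau> * ?d x / 2 \<le> ?d y" "norm (y - x) \<le> ?d x" by (auto simp: M_def)
          have "?d x \<le> 2 / \<tau> * ?d y" using m(2) \<tau>(1) by (simp add: field_simps)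
          then have "x \<in> cball y (2 / \<tau> * ?d y)" using m(3) by (simp add: dist_norm)
          moreover have "?d x powr (- r) \<le> (?d y / (3 / 2 * \<tau>)) powr (- r)"
            using m(1) \<tau>(1) dy r by (intro powr_mono2') (auto simp: field_simps)
          then have "2 powr p * \<bar>\<phi> y\<bar> powr p * ?d x powr (- r) \<le> ?c" by (intro mult_left_mono) auto
          ultimately show ?thesis using inM by (simp add: G1_def ennreal_leI)
        qed (simp add: G1_def)
      qed
      also have "\<dots> = ennreal (?c * (?w * (2 / \<tau> * ?d y) ^ ?n))"
        using dy \<tau> by (intro nn_integral_const_ball) auto
      also have "?c * (?w * (2 / \<tau> * ?d y) ^ ?n) = A' * (\<bar>\<phi> y\<bar> powr p * ?d y powr (?n - r))"
      proof -
        have "(?d y / (3 / 2 * \<tau>)) powr (- r) = (3 / 2) powr r * \<tau> powr r * ?d y powr (- r)"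
          using dy \<tau>(1) by (simp add: powr_divide powr_minus_divide powr_mult)
        moreover have "?d y powr (?n - r) = ?d y powr (- r) * ?d y ^ ?n"
          using dy by (simp add: powr_diff powr_minus_divide powr_realpow)
        ultimately show ?thesis by (simp only: A'_def power_mult_distrib mult_ac)
      qed
      finally show ?thesis using True \<tau>(1) by (simp add: ennreal_mult A'_def)
    next
      case False
      then have "G1 (x, y) = 0" for x by (simp add: G1_def M_def)
      then show ?thesis by simp
    qed
    have "ennreal \<kappa> * ?H = (\<integral>\<^sup>+x. ennreal (\<bar>\<phi> x\<bar> powr p * ?d x powr (?n - r) * \<kappa>) * indicator \<Omega> x \<partial>lborel)"
      unfolding hardy_integral_def using \<kappa>
      by (subst nn_integral_cmult[symmetric]) (auto simp: ennreal_mult mult_ac intro!: nn_integral_cong)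
    also have "\<dots> \<le> (\<integral>\<^sup>+x. \<integral>\<^sup>+y. G1 (x, y) + G2 (x, y) \<partial>lborel \<partial>lborel)"
      by (intro nn_integral_mono pt)
    also have "\<dots> = (\<integral>\<^sup>+z. G1 z + G2 z \<partial>lborel)"
      by (rule nn_integral_pair(1)[symmetric]) measurable
    also have "\<dots> = (\<integral>\<^sup>+z. G1 z \<partial>lborel) + (\<integral>\<^sup>+z. G2 z \<partial>lborel)"
      by (rule nn_integral_add) auto
    also have "(\<integral>\<^sup>+z. G2 z \<partial>lborel) = ennreal (2 powr p) * ?E"
      unfolding G2_def energy_on_def by (rule nn_integral_cmult) measurable
    also have "(\<integral>\<^sup>+z. G1 z \<partial>lborel) = (\<integral>\<^sup>+y. \<integral>\<^sup>+x. G1 (x, y) \<partial>lborel \<partial>lborel)"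
      by (rule nn_integral_pair(2)) measurable
    also have "\<dots> \<le> (\<integral>\<^sup>+y. ennreal A' * (ennreal (\<bar>\<phi> y\<bar> powr p * ?d y powr (?n - r)) * indicator \<Omega> y) \<partial>lborel)"
      by (intro nn_integral_mono G1)
    also have "\<dots> = ennreal A' * ?H"
      unfolding hardy_integral_def by (rule nn_integral_cmult) measurable
    also have "ennreal A' * ?H \<le> ennreal (\<kappa> / 2) * ?H"
      using A' by (intro mult_right_mono ennreal_leI) auto
    finally have main: "ennreal \<kappa> * ?H \<le> ennreal (\<kappa> / 2) * ?H + ennreal (2 powr p) * ?E"
      by (simp add: add_right_mono)
    have Hfin: "?H < \<infinity>" using hardy_integral_finite[OF \<Omega> _ _ \<phi>] p r by simp
    then obtain h where h: "?H = ennreal h" "h \<ge> 0" by (cases ?H) auto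
    show "?H \<le> ennreal (2 powr p * (2 / \<kappa>)) * ?E"
    proof (cases ?E)
      case top
      then show ?thesis using \<kappa> by (simp add: ennreal_mult_top)
    next
      case (real e)
      have "ennreal (\<kappa> * h) \<le> ennreal (\<kappa> / 2 * h + 2 powr p * e)"
      proof -
        have "ennreal (\<kappa> / 2 * h + 2 powr p * e) = ennreal (\<kappa> / 2) * ennreal h + ennreal (2 powr p) * ennreal e"
          using h(2) real(1) \<kappa> by (subst ennreal_plus) (auto simp: ennreal_mult[symmetric])
        moreover have "ennreal (\<kappa> * h) = ennreal \<kappa> * ennreal h"
          using h(2) \<kappa> by (intro ennreal_mult) auto
        ultimately show ?thesis using main h(1) real(2) by simp
      qed
      then have "\<kappa> * h \<le> \<kappa> / 2 * h + 2 powr p * e"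
        using real h \<kappa> by (subst (asm) ennreal_le_iff) auto
      then have "h \<le> 2 powr p * (2 / \<kappa>) * e" using \<kappa> by (simp add: field_simps)
      then show ?thesis using h real \<kappa> by (simp add: ennreal_mult[symmetric] ennreal_leI)
    qed
  qed
qed

lemma energy_on_sym:
  assumes [measurable]: "u \<in> borel_measurable borel" "A \<in> sets borel" "B \<in> sets borel"
  shows "energy_on (A \<times> B) r p u = energy_on (B \<times> A) r p u"
proof -
  have m: "\<And>A B. A \<in> sets borel \<Longrightarrow> B \<in> sets borel \<Longrightarrow> A \<times> B \<in> sets (borel :: ('a \<times> 'a) measure)"
    by (metis borel_prod pair_measureI)
  have [measurable]: "A \<times> B \<in> sets borel" "B \<times> A \<in> sets borel" by (auto intro: m)
  show ?thesis
    unfolding energy_on_def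
    by (subst nn_integral_pair(1), measurable, subst nn_integral_pair(2), measurable)
      (auto simp: wt_def dif_def norm_minus_commute abs_minus_commute indicator_def intro!: nn_integral_cong)
qed

text \<open>Outside \<Omega> \<times> \<Omega> only pairs with exactly one point in \<Omega>
  contribute. There the difference is a value of \<phi>, and integrating the kernel over the other
  point leaves the Hardy integral. The two equal cross terms account for the constant.\<close>

lemma energy_global_le:
  fixes \<Omega> :: "'a::euclidean_space set" and r p :: real
  assumes \<Omega>: "open \<Omega>" "bounded \<Omega>" and p: "p \<ge> 1" and r: "2 * real DIM('a) < r"
  obtains C where "C > 0" and
    "\<And>\<phi>. \<phi> \<in> test_functions \<Omega> \<Longrightarrow> energy_on UNIV r p \<phi> \<le> ennreal C * energy_on (\<Omega> \<times> \<Omega>) r p \<phi>"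
proof -
  let ?n = "DIM('a)" and ?d = "\<lambda>x. infdist x (- \<Omega>)"
  have ne: "\<Omega> \<noteq> UNIV" using \<Omega>(2) not_bounded_UNIV by metis
  have dpos: "?d x > 0" if "x \<in> \<Omega>" for x
    using that \<Omega>(1) ne by (intro infdist_pos_not_in_closed) auto
  have [measurable]: "\<Omega> \<in> sets borel" using \<Omega>(1) by simp
  have m: "\<And>A B. A \<in> sets borel \<Longrightarrow> B \<in> sets borel \<Longrightarrow> A \<times> B \<in> sets (borel :: ('a \<times> 'a) measure)"
    by (metis borel_prod pair_measureI)
  have [measurable]: "\<Omega> \<times> \<Omega> \<in> sets borel" "\<Omega> \<times> (- \<Omega>) \<in> sets borel" "(- \<Omega>) \<times> \<Omega> \<in> sets borel"
    by (auto intro!: m)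
  obtain C1 where C1: "C1 > 0" "\<And>\<phi>. \<phi> \<in> test_functions \<Omega> \<Longrightarrow> hardy_integral \<Omega> r p \<phi> \<le> ennreal C1 * energy_on (\<Omega> \<times> \<Omega>) r p \<phi>"
    using fractional_hardy[OF \<Omega> p r] by blast
  have "real DIM('a) < r" using r DIM_positive[where 'a='a] by linarith
  then obtain C2 where C2: "C2 > 0" "\<And>x::'a. \<And>d. d > 0 \<Longrightarrow>
    (\<integral>\<^sup>+y. ennreal (if d \<le> norm (y - x) then 1 / norm (y - x) powr r else 0) \<partial>lborel)
      \<le> ennreal (C2 * d powr (real DIM('a) - r))"
    using tail_integral by blast
  show ?thesis
  proof (rule that[of "1 + (C2 * C1 + C2 * C1)"])
    show "1 + (C2 * C1 + C2 * C1) > 0" using C1(1) C2(1) by (intro add_pos_pos mult_pos_pos) auto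
    fix \<phi> assume \<phi>: "\<phi> \<in> test_functions \<Omega>"
    note [measurable] = test_functions_measurable[OF \<phi>]
    note out = test_functions_outside[OF \<phi>]
    let ?f = "\<lambda>z. ennreal (wt r z * \<bar>dif \<phi> z\<bar> powr p)"
    have cross: "energy_on (\<Omega> \<times> (- \<Omega>)) r p \<phi> \<le> ennreal C2 * hardy_integral \<Omega> r p \<phi>"
    proof -
      have "energy_on (\<Omega> \<times> (- \<Omega>)) r p \<phi> = (\<integral>\<^sup>+x. \<integral>\<^sup>+y. ?f (x, y) * indicator (\<Omega> \<times> (- \<Omega>)) (x, y) \<partial>lborel \<partial>lborel)"
        unfolding energy_on_def by (rule nn_integral_pair(1)) measurable
      also have "\<dots> \<le> (\<integral>\<^sup>+x. ennreal C2 * (ennreal (\<bar>\<phi> x\<bar> powr p * ?d x powr (real ?n - r)) * indicator \<Omega> x) \<partial>lborel)"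
      proof (rule nn_integral_mono)
        fix x
        show "(\<integral>\<^sup>+y. ?f (x, y) * indicator (\<Omega> \<times> (- \<Omega>)) (x, y) \<partial>lborel)
          \<le> ennreal C2 * (ennreal (\<bar>\<phi> x\<bar> powr p * ?d x powr (real ?n - r)) * indicator \<Omega> x)"
        proof (cases "x \<in> \<Omega>")
          case True
          have "(\<integral>\<^sup>+y. ?f (x, y) * indicator (\<Omega> \<times> (- \<Omega>)) (x, y) \<partial>lborel)
            \<le> (\<integral>\<^sup>+y. ennreal (\<bar>\<phi> x\<bar> powr p) * ennreal (if ?d x \<le> norm (y - x) then 1 / norm (y - x) powr r else 0) \<partial>lborel)"
          proof (rule nn_integral_mono)
            fix y
            show "?f (x, y) * indicator (\<Omega> \<times> (- \<Omega>)) (x, y)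
              \<le> ennreal (\<bar>\<phi> x\<bar> powr p) * ennreal (if ?d x \<le> norm (y - x) then 1 / norm (y - x) powr r else 0)"
            proof (cases "y \<in> \<Omega>")
              case False
              have "?d x \<le> norm (y - x)"
                using infdist_le[of y "- \<Omega>" x] False by (simp add: dist_norm norm_minus_commute)
              then show ?thesis using True False out[OF False]
                by (simp add: wt_def dif_def ennreal_mult[symmetric])
            qed simp
          qed
          also have "\<dots> = ennreal (\<bar>\<phi> x\<bar> powr p) * (\<integral>\<^sup>+y. ennreal (if ?d x \<le> norm (y - x) then 1 / norm (y - x) powr r else 0) \<partial>lborel)"
            by (rule nn_integral_cmult) measurable
          also have "\<dots> \<le> ennreal (\<bar>\<phi> x\<bar> powr p) * ennreal (C2 * ?d x powr (real ?n - r))"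
            by (intro mult_left_mono C2(2) dpos True) auto
          also have "\<dots> = ennreal C2 * (ennreal (\<bar>\<phi> x\<bar> powr p * ?d x powr (real ?n - r)) * indicator \<Omega> x)"
            using True C2(1) by (simp add: ennreal_mult mult_ac)
          finally show ?thesis .
        qed simp
      qed
      also have "\<dots> = ennreal C2 * hardy_integral \<Omega> r p \<phi>"
        unfolding hardy_integral_def by (rule nn_integral_cmult) measurable
      finally show ?thesis .
    qed
    have "energy_on UNIV r p \<phi> \<le> (\<integral>\<^sup>+z. ?f z * indicator (\<Omega> \<times> \<Omega>) z + (?f z * indicator (\<Omega> \<times> (- \<Omega>)) z + ?f z * indicator ((- \<Omega>) \<times> \<Omega>) z) \<partial>lborel)"
      unfolding energy_on_def
    proof (rule nn_integral_mono)
      fix z :: "'a \<times> 'a"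
      obtain x y where z: "z = (x, y)" by (cases z)
      show "?f z * indicator UNIV z \<le> ?f z * indicator (\<Omega> \<times> \<Omega>) z + (?f z * indicator (\<Omega> \<times> (- \<Omega>)) z + ?f z * indicator ((- \<Omega>) \<times> \<Omega>) z)"
        unfolding z using out[of x] out[of y] p by (cases "x \<in> \<Omega>"; cases "y \<in> \<Omega>") (auto simp: dif_def)
    qed
    also have "\<dots> = energy_on (\<Omega> \<times> \<Omega>) r p \<phi> + (energy_on (\<Omega> \<times> (- \<Omega>)) r p \<phi> + energy_on ((- \<Omega>) \<times> \<Omega>) r p \<phi>)"
    proof -
      have f: "?f \<in> borel_measurable lborel" by measurable
      have m: "(\<lambda>z. ?f z * indicator S z) \<in> borel_measurable lborel" if "S \<in> sets borel" for S
        using that by (intro borel_measurable_times_ennreal borel_measurable_indicator f) simp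
      have s: "\<Omega> \<times> \<Omega> \<in> sets borel" "\<Omega> \<times> (- \<Omega>) \<in> sets borel" "(- \<Omega>) \<times> \<Omega> \<in> sets borel"
        by measurable
      show ?thesis
        unfolding energy_on_def
        by (simp only: nn_integral_add m s borel_measurable_add)
    qed
    also have "energy_on ((- \<Omega>) \<times> \<Omega>) r p \<phi> = energy_on (\<Omega> \<times> (- \<Omega>)) r p \<phi>"
      by (rule energy_on_sym) measurable
    also have "energy_on (\<Omega> \<times> \<Omega>) r p \<phi> + (energy_on (\<Omega> \<times> (- \<Omega>)) r p \<phi> + energy_on (\<Omega> \<times> (- \<Omega>)) r p \<phi>)
      \<le> energy_on (\<Omega> \<times> \<Omega>) r p \<phi> + (ennreal C2 * (ennreal C1 * energy_on (\<Omega> \<times> \<Omega>) r p \<phi>) + ennreal C2 * (ennreal C1 * energy_on (\<Omega> \<times> \<Omega>) r p \<phi>))"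
      by (intro add_left_mono add_mono order.trans[OF cross] mult_left_mono C1(2) \<phi>) auto
    also have "\<dots> = ennreal (1 + (C2 * C1 + C2 * C1)) * energy_on (\<Omega> \<times> \<Omega>) r p \<phi>"
    proof -
      have "ennreal (1 + (C2 * C1 + C2 * C1)) = 1 + (ennreal C2 * ennreal C1 + ennreal C2 * ennreal C1)"
        using C1(1) C2(1) by (simp add: ennreal_mult mult_2 mult.commute)
      then show ?thesis by (simp only: distrib_right mult_1 mult.assoc)
    qed
    finally show "energy_on UNIV r p \<phi> \<le> ennreal (1 + (C2 * C1 + C2 * C1)) * energy_on (\<Omega> \<times> \<Omega>) r p \<phi>" .
  qed
qed

text \<open>The a priori Hoelder bound only serves to absorb: its constant does not enter the conclusion.\<close>

lemma morrey:
  fixes r p :: real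
  assumes p: "p \<ge> 1" and r: "2 * real DIM('a::euclidean_space) < r"
  defines "\<gamma> \<equiv> (r - 2 * real DIM('a)) / p"
  obtains K where "K > 0" and
    "\<And>(f :: 'a \<Rightarrow> real) L M x y. f \<in> borel_measurable borel \<Longrightarrow>
      (\<And>x y. \<bar>f x - f y\<bar> \<le> L * norm (x - y) powr \<gamma>) \<Longrightarrow> energy_on UNIV r p f \<le> ennreal M \<Longrightarrow> M > 0 \<Longrightarrow>
      \<bar>f x - f y\<bar> \<le> K * M powr (1 / p) * norm (x - y) powr \<gamma>"
proof -
  let ?n = "DIM('a)"
  let ?w = "unit_ball_vol (real ?n)"
  have w: "?w > 0" by simp
  have \<gamma>: "\<gamma> > 0" using p r by (simp add: \<gamma>_def)
  obtain \<tau> where \<tau>: "0 < \<tau>" "\<tau> \<le> 1 / 2" "\<tau> powr \<gamma> \<le> 1 / 4"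
    using exists_powr_le[of "1 / 4" \<gamma>] \<gamma> by auto
  \<comment> \<open>The value for which the lower energy bound in the contradiction below is exactly
    \<open>2 * M\<close>.\<close>
  define A where "A = 2 powr r * 2 / (?w * \<tau> ^ ?n)\<^sup>2"
  have A: "A > 0" unfolding A_def
    by (intro divide_pos_pos mult_pos_pos zero_less_power w \<tau>(1)) auto
  define K0 where "K0 = A powr (1 / p)"
  have K0: "K0 > 0" using A by (simp add: K0_def)
  show ?thesis
  proof (rule that[of "2 * K0"])
    show "2 * K0 > 0" using K0 by simp
    fix f :: "'a \<Rightarrow> real" and L M :: real and x y :: 'a
    assume f[measurable]: "f \<in> borel_measurable borel" and L: "\<And>x y. \<bar>f x - f y\<bar> \<le> L * norm (x - y) powr \<gamma>"
      and E: "energy_on UNIV r p f \<le> ennreal M" and M: "M > 0"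
    define c0 where "c0 = K0 * M powr (1 / p)"
    \<comment> \<open>If all pairs from the two small balls had larger differences, the product of
      the balls alone would carry energy at least \<open>2 * M\<close>; distances between the balls
      are at most \<open>2 |x - y|\<close>.\<close>
    have near: "\<exists>x'\<in>ball x (\<tau> * norm (x - y)). \<exists>y'\<in>ball y (\<tau> * norm (x - y)). \<bar>f x' - f y'\<bar> \<le> c0 * norm (x - y) powr \<gamma>"
      if "x \<noteq> y" for x y
    proof (rule ccontr)
      let ?t = "norm (x - y)"
      let ?c = "c0 * ?t powr \<gamma>"
      let ?B = "ball x (\<tau> * ?t) \<times> ball y (\<tau> * ?t)"
      let ?m = "?w * (\<tau> * ?t) ^ ?n"
      have t: "?t > 0" using that by simp
      assume "\<not> ?thesis"
      then have big: "\<bar>f x' - f y'\<bar> > ?c" if "x' \<in> ball x (\<tau> * ?t)" "y' \<in> ball y (\<tau> * ?t)" for x' y'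
        using that by force
      have c: "?c \<ge> 0" using K0 M by (simp add: c0_def)
      have [measurable]: "?B \<in> sets borel" by (simp add: open_Times borel_open)
      have "ennreal (2 * M) = ennreal ((2 * ?t) powr (- r) * ?c powr p) * emeasure lborel ?B"
      proof -
        have "emeasure lborel ?B = emeasure lborel (ball x (\<tau> * ?t)) * emeasure lborel (ball y (\<tau> * ?t))"
          unfolding lborel_prod[symmetric] by (rule lborel.emeasure_pair_measure_Times) auto
        also have "\<dots> = ennreal (?m * ?m)"
          using t \<tau> by (simp add: emeasure_ball ennreal_mult)
        finally have e: "emeasure lborel ?B = ennreal (?m * ?m)" .
        have "?c powr p = A * M * ?t powr (r - 2 * real ?n)"
          using A M t p by (simp add: c0_def K0_def powr_mult powr_powr \<gamma>_def)
        moreover have "?t powr (r - 2 * real ?n) = ?t powr r / (?t ^ ?n * ?t ^ ?n)"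
          using t by (simp add: powr_diff powr_realpow[symmetric] powr_add[symmetric])
        ultimately have "(2 * ?t) powr (- r) * ?c powr p * (?m * ?m) = 2 * M"
          using t \<tau> less_imp_neq[OF w, symmetric] by (simp add: A_def powr_minus_divide powr_mult power2_eq_square power_mult_distrib)
        then show ?thesis unfolding e using t \<tau> by (subst ennreal_mult[symmetric]) auto
      qed
      also have "\<dots> = (\<integral>\<^sup>+z. ennreal ((2 * ?t) powr (- r) * ?c powr p) * indicator ?B z \<partial>lborel)"
        by (rule nn_integral_cmult_indicator[symmetric]) simp
      also have "\<dots> \<le> energy_on UNIV r p f"
        unfolding energy_on_def
      proof (rule nn_integral_mono)
        fix z :: "'a \<times> 'a"
        show "ennreal ((2 * ?t) powr (- r) * ?c powr p) * indicator ?B z \<le> ennreal (wt r z * \<bar>dif f z\<bar> powr p) * indicator UNIV z"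
        proof (cases "z \<in> ?B")
          case True
          obtain x' y' where z: "z = (x', y')" by (cases z)
          with True have in': "x' \<in> ball x (\<tau> * ?t)" "y' \<in> ball y (\<tau> * ?t)" by auto
          have tt: "\<tau> * ?t \<le> 1 / 2 * ?t" using \<tau> t by (intro mult_right_mono) auto
          have d: "norm (x - x') < 1 / 2 * ?t" "norm (y - y') < 1 / 2 * ?t" using in' tt by (auto simp: dist_norm)
          have "norm (y' - x') \<le> norm (x - x') + norm (y - y') + ?t"
            using norm_triangle_ineq[of "(x - x') - (y - y')" "y - x"] norm_triangle_ineq4[of "x - x'" "y - y'"]
            by (simp add: norm_minus_commute)
          then have up: "norm (y' - x') \<le> 2 * ?t" using d by linarith
          have "?t \<le> norm (x - x') + norm (y - y') + norm (y' - x')"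
            using norm_triangle_ineq[of "(x - x') - (y - y')" "x' - y'"] norm_triangle_ineq4[of "x - x'" "y - y'"]
            by (simp add: norm_minus_commute)
          then have "norm (y' - x') > 0" using d by linarith
          then have "(2 * ?t) powr (- r) \<le> wt r z"
            unfolding wt_def powr_minus_divide z fst_conv snd_conv
            using up r by (intro divide_left_mono powr_mono2 mult_pos_pos) auto
          moreover have "?c powr p \<le> \<bar>dif f z\<bar> powr p"
            using big[OF in'] c p by (intro powr_mono2) (auto simp: z dif_def abs_minus_commute)
          ultimately show ?thesis using True by (auto intro!: ennreal_leI mult_mono)
        qed simp
      qed
      also have "\<dots> \<le> ennreal M" by (rule E)
      finally show False using M by (simp add: ennreal_le_iff)
    qed
    \<comment> \<open>Passing from \<open>x\<close>, \<open>y\<close> to the good pair costs at most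
      a quarter of the old constant at each end, because
      \<open>\<tau> powr \<gamma> \<le> 1 / 4\<close>. Iteration drives the constant to the fixed
      point \<open>2 * c0\<close>.\<close>
    have step: "\<bar>f x - f y\<bar> \<le> (l / 2 + c0) * norm (x - y) powr \<gamma>"
      if l: "\<And>x y. \<bar>f x - f y\<bar> \<le> l * norm (x - y) powr \<gamma>" and "l \<ge> 0" for l x y
    proof (cases "x = y")
      case False
      let ?t = "norm (x - y)"
      obtain x' y' where xy: "x' \<in> ball x (\<tau> * ?t)" "y' \<in> ball y (\<tau> * ?t)" "\<bar>f x' - f y'\<bar> \<le> c0 * ?t powr \<gamma>"
        using near[OF False] by blast
      have *: "l * s powr \<gamma> \<le> l / 4 * ?t powr \<gamma>" if "0 \<le> s" "s \<le> \<tau> * ?t" for s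
      proof -
        have "s powr \<gamma> \<le> (\<tau> * ?t) powr \<gamma>" using that \<gamma> by (intro powr_mono2) auto
        also have "\<dots> = \<tau> powr \<gamma> * ?t powr \<gamma>" using \<tau> by (simp add: powr_mult)
        also have "\<dots> \<le> 1 / 4 * ?t powr \<gamma>" using \<tau>(3) by (intro mult_right_mono) auto
        finally show ?thesis using mult_left_mono[OF _ \<open>l \<ge> 0\<close>] by fastforce
      qed
      have "\<bar>f x - f x'\<bar> \<le> l / 4 * ?t powr \<gamma>"
        using l[of x x'] *[of "norm (x - x')"] xy(1) by (simp add: dist_norm)
      moreover have "\<bar>f y - f y'\<bar> \<le> l / 4 * ?t powr \<gamma>"
        using l[of y y'] *[of "norm (y - y')"] xy(2) by (simp add: dist_norm)
      moreover have "\<bar>f x - f y\<bar> \<le> \<bar>f x - f x'\<bar> + \<bar>f x' - f y'\<bar> + \<bar>f y - f y'\<bar>" by linarith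
      ultimately show ?thesis using xy(3) by (simp add: algebra_simps)
    qed simp
    have it: "\<bar>f x - f y\<bar> \<le> (2 * c0 + \<bar>L\<bar> * (1 / 2) ^ k) * norm (x - y) powr \<gamma>" for k x y
    proof (induction k arbitrary: x y)
      case 0
      have "L * norm (x - y) powr \<gamma> \<le> (2 * c0 + \<bar>L\<bar>) * norm (x - y) powr \<gamma>"
        using K0 M by (intro mult_right_mono) (auto simp: c0_def intro: add_increasing)
      with L[of x y] show ?case by simp
    next
      case (Suc k)
      have "2 * c0 + \<bar>L\<bar> * (1 / 2) ^ k \<ge> 0" using K0 M by (simp add: c0_def)
      from step[OF Suc this] show ?case by (simp add: field_simps)
    qed
    have "(\<lambda>k. (2 * c0 + \<bar>L\<bar> * (1 / 2) ^ k) * norm (x - y) powr \<gamma>) \<longlonglongrightarrow> (2 * c0 + \<bar>L\<bar> * 0) * norm (x - y) powr \<gamma>"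
      by (intro tendsto_intros LIMSEQ_power_zero) auto
    then have "\<bar>f x - f y\<bar> \<le> (2 * c0 + \<bar>L\<bar> * 0) * norm (x - y) powr \<gamma>"
      by (rule LIMSEQ_le_const) (use it in blast)
    then show "\<bar>f x - f y\<bar> \<le> 2 * K0 * M powr (1 / p) * norm (x - y) powr \<gamma>"
      by (simp add: c0_def)
  qed
qed

section \<open>Difference quotients as integrals against the kernel measure\<close>

lemma energy_on_mono: "A \<subseteq> B \<Longrightarrow> energy_on A r p u \<le> energy_on B r p u"
  unfolding energy_on_def by (intro nn_integral_mono) (auto simp: indicator_def)

lemma diff_quotient_eq: "diff_quotient r p u = (\<lambda>z. wt r z * \<bar>dif u z\<bar> powr p)"
  by (auto simp: diff_quotient_def wt_def dif_def)

lemma set_integrable_diff_quotient: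
  fixes u :: "'a::euclidean_space \<Rightarrow> real"
  assumes [measurable]: "u \<in> borel_measurable borel" "A \<in> sets borel"
  shows "set_integrable (lborel \<Otimes>\<^sub>M lborel) A (diff_quotient r p u) \<longleftrightarrow> Lpow (kern_on A r) p (dif u)"
    and "set_lebesgue_integral (lborel \<Otimes>\<^sub>M lborel) A (diff_quotient r p u) = Jpow (kern_on A r) p (dif u)"
proof -
  have k: "kern_on A r = density lborel (\<lambda>z. ennreal (wt r z * indicator A z))"
    unfolding kern_on_def by (rule density_cong) (auto simp: indicator_def)
  show "set_integrable (lborel \<Otimes>\<^sub>M lborel) A (diff_quotient r p u) \<longleftrightarrow> Lpow (kern_on A r) p (dif u)"
    unfolding lborel_prod set_integrable_def diff_quotient_eq Lpow_def k
    by (subst integrable_density) (auto simp: mult_ac)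
  show "set_lebesgue_integral (lborel \<Otimes>\<^sub>M lborel) A (diff_quotient r p u) = Jpow (kern_on A r) p (dif u)"
    unfolding lborel_prod set_lebesgue_integral_def diff_quotient_eq Jpow_def k
    by (subst integral_density) (auto simp: mult_ac)
qed

lemma AE_pair_lborel:
  fixes Q :: "'a::euclidean_space \<Rightarrow> bool"
  assumes "AE x in lborel. Q x"
  shows "AE z in (lborel :: ('a \<times> 'a) measure). Q (fst z) \<and> Q (snd z)"
proof -
  obtain A where A: "{x. \<not> Q x} \<subseteq> A" "A \<in> sets borel" "emeasure lborel A = 0"
    using assms by (auto elim!: AE_E)
  have "A \<times> UNIV \<in> null_sets (lborel :: ('a \<times> 'a) measure)" "UNIV \<times> A \<in> null_sets (lborel :: ('a \<times> 'a) measure)"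
    using A(2,3) lborel.emeasure_pair_measure_Times[of A lborel UNIV] lborel.emeasure_pair_measure_Times[of UNIV lborel A]
    unfolding lborel_prod null_sets_def by (auto simp: lborel_prod[symmetric] simp del: lborel_prod)
  then have "AE z in (lborel :: ('a \<times> 'a) measure). z \<notin> A \<times> UNIV" "AE z in (lborel :: ('a \<times> 'a) measure). z \<notin> UNIV \<times> A"
    by (auto intro: AE_not_in)
  then show ?thesis
    by eventually_elim (use A(1) in \<open>auto simp: mem_Times_iff\<close>)
qed

text \<open>Upper semicontinuity under strong convergence, via \<open>powr_abs_sum_le\<close>: first
  \<theta> is chosen so small that the coefficient of the limit is nearly 1, then \<open>k\<close>
  so large that the error, with its large coefficient, is negligible.\<close>

lemma Jpow_limsup:
  assumes a: "Lpow N p a" and c: "\<And>k. Lpow N p (\<lambda>z. c k z - a z)"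
    and lim: "(\<lambda>k. Jpow N p (\<lambda>z. c k z - a z)) \<longlonglongrightarrow> 0" and p: "p \<ge> 1" and e: "e > 0"
  shows "eventually (\<lambda>k. Jpow N p (c k) < Jpow N p a + e) sequentially"
proof -
  have "((\<lambda>\<theta>. (1 - \<theta>) powr (1 - p) * Jpow N p a) \<longlongrightarrow> (1 - 0) powr (1 - p) * Jpow N p a) (at_right 0)"
    by (intro tendsto_intros) auto
  then have "eventually (\<lambda>\<theta>. (1 - \<theta>) powr (1 - p) * Jpow N p a < Jpow N p a + e) (at_right 0)"
    by (rule order_tendstoD(2)) (use e in simp)
  moreover have "eventually (\<lambda>\<theta>::real. 0 < \<theta> \<and> \<theta> < 1) (at_right 0)"
    by (rule eventually_at_rightI[of 0 1]) auto
  ultimately obtain \<theta> :: real where \<theta>: "0 < \<theta>" "\<theta> < 1" "(1 - \<theta>) powr (1 - p) * Jpow N p a < Jpow N p a + e"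
    using eventually_happens[OF eventually_conj] by (metis (mono_tags, lifting) trivial_limit_at_right_real)
  have "(\<lambda>k. (1 - \<theta>) powr (1 - p) * Jpow N p a + \<theta> powr (1 - p) * Jpow N p (\<lambda>z. c k z - a z))
      \<longlonglongrightarrow> (1 - \<theta>) powr (1 - p) * Jpow N p a + \<theta> powr (1 - p) * 0"
    by (intro tendsto_intros lim)
  then have "eventually (\<lambda>k. (1 - \<theta>) powr (1 - p) * Jpow N p a + \<theta> powr (1 - p) * Jpow N p (\<lambda>z. c k z - a z)
      < Jpow N p a + e) sequentially"
    by (rule order_tendstoD(2)) (use \<theta>(3) in simp)
  then show ?thesis
  proof eventually_elim
    case (elim k)
    have "Jpow N p (\<lambda>z. a z + (c k z - a z)) \<le> (1 - \<theta>) powr (1 - p) * Jpow N p a + \<theta> powr (1 - p) * Jpow N p (\<lambda>z. c k z - a z)"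
      by (rule Lpow_add(2)[OF a c p \<theta>(1,2)])
    with elim show ?case by simp
  qed
qed

lemma dif_simps:
  "dif (\<lambda>x. f x - g x) = (\<lambda>z. dif f z - dif g z)"
  "dif (\<lambda>x. f x + g x) = (\<lambda>z. dif f z + dif g z)"
  "dif (\<lambda>x. c * f x) = (\<lambda>z. c * dif f z)"
  by (auto simp: dif_def algebra_simps)

subsection \<open>The closure of the test functions\<close>

text \<open>Here \<open>r\<close> stands for \<open>\<alpha> p = n + s p\<close> and \<gamma> is the
  exponent of Morrey's inequality. The upper bound on \<open>r\<close> yields
  \<open>\<gamma> \<le> 1\<close>, so that test functions satisfy its a priori hypothesis, and gives
  them finite energy.\<close>

locale fractional =
  fixes \<Omega> :: "'a::euclidean_space set" and r p \<gamma> :: real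
  assumes open_\<Omega>: "open \<Omega>" and bounded_\<Omega>: "bounded \<Omega>" and nonempty_\<Omega>: "\<Omega> \<noteq> {}"
    and p2: "p \<ge> 2" and r_lower: "2 * real DIM('a) < r" and r_upper: "r < real DIM('a) + p"
    and \<gamma>_eq: "\<gamma> = (r - 2 * real DIM('a)) / p"
begin

abbreviation "test \<equiv> test_functions \<Omega>"
abbreviation "fin u \<equiv> Lpow (kern r) p (dif u)"
abbreviation "En u \<equiv> Jpow (kern r) p (dif u)"
abbreviation "Pw u \<equiv> Jpow lborel p u"

lemma p1: "p > 1" "p \<ge> 1" "p > 0" "p \<ge> 0" using p2 by auto

lemma r1: "real DIM('a) < r" using r_lower DIM_positive[where 'a='a] by linarith

lemma \<gamma>: "0 < \<gamma>" "\<gamma> \<le> 1" unfolding \<gamma>_eq using p2 r_lower r_upper by (auto simp: field_simps)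

lemma sets_\<Omega>[measurable]: "\<Omega> \<in> sets borel" using open_\<Omega> by simp

lemma sets_\<Omega>\<Omega>[measurable]: "\<Omega> \<times> \<Omega> \<in> sets borel" using open_\<Omega> by (simp add: open_Times borel_open)

lemma emeasure_\<Omega>: "emeasure lborel \<Omega> < \<infinity>"
  using bounded_\<Omega> by (rule bounded_emeasure_finite)

lemma bounded_Lpow:
  assumes [measurable]: "u \<in> borel_measurable borel" and "\<And>x. x \<notin> \<Omega> \<Longrightarrow> u x = 0" and "\<And>x. \<bar>u x\<bar> \<le> B"
  shows "Lpow lborel p u" and "Pw u \<le> B powr p * measure lborel \<Omega>"
proof -
  have B: "B \<ge> 0" using assms(3)[of undefined] by linarith
  have i: "integrable lborel (\<lambda>x. B powr p * indicator \<Omega> x)"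
    using emeasure_\<Omega> by (intro integrable_mult_right integrable_real_indicator) auto
  have le: "\<bar>u x\<bar> powr p \<le> B powr p * indicator \<Omega> x" for x
    using assms(2)[of x] assms(3)[of x] p1 by (cases "x \<in> \<Omega>") (auto intro: powr_mono2)
  have j: "integrable lborel (\<lambda>x. \<bar>u x\<bar> powr p)"
    by (rule Bochner_Integration.integrable_bound[OF i]) (use le in \<open>auto intro: order.trans[OF _ abs_ge_self]\<close>)
  then show "Lpow lborel p u" by (simp add: Lpow_def)
  have "Pw u \<le> (\<integral>x. B powr p * indicator \<Omega> x \<partial>lborel)"
    unfolding Jpow_def by (rule integral_mono[OF j i le])
  then show "Pw u \<le> B powr p * measure lborel \<Omega>" by simp
qed

lemma test_measurable[measurable_dest]: "\<phi> \<in> test \<Longrightarrow> \<phi> \<in> borel_measurable borel"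
  by (rule test_functions_measurable)

lemma test_fin: "\<phi> \<in> test \<Longrightarrow> fin \<phi>"
proof -
  assume \<phi>: "\<phi> \<in> test"
  obtain B where B: "B > 0" "\<And>x. \<bar>\<phi> x\<bar> \<le> B" "\<And>x y. \<bar>\<phi> x - \<phi> y\<bar> \<le> B * norm (x - y)"
    by (rule test_functions_bounded_lipschitz[OF \<phi>]) (rule that)
  show "fin \<phi>"
    by (rule lipschitz_finite_energy[OF sets_\<Omega> emeasure_\<Omega> _ _ B(2,3) _ r1 r_upper])
      (use \<phi> p1 test_functions_outside in auto)
qed

text \<open>Purely qualitative: this is the a priori hypothesis of \<open>morrey\<close>, which
  replaces the constant by one determined by the energy.\<close>

definition hoelder :: "('a \<Rightarrow> real) \<Rightarrow> bool" where
  "hoelder f \<longleftrightarrow> (\<exists>L. \<forall>x y. \<bar>f x - f y\<bar> \<le> L * norm (x - y) powr \<gamma>)"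

lemma test_hoelder: "\<phi> \<in> test \<Longrightarrow> hoelder \<phi>"
proof -
  assume \<phi>: "\<phi> \<in> test"
  obtain B where B: "B > 0" "\<And>x. \<bar>\<phi> x\<bar> \<le> B" "\<And>x y. \<bar>\<phi> x - \<phi> y\<bar> \<le> B * norm (x - y)"
    by (rule test_functions_bounded_lipschitz[OF \<phi>]) (rule that)
  have "\<bar>\<phi> x - \<phi> y\<bar> \<le> 2 * B * norm (x - y) powr \<gamma>" for x y
  proof (cases "norm (x - y) \<le> 1")
    case True
    have "norm (x - y) \<le> norm (x - y) powr \<gamma>"
      using powr_mono'[OF \<gamma>(2) norm_ge_zero True] by simp
    then have "B * norm (x - y) \<le> 2 * B * norm (x - y) powr \<gamma>" using B(1) by (intro mult_mono) auto
    with B(3)[of x y] show ?thesis by linarith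
  next
    case False
    then have "1 \<le> norm (x - y) powr \<gamma>" using \<gamma>(1) by (intro ge_one_powr_ge_zero) auto
    then have "2 * B * 1 \<le> 2 * B * norm (x - y) powr \<gamma>" using B(1) by (intro mult_left_mono) auto
    with B(2)[of x] B(2)[of y] show ?thesis by linarith
  qed
  then show ?thesis unfolding hoelder_def by blast
qed

lemma hoelder_continuous:
  assumes "hoelder f" shows "continuous_on UNIV f"
proof -
  obtain L where L: "\<And>x y. \<bar>f x - f y\<bar> \<le> L * norm (x - y) powr \<gamma>" using assms unfolding hoelder_def by blast
  have "isCont f x" for x
  proof -
    have "((\<lambda>y. norm (y - x)) \<longlongrightarrow> norm (x - x)) (at x)" by (intro tendsto_intros)
    from tendsto_mult_left[OF tendsto_abs_powr[OF this \<gamma>(1)], of L]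
    have "((\<lambda>y. L * norm (y - x) powr \<gamma>) \<longlongrightarrow> 0) (at x)" by simp
    moreover have "\<forall>\<^sub>F y in at x. norm (f y - f x) \<le> L * norm (y - x) powr \<gamma>" using L by simp
    ultimately have "((\<lambda>y. f y - f x) \<longlongrightarrow> 0) (at x)"
      by (rule Lim_null_comparison[rotated])
    then show ?thesis by (simp add: isCont_def LIM_zero_iff)
  qed
  then show ?thesis by (simp add: continuous_at_imp_continuous_on)
qed

lemma hoelder_measurable: "hoelder f \<Longrightarrow> f \<in> borel_measurable borel"
  by (intro borel_measurable_continuous_onI hoelder_continuous)

text \<open>The sup bound compares \<open>x\<close> with a fixed point outside the bounded set
  \<Omega>, where \<open>f\<close> vanishes. Both bounds share one constant.\<close>

lemma hoelder_bound:
  "\<exists>K>0. (\<forall>f M x y. hoelder f \<longrightarrow> fin f \<longrightarrow> En f \<le> M \<longrightarrow> M > 0 \<longrightarrow> \<bar>f x - f y\<bar> \<le> K * M powr (1 / p) * norm (x - y) powr \<gamma>)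
    \<and> (\<forall>f M x. hoelder f \<longrightarrow> fin f \<longrightarrow> En f \<le> M \<longrightarrow> M > 0 \<longrightarrow> (\<forall>x. x \<notin> \<Omega> \<longrightarrow> f x = 0) \<longrightarrow> \<bar>f x\<bar> \<le> K * M powr (1 / p))"
proof -
  obtain K0 where K0: "K0 > 0" "\<And>(f :: 'a \<Rightarrow> real) L M x y. f \<in> borel_measurable borel \<Longrightarrow>
      (\<And>x y. \<bar>f x - f y\<bar> \<le> L * norm (x - y) powr \<gamma>) \<Longrightarrow> energy_on UNIV r p f \<le> ennreal M \<Longrightarrow> M > 0 \<Longrightarrow>
      \<bar>f x - f y\<bar> \<le> K0 * M powr (1 / p) * norm (x - y) powr \<gamma>"
  proof (rule morrey[OF p1(2) r_lower, folded \<gamma>_eq])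
    fix K :: real
    assume K: "K > 0" and *: "\<And>(f :: 'a \<Rightarrow> real) L M x y. f \<in> borel_measurable borel \<Longrightarrow>
      (\<And>x y. \<bar>f x - f y\<bar> \<le> L * norm (x - y) powr \<gamma>) \<Longrightarrow> energy_on UNIV r p f \<le> ennreal M \<Longrightarrow> M > 0 \<Longrightarrow>
      \<bar>f x - f y\<bar> \<le> K * M powr (1 / p) * norm (x - y) powr \<gamma>"
    show ?thesis by (rule that[OF K *])
  qed
  have "\<Omega> \<noteq> UNIV" using bounded_\<Omega> not_bounded_UNIV by metis
  then obtain y0 where y0: "y0 \<notin> \<Omega>" by blast
  obtain D where D: "D > 0" "\<And>x. x \<in> \<Omega> \<Longrightarrow> norm (x - y0) \<le> D"
  proof -
    obtain a where a: "\<And>x. x \<in> \<Omega> \<Longrightarrow> norm x \<le> a" using bounded_\<Omega> by (auto simp: bounded_iff)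
    have "norm (x - y0) \<le> max 1 (a + norm y0)" if "x \<in> \<Omega>" for x
      using a[OF that] norm_triangle_ineq4[of x y0] by linarith
    then show ?thesis by (intro that[of "max 1 (a + norm y0)"]) auto
  qed
  define K where "K = K0 * max 1 (D powr \<gamma>)"
  have K: "K0 \<le> K" "K0 * D powr \<gamma> \<le> K" "K > 0" using K0(1) by (auto simp: K_def)
  have main: "\<bar>f x - f y\<bar> \<le> K0 * M powr (1 / p) * norm (x - y) powr \<gamma>"
    if f: "hoelder f" "fin f" "En f \<le> M" "M > 0" for f M x y
  proof -
    obtain L where L: "\<And>x y. \<bar>f x - f y\<bar> \<le> L * norm (x - y) powr \<gamma>" using f(1) unfolding hoelder_def by blast
    have "energy_on UNIV r p f \<le> ennreal M"
      using Jpow_kern[OF hoelder_measurable[OF f(1)] f(2)] f(3) by (metis ennreal_leI)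
    from K0(2)[OF hoelder_measurable[OF f(1)] L this f(4)] show ?thesis .
  qed
  show ?thesis
  proof (intro exI[of _ K] conjI allI impI)
    show "K > 0" by (rule K)
    show "\<bar>f x - f y\<bar> \<le> K * M powr (1 / p) * norm (x - y) powr \<gamma>"
      if "hoelder f" "fin f" "En f \<le> M" "M > 0" for f M x y
      using main[OF that, of x y] K(1)
      by (elim order.trans) (intro mult_right_mono, auto)
    show "\<bar>f x\<bar> \<le> K * M powr (1 / p)"
      if f: "hoelder f" "fin f" "En f \<le> M" "M > 0" "\<forall>x. x \<notin> \<Omega> \<longrightarrow> f x = 0" for f M x
    proof (cases "x \<in> \<Omega>")
      case True
      have "\<bar>f x\<bar> \<le> K0 * M powr (1 / p) * norm (x - y0) powr \<gamma>"
        using main[OF f(1-4), of x y0] f(5) y0 by simp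
      also have "\<dots> \<le> K0 * M powr (1 / p) * D powr \<gamma>"
        using K0(1) D(2)[OF True] \<gamma>(1) by (intro mult_left_mono powr_mono2) auto
      also have "\<dots> = (K0 * D powr \<gamma>) * M powr (1 / p)" by simp
      also have "\<dots> \<le> K * M powr (1 / p)" using K(2) by (intro mult_right_mono) auto
      finally show ?thesis .
    next
      case False
      then show ?thesis using f(5) K(3) by simp
    qed
  qed
qed

text \<open>Elements of the energy space are represented by their continuous versions; uniform convergence
  is no restriction, by Morrey's inequality.\<close>

definition approx :: "(nat \<Rightarrow> 'a \<Rightarrow> real) \<Rightarrow> ('a \<Rightarrow> real) \<Rightarrow> bool" where
  "approx \<phi> g \<longleftrightarrow> (\<forall>k. \<phi> k \<in> test) \<and> (\<forall>k. fin (\<lambda>x. \<phi> k x - g x)) \<and>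
     (\<lambda>k. En (\<lambda>x. \<phi> k x - g x)) \<longlonglongrightarrow> 0 \<and> uniform_limit UNIV \<phi> g sequentially"

lemma approxD:
  assumes "approx \<phi> g"
  shows "\<And>k. \<phi> k \<in> test" and "\<And>k. fin (\<lambda>x. \<phi> k x - g x)" and "(\<lambda>k. En (\<lambda>x. \<phi> k x - g x)) \<longlonglongrightarrow> 0"
    and "uniform_limit UNIV \<phi> g sequentially" and "\<And>x. (\<lambda>k. \<phi> k x) \<longlonglongrightarrow> g x"
  using assms unfolding approx_def by (auto intro: tendsto_uniform_limitI)

lemma approx_outside:
  assumes "approx \<phi> g" and "x \<notin> \<Omega>"
  shows "g x = 0"
proof -
  have "(\<lambda>k. \<phi> k x) = (\<lambda>k. 0)" using approxD(1)[OF assms(1)] assms(2) test_functions_outside by blast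
  with approxD(5)[OF assms(1), of x] show ?thesis by (simp add: LIMSEQ_const_iff)
qed

lemma approx_fin:
  assumes "approx \<phi> g"
  shows "fin g"
proof -
  have "fin (\<lambda>x. \<phi> 0 x - (\<phi> 0 x - g x))"
    unfolding dif_simps(1)
    by (intro Lpow_diff(1) test_fin approxD(1)[OF assms] approxD(2)[OF assms, of 0, unfolded dif_simps] p1)
  then show ?thesis by simp
qed

text \<open>The energies of the approximants are eventually below \<open>En g + 1\<close>, so
  Morrey's inequality bounds their Hoelder constants uniformly and the bound passes to the
  limit.\<close>

lemma approx_hoelder:
  assumes "approx \<phi> g"
  shows "hoelder g"
proof -
  obtain K where K: "K > 0" "\<And>f M x y. hoelder f \<Longrightarrow> fin f \<Longrightarrow> En f \<le> M \<Longrightarrow> M > 0 \<Longrightarrow> \<bar>f x - f y\<bar> \<le> K * M powr (1 / p) * norm (x - y) powr \<gamma>"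
    using hoelder_bound by blast
  have "eventually (\<lambda>k. En (\<phi> k) < En g + 1) sequentially"
    by (rule Jpow_limsup[OF approx_fin[OF assms]])
      (use approxD[OF assms] p1 in \<open>auto simp: dif_simps\<close>)
  then have "eventually (\<lambda>k. \<bar>\<phi> k x - \<phi> k y\<bar> \<le> K * (En g + 1) powr (1 / p) * norm (x - y) powr \<gamma>) sequentially" for x y
  proof eventually_elim
    case (elim k)
    have "En g + 1 > 0" using Jpow_nonneg[of "kern r" p "dif g"] by linarith
    then show ?case
      using K(2)[OF test_hoelder[OF approxD(1)[OF assms]] test_fin[OF approxD(1)[OF assms]], of k "En g + 1" x y] elim by simp
  qed
  then have "\<bar>g x - g y\<bar> \<le> K * (En g + 1) powr (1 / p) * norm (x - y) powr \<gamma>" for x y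
    by (rule tendsto_upperbound[OF tendsto_rabs[OF tendsto_diff[OF approxD(5)[OF assms] approxD(5)[OF assms]]]]) auto
  then show ?thesis unfolding hoelder_def by blast
qed

lemmas approx_measurable = hoelder_measurable[OF approx_hoelder]
lemmas approx_continuous = hoelder_continuous[OF approx_hoelder]

lemma approx_bounded:
  assumes "approx \<phi> g"
  obtains B where "B > 0" and "\<And>k x. \<bar>\<phi> k x\<bar> \<le> B" and "\<And>x. \<bar>g x\<bar> \<le> B"
    and "\<And>k. En (\<phi> k) \<le> B"
proof -
  obtain K where K: "K > 0" "\<And>f M x. hoelder f \<Longrightarrow> fin f \<Longrightarrow> En f \<le> M \<Longrightarrow> M > 0 \<Longrightarrow> (\<And>x. x \<notin> \<Omega> \<Longrightarrow> f x = 0) \<Longrightarrow> \<bar>f x\<bar> \<le> K * M powr (1 / p)"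
    using hoelder_bound by blast
  note D = approxD[OF assms]
  obtain A where A: "A > 0" "\<And>k. En (\<lambda>x. \<phi> k x - g x) \<le> A"
    using Bseq_bdd_above'[OF convergent_imp_Bseq[OF convergentI[OF D(3)]]]
      convergent_imp_Bseq[OF convergentI[OF D(3)]]
    unfolding Bseq_def by (metis abs_le_D1 real_norm_def)
  define M where "M = max 1 (2 powr p * (A + En g))"
  have E: "En (\<phi> k) \<le> M" for k
  proof -
    have "En (\<lambda>x. (\<phi> k x - g x) + g x) \<le> 2 powr p * (En (\<lambda>x. \<phi> k x - g x) + En g)"
      unfolding dif_simps(2)[of _ g] by (rule Lpow_add(3)[OF D(2) approx_fin[OF assms] p1(2)])
    also have "\<dots> \<le> 2 powr p * (A + En g)" using A(2)[of k] by (intro mult_left_mono) auto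
    also have "\<dots> \<le> M" by (simp add: M_def)
    finally show ?thesis by simp
  qed
  have M: "M > 0" by (simp add: M_def)
  have b: "\<bar>\<phi> k x\<bar> \<le> K * M powr (1 / p)" for k x
    by (rule K(2)[OF test_hoelder[OF D(1)] test_fin[OF D(1)] E M test_functions_outside[OF D(1)]])
  then have b': "\<bar>g x\<bar> \<le> K * M powr (1 / p)" for x
    by (intro tendsto_upperbound[OF tendsto_rabs[OF D(5)]]) auto
  show ?thesis
  proof (rule that[of "max M (K * M powr (1 / p))"])
    show "max M (K * M powr (1 / p)) > 0" using M by simp
    show "\<bar>\<phi> k x\<bar> \<le> max M (K * M powr (1 / p))" for k x using b[of k x] by linarith
    show "\<bar>g x\<bar> \<le> max M (K * M powr (1 / p))" for x using b'[of x] by linarith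
    show "En (\<phi> k) \<le> max M (K * M powr (1 / p))" for k using E[of k] by linarith
  qed
qed

lemma approx_Lpow:
  assumes "approx \<phi> g"
  shows "Lpow lborel p g"
proof -
  obtain B where "B > 0" "\<And>k x. \<bar>\<phi> k x\<bar> \<le> B" and B: "\<And>x. \<bar>g x\<bar> \<le> B" and "\<And>k. En (\<phi> k) \<le> B"
    by (rule approx_bounded[OF assms]) (rule that)
  show ?thesis
    by (rule bounded_Lpow(1)[OF approx_measurable[OF assms] approx_outside[OF assms] B])
qed

lemma test_Lpow:
  assumes "\<phi> \<in> test"
  shows "Lpow lborel p \<phi>"
proof -
  obtain B where "B > 0" and B: "\<And>x. \<bar>\<phi> x\<bar> \<le> B" and "\<And>x y. \<bar>\<phi> x - \<phi> y\<bar> \<le> B * norm (x - y)"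
    by (rule test_functions_bounded_lipschitz[OF assms]) (rule that)
  show ?thesis
    by (rule bounded_Lpow(1)[OF test_measurable[OF assms] test_functions_outside[OF assms] B])
qed

text \<open>Completeness of the energy space: the sup bound makes an energy-Cauchy sequence
  uniformly Cauchy, and Fatou's lemma in the second index shows that it converges to the uniform
  limit in energy as well.\<close>

lemma Cauchy_approx:
  assumes \<phi>: "\<And>k. \<phi> k \<in> test"
    and C: "\<And>e. e > 0 \<Longrightarrow> \<exists>n. \<forall>k\<ge>n. \<forall>l\<ge>n. En (\<lambda>x. \<phi> k x - \<phi> l x) \<le> e"
  shows "\<exists>g. approx \<phi> g"
proof -
  obtain K where K: "K > 0" "\<And>f M x. hoelder f \<Longrightarrow> fin f \<Longrightarrow> En f \<le> M \<Longrightarrow> M > 0 \<Longrightarrow> (\<And>x. x \<notin> \<Omega> \<Longrightarrow> f x = 0) \<Longrightarrow> \<bar>f x\<bar> \<le> K * M powr (1 / p)"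
    using hoelder_bound by blast
  note d = test_functions_diff[OF \<phi> \<phi>]
  have "uniformly_Cauchy_on UNIV \<phi>"
  proof (rule uniformly_Cauchy_onI')
    fix e :: real assume e: "e > 0"
    define M where "M = (e / (2 * K)) powr p"
    have M: "M > 0" using e K(1) by (simp add: M_def)
    obtain n where n: "\<And>k l. k \<ge> n \<Longrightarrow> l \<ge> n \<Longrightarrow> En (\<lambda>x. \<phi> k x - \<phi> l x) \<le> M" using C[OF M] by blast
    have "M powr (1 / p) = e / (2 * K)" using e K(1) p1 by (simp add: M_def powr_powr)
    then have *: "K * M powr (1 / p) < e" using e K(1) by simp
    show "\<exists>n. \<forall>x\<in>UNIV. \<forall>m\<ge>n. \<forall>l>m. dist (\<phi> m x) (\<phi> l x) < e"
    proof (intro exI ballI allI impI)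
      fix x m l assume "n \<le> m" "m < l"
      then have "\<bar>\<phi> m x - \<phi> l x\<bar> \<le> K * M powr (1 / p)"
        using K(2)[OF test_hoelder[OF d] test_fin[OF d] n M test_functions_outside[OF d], of m l x] by simp
      with * show "dist (\<phi> m x) (\<phi> l x) < e" by (simp add: dist_real_def)
    qed
  qed
  then obtain g where g: "uniform_limit UNIV \<phi> g sequentially"
    using Cauchy_uniformly_convergent uniformly_convergent_on_def by blast
  have pt: "(\<lambda>k. \<phi> k x) \<longlonglongrightarrow> g x" for x using tendsto_uniform_limitI[OF g] by simp
  have [measurable]: "g \<in> borel_measurable borel" by (rule borel_measurable_LIMSEQ_real[OF pt]) (use \<phi> in auto)
  have F: "fin (\<lambda>x. \<phi> k x - g x) \<and> En (\<lambda>x. \<phi> k x - g x) \<le> e"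
    if n: "\<And>l. l \<ge> n \<Longrightarrow> En (\<lambda>x. \<phi> k x - \<phi> l x) \<le> e" for n k e
  proof -
    have [measurable]: "\<phi> k \<in> borel_measurable borel" using \<phi> by auto
    have 1: "fin (\<lambda>x. \<phi> k x - \<phi> (l + n) x)" for l by (rule test_fin[OF d])
    have 2: "En (\<lambda>x. \<phi> k x - \<phi> (l + n) x) \<le> e" for l by (rule n) simp
    have 3: "AE z in kern r. (\<lambda>l. dif (\<lambda>x. \<phi> k x - \<phi> (l + n) x) z) \<longlonglongrightarrow> dif (\<lambda>x. \<phi> k x - g x) z"
      unfolding dif_def by (intro AE_I2 tendsto_intros LIMSEQ_ignore_initial_segment pt)
    show ?thesis
      using Lpow_Fatou[OF 1 2 tendsto_const 3 _ p1(3)] by simp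
  qed
  obtain n1 where n1: "\<And>l. l \<ge> n1 \<Longrightarrow> En (\<lambda>x. \<phi> n1 x - \<phi> l x) \<le> 1" using C[of 1] by auto
  have fin: "fin (\<lambda>x. \<phi> k x - g x)" for k
  proof -
    have "fin (\<lambda>x. (\<phi> k x - \<phi> n1 x) + (\<phi> n1 x - g x))"
      unfolding dif_simps(2)[of _ "\<lambda>x. \<phi> n1 x - g x"]
      by (rule Lpow_add(1)[OF test_fin[OF d] _ p1(2)]) (use F[OF n1] in simp)
    then show ?thesis by simp
  qed
  have "(\<lambda>k. En (\<lambda>x. \<phi> k x - g x)) \<longlonglongrightarrow> 0"
  proof (rule LIMSEQ_I)
    fix e :: real assume e: "e > 0"
    obtain n where n: "\<And>k l. k \<ge> n \<Longrightarrow> l \<ge> n \<Longrightarrow> En (\<lambda>x. \<phi> k x - \<phi> l x) \<le> e / 2" using C[of "e / 2"] e by auto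
    have "En (\<lambda>x. \<phi> k x - g x) \<le> e / 2" if "k \<ge> n" for k using F[OF n[OF that]] by simp
    then have "norm (En (\<lambda>x. \<phi> k x - g x) - 0) < e" if "k \<ge> n" for k
      using that e Jpow_nonneg[of "kern r" p "dif (\<lambda>x. \<phi> k x - g x)"] by fastforce
    then show "\<exists>no. \<forall>k\<ge>no. norm (En (\<lambda>x. \<phi> k x - g x) - 0) < e" by blast
  qed
  with \<phi> fin g show ?thesis unfolding approx_def by blast
qed


subsection \<open>Eigenfunctions\<close>

lemma Pw_tendsto:
  assumes [measurable]: "\<And>k. f k \<in> borel_measurable borel" "g \<in> borel_measurable borel"
    and out: "\<And>k x. x \<notin> \<Omega> \<Longrightarrow> f k x = 0" and B: "\<And>k x. \<bar>f k x\<bar> \<le> B"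
    and lim: "\<And>x. (\<lambda>k. f k x) \<longlonglongrightarrow> g x"
  shows "(\<lambda>k. Pw (f k)) \<longlonglongrightarrow> Pw g"
  unfolding Jpow_def
proof (rule integral_dominated_convergence)
  show "integrable lborel (\<lambda>x. B powr p * indicator \<Omega> x)"
    using emeasure_\<Omega> by (intro integrable_mult_right integrable_real_indicator) auto
  show "AE x in lborel. (\<lambda>k. \<bar>f k x\<bar> powr p) \<longlonglongrightarrow> \<bar>g x\<bar> powr p"
    by (intro AE_I2 tendsto_abs_powr lim p1)
  have "\<bar>f k x\<bar> powr p \<le> B powr p * indicator \<Omega> x" for k x
    using out[of x k] B[of k x] p1 by (cases "x \<in> \<Omega>") (auto intro: powr_mono2)
  then show "AE x in lborel. norm (\<bar>f k x\<bar> powr p) \<le> B powr p * indicator \<Omega> x" for k by simp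
qed auto

text \<open>The function \<open>w\<close> is left arbitrary, because the equation is later tested
  with functions that are not smooth.\<close>

definition weak_eq :: "('a \<Rightarrow> real) \<Rightarrow> real \<Rightarrow> ('a \<Rightarrow> real) \<Rightarrow> bool" where
  "weak_eq g lam w \<longleftrightarrow> (\<integral>z. signed_powr p (dif g z) * dif w z \<partial>kern r)
     = lam * (\<integral>x. signed_powr p (g x) * w x \<partial>lborel)"

definition eigen :: "('a \<Rightarrow> real) \<Rightarrow> real \<Rightarrow> bool" where
  "eigen g lam \<longleftrightarrow> (\<exists>\<phi>. approx \<phi> g) \<and> (\<exists>x. g x \<noteq> 0) \<and> (\<forall>\<phi>\<in>test. weak_eq g lam \<phi>)"

lemma weak_eq_limit:
  assumes g: "approx \<phi> g" and eq: "\<And>k. weak_eq g lam (w k)" and w: "\<And>k. w k \<in> test"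
    and M: "\<And>k. En (w k) \<le> M" and lim: "\<And>x. (\<lambda>k. w k x) \<longlonglongrightarrow> v x"
  shows "weak_eq g lam v" and "fin v" and "En v \<le> M" and "v \<in> borel_measurable borel"
proof -
  obtain K where K: "K > 0" "\<And>f M x. hoelder f \<Longrightarrow> fin f \<Longrightarrow> En f \<le> M \<Longrightarrow> M > 0 \<Longrightarrow> (\<And>x. x \<notin> \<Omega> \<Longrightarrow> f x = 0) \<Longrightarrow> \<bar>f x\<bar> \<le> K * M powr (1 / p)"
    using hoelder_bound by blast
  define M' where "M' = max 1 M"
  have M': "M' > 0" "\<And>k. En (w k) \<le> M'" using M by (auto simp: M'_def le_max_iff_disj)
  let ?B = "K * M' powr (1 / p)"
  have B: "\<bar>w k x\<bar> \<le> ?B" for k x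
    by (rule K(2)[OF test_hoelder[OF w] test_fin[OF w] M'(2,1) test_functions_outside[OF w]])
  have [measurable]: "\<And>k. w k \<in> borel_measurable borel" using w by auto
  show vm[measurable]: "v \<in> borel_measurable borel" by (rule borel_measurable_LIMSEQ_real[OF lim]) simp
  have l1: "AE z in kern r. (\<lambda>k. dif (w k) z) \<longlonglongrightarrow> dif v z"
    unfolding dif_def by (intro AE_I2 tendsto_intros lim)
  have dm: "dif v \<in> borel_measurable (kern r)" by measurable
  note W1 = Lpow_weak_limit[OF approx_fin[OF g] test_fin[OF w] M l1 dm p1(1)]
  show "fin v" by (rule W1(1))
  show "En v \<le> M" by (rule Lpow_Fatou(2)[OF test_fin[OF w] M tendsto_const l1 dm p1(3)])
  have "v \<in> borel_measurable lborel" by simp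
  note W2 = Lpow_weak_limit(2)[OF approx_Lpow[OF g] test_Lpow[OF w] bounded_Lpow(2)[OF _ test_functions_outside[OF w] B] AE_I2[OF lim] this p1(1)]
  have "(\<lambda>k. lam * (\<integral>x. signed_powr p (g x) * w k x \<partial>lborel)) \<longlonglongrightarrow> lam * (\<integral>x. signed_powr p (g x) * v x \<partial>lborel)"
    by (intro tendsto_mult tendsto_const W2) auto
  with W1(2) show "weak_eq g lam v"
    using eq unfolding weak_eq_def by (simp add: LIMSEQ_unique)
qed

section \<open>Agreement of the Sobolev closure with the energy closure\<close>

lemma kern_on_le:
  assumes [measurable]: "v \<in> borel_measurable borel" and "fin v"
  shows "Lpow (kern_on (\<Omega> \<times> \<Omega>) r) p (dif v)" and "Jpow (kern_on (\<Omega> \<times> \<Omega>) r) p (dif v) \<le> En v"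
proof -
  have le: "energy_on (\<Omega> \<times> \<Omega>) r p v \<le> energy_on UNIV r p v" by (rule energy_on_mono) simp
  show L: "Lpow (kern_on (\<Omega> \<times> \<Omega>) r) p (dif v)"
    using assms(2) le unfolding Lpow_kern_on_iff[OF assms(1) sets_\<Omega>\<Omega>] Lpow_kern_iff[OF assms(1)] by (rule le_less_trans[rotated])
  have "ennreal (Jpow (kern_on (\<Omega> \<times> \<Omega>) r) p (dif v)) \<le> ennreal (En v)"
    using le Jpow_kern[OF assms] Jpow_kern_on[OF assms(1) sets_\<Omega>\<Omega> L] by simp
  then show "Jpow (kern_on (\<Omega> \<times> \<Omega>) r) p (dif v) \<le> En v"
    by (simp add: ennreal_le_iff Jpow_nonneg)
qed

lemma test_energy_le:
  obtains C where "C > 0" and "\<And>\<phi>. \<phi> \<in> test \<Longrightarrow> En \<phi> \<le> C * Jpow (kern_on (\<Omega> \<times> \<Omega>) r) p (dif \<phi>)"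
proof -
  obtain C where C: "C > 0" "\<And>\<phi>. \<phi> \<in> test \<Longrightarrow> energy_on UNIV r p \<phi> \<le> ennreal C * energy_on (\<Omega> \<times> \<Omega>) r p \<phi>"
    by (rule energy_global_le[OF open_\<Omega> bounded_\<Omega> p1(2) r_lower]) (rule that)
  show ?thesis
  proof (rule that[OF C(1)])
    fix \<phi> assume \<phi>: "\<phi> \<in> test"
    have "ennreal (En \<phi>) \<le> ennreal (C * Jpow (kern_on (\<Omega> \<times> \<Omega>) r) p (dif \<phi>))"
      using C(2)[OF \<phi>] C(1) Jpow_kern[OF test_measurable[OF \<phi>] test_fin[OF \<phi>]]
        Jpow_kern_on[OF test_measurable[OF \<phi>] sets_\<Omega>\<Omega> kern_on_le(1)[OF test_measurable[OF \<phi>] test_fin[OF \<phi>]]]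
      by (simp add: ennreal_mult Jpow_nonneg)
    then show "En \<phi> \<le> C * Jpow (kern_on (\<Omega> \<times> \<Omega>) r) p (dif \<phi>)"
      using C(1) by (subst (asm) ennreal_le_iff) (simp_all add: Jpow_nonneg)
  qed
qed

lemma set_integral_Pw:
  assumes "\<And>x. x \<notin> \<Omega> \<Longrightarrow> v x = 0"
  shows "set_integrable lborel \<Omega> (\<lambda>x. \<bar>v x\<bar> powr p) \<longleftrightarrow> integrable lborel (\<lambda>x. \<bar>v x\<bar> powr p)"
    and "set_lebesgue_integral lborel \<Omega> (\<lambda>x. \<bar>v x\<bar> powr p) = Pw v"
proof -
  have "(\<lambda>x. indicator \<Omega> x *\<^sub>R \<bar>v x\<bar> powr p) = (\<lambda>x. \<bar>v x\<bar> powr p)"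
  proof
    fix x
    show "indicator \<Omega> x *\<^sub>R \<bar>v x\<bar> powr p = \<bar>v x\<bar> powr p"
      using assms p1 by (cases "x \<in> \<Omega>") auto
  qed
  then show "set_integrable lborel \<Omega> (\<lambda>x. \<bar>v x\<bar> powr p) \<longleftrightarrow> integrable lborel (\<lambda>x. \<bar>v x\<bar> powr p)"
    "set_lebesgue_integral lborel \<Omega> (\<lambda>x. \<bar>v x\<bar> powr p) = Pw v"
    by (simp_all add: set_integrable_def set_lebesgue_integral_def Jpow_def)
qed

lemma frac_sobolev_norm_eq:
  assumes "real DIM('a) + s * p = r" and "v \<in> borel_measurable borel" and "\<And>x. x \<notin> \<Omega> \<Longrightarrow> v x = 0"
  shows "frac_sobolev_norm \<Omega> s p v = (Jpow (kern_on (\<Omega> \<times> \<Omega>) r) p (dif v) + Pw v) powr (1 / p)"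
  unfolding frac_sobolev_norm_def assms(1)
  by (simp add: set_integrable_diff_quotient(2)[OF assms(2) sets_\<Omega>\<Omega>] set_integral_Pw(2)[OF assms(3)])

lemma approx_in_frac_sobolev_0:
  assumes s: "real DIM('a) + s * p = r" and g: "approx \<phi> g"
  shows "g \<in> frac_sobolev_0 \<Omega> s p"
proof -
  note m = approx_measurable[OF g] and out = approx_outside[OF g] and D = approxD[OF g]
  obtain B where B: "B > 0" "\<And>k x. \<bar>\<phi> k x\<bar> \<le> B" "\<And>x. \<bar>g x\<bar> \<le> B" "\<And>k. En (\<phi> k) \<le> B"
    by (rule approx_bounded[OF g]) (rule that)
  have mem: "g \<in> frac_sobolev \<Omega> s p"
    unfolding frac_sobolev_def s
    using m set_integrable_diff_quotient(1)[OF m sets_\<Omega>\<Omega>, of r p] kern_on_le(1)[OF m approx_fin[OF g]]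
      set_integral_Pw(1)[OF out] LpowD(2)[OF approx_Lpow[OF g]] by simp
  let ?d = "\<lambda>k x. g x - \<phi> k x"
  have dm: "?d k \<in> borel_measurable borel" for k
    using m test_measurable[OF D(1)] by (intro borel_measurable_diff)
  have eq: "dif (?d k) = (\<lambda>z. (-1) * dif (\<lambda>x. \<phi> k x - g x) z)" for k by (auto simp: dif_def)
  have fd: "fin (?d k)" "En (?d k) = En (\<lambda>x. \<phi> k x - g x)" for k
    unfolding eq using Lpow_scale[OF D(2), of "-1"] by auto
  have "(\<lambda>k. Pw (?d k)) \<longlonglongrightarrow> Pw (\<lambda>x::'a. 0)"
  proof (rule Pw_tendsto[where f="?d" and g="\<lambda>x. 0" and B="2 * B"])
    show "?d k \<in> borel_measurable borel" for k by (rule dm)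
    show "\<bar>g x - \<phi> k x\<bar> \<le> 2 * B" for k x using B(2)[of k x] B(3)[of x] by linarith
    show "(\<lambda>k. g x - \<phi> k x) \<longlonglongrightarrow> 0" for x
      using tendsto_diff[OF tendsto_const D(5), of "g x" x] by simp
  qed (use out test_functions_outside[OF D(1)] in auto)
  then have P0: "(\<lambda>k. Pw (?d k)) \<longlonglongrightarrow> 0" by (simp add: Jpow_def)
  have "(\<lambda>k. Jpow (kern_on (\<Omega> \<times> \<Omega>) r) p (dif (?d k))) \<longlonglongrightarrow> 0"
    by (rule tendsto_sandwich[OF _ _ tendsto_const D(3)])
      (use kern_on_le(2)[OF dm fd(1)] fd(2) in \<open>auto simp: Jpow_nonneg\<close>)
  from tendsto_add[OF this P0]
  have "(\<lambda>k. \<bar>Jpow (kern_on (\<Omega> \<times> \<Omega>) r) p (dif (?d k)) + Pw (?d k)\<bar> powr (1 / p)) \<longlonglongrightarrow> \<bar>0 + 0\<bar> powr (1 / p)"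
    by (rule tendsto_abs_powr) (use p1 in simp)
  then have "(\<lambda>k. frac_sobolev_norm \<Omega> s p (?d k)) \<longlonglongrightarrow> 0"
    using p1 out test_functions_outside[OF D(1)]
    by (simp add: frac_sobolev_norm_eq[OF s dm] Jpow_nonneg)
  with mem out D(1) show ?thesis unfolding frac_sobolev_0_def by blast
qed

text \<open>Convergence in the Sobolev norm controls energies over \<Omega> \<times> \<Omega> only.
  Applied to differences of the approximating test functions, the comparison from Hardy's inequality
  makes the sequence Cauchy in the energy over the whole space. The two limits agree almost
  everywhere, by Fatou's lemma for the p-th powers of \<open>u - \<phi> k\<close>.\<close>

lemma frac_sobolev_0_approx:
  assumes s: "real DIM('a) + s * p = r" and u: "u \<in> frac_sobolev_0 \<Omega> s p"
  shows "\<exists>\<phi> g. approx \<phi> g \<and> (AE x in lborel. u x = g x)"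
proof -
  obtain \<phi> where \<phi>: "\<And>k. \<phi> k \<in> test" "(\<lambda>k. frac_sobolev_norm \<Omega> s p (\<lambda>x. u x - \<phi> k x)) \<longlonglongrightarrow> 0"
    and um[measurable]: "u \<in> borel_measurable borel" and out: "\<And>x. x \<notin> \<Omega> \<Longrightarrow> u x = 0"
    and u1: "set_integrable (lborel \<Otimes>\<^sub>M lborel) (\<Omega> \<times> \<Omega>) (diff_quotient r p u)"
    and u2: "set_integrable lborel \<Omega> (\<lambda>x. \<bar>u x\<bar> powr p)"
    using u unfolding frac_sobolev_0_def frac_sobolev_def s by blast
  let ?N = "kern_on (\<Omega> \<times> \<Omega>) r"
  let ?d = "\<lambda>k x. u x - \<phi> k x"
  have [measurable]: "\<And>k. \<phi> k \<in> borel_measurable borel" using \<phi>(1) by auto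
  have dm: "?d k \<in> borel_measurable borel" for k by measurable
  have Lu: "Lpow ?N p (dif u)" using set_integrable_diff_quotient(1)[OF um sets_\<Omega>\<Omega>] u1 by simp
  have L\<phi>: "Lpow ?N p (dif (\<phi> k))" for k by (rule kern_on_le(1)) (auto intro: test_fin \<phi>)
  have Ld: "Lpow ?N p (dif (?d k))" for k unfolding dif_simps by (rule Lpow_diff(1)[OF Lu L\<phi> p1(2)])
  have Pu: "Lpow lborel p u" using u2 set_integral_Pw(1)[OF out] by (simp add: Lpow_def)
  have Pd: "Lpow lborel p (?d k)" for k by (rule Lpow_diff(1)[OF Pu test_Lpow[OF \<phi>(1)] p1(2)])
  have nn: "0 \<le> Jpow ?N p (dif (?d k)) + Pw (?d k)" for k by (simp add: Jpow_nonneg)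
  have "(\<lambda>k. \<bar>frac_sobolev_norm \<Omega> s p (?d k)\<bar> powr p) \<longlonglongrightarrow> \<bar>0\<bar> powr p"
    by (rule tendsto_abs_powr[OF \<phi>(2) p1(3)])
  moreover have "\<bar>frac_sobolev_norm \<Omega> s p (?d k)\<bar> powr p = Jpow ?N p (dif (?d k)) + Pw (?d k)" for k
    using frac_sobolev_norm_eq[OF s dm, of k] out test_functions_outside[OF \<phi>(1)] nn p1
    by (simp add: powr_powr)
  ultimately have lim: "(\<lambda>k. Jpow ?N p (dif (?d k)) + Pw (?d k)) \<longlonglongrightarrow> 0" by simp
  have lim1: "(\<lambda>k. Jpow ?N p (dif (?d k))) \<longlonglongrightarrow> 0"
    by (rule tendsto_sandwich[OF _ _ tendsto_const lim]) (auto simp: Jpow_nonneg)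
  have lim2: "(\<lambda>k. Pw (?d k)) \<longlonglongrightarrow> 0"
    by (rule tendsto_sandwich[OF _ _ tendsto_const lim]) (auto simp: Jpow_nonneg)
  obtain C where C: "C > 0" "\<And>\<phi>. \<phi> \<in> test \<Longrightarrow> En \<phi> \<le> C * Jpow ?N p (dif \<phi>)"
    by (rule test_energy_le) (rule that)
  have "\<exists>g. approx \<phi> g"
  proof (rule Cauchy_approx[OF \<phi>(1)])
    fix e :: real assume e: "e > 0"
    define e' where "e' = e / (C * 2 powr p * 2)"
    have e': "e' > 0" using e C(1) by (simp add: e'_def)
    have "eventually (\<lambda>k. Jpow ?N p (dif (?d k)) < e') sequentially"
      by (rule order_tendstoD(2)[OF lim1 e'])
    then obtain n where n: "\<And>k. k \<ge> n \<Longrightarrow> Jpow ?N p (dif (?d k)) < e'" by (auto simp: eventually_sequentially)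
    have "En (\<lambda>x. \<phi> k x - \<phi> l x) \<le> e" if "k \<ge> n" "l \<ge> n" for k l
    proof -
      have "dif (\<lambda>x. \<phi> k x - \<phi> l x) = (\<lambda>z. dif (?d l) z - dif (?d k) z)" by (auto simp: dif_def)
      then have "Jpow ?N p (dif (\<lambda>x. \<phi> k x - \<phi> l x)) = Jpow ?N p (\<lambda>z. dif (?d l) z - dif (?d k) z)" by simp
      also have "\<dots> \<le> 2 powr p * (Jpow ?N p (dif (?d l)) + Jpow ?N p (dif (?d k)))"
        by (rule Lpow_diff(2)[OF Ld Ld p1(2)])
      also have "\<dots> \<le> 2 powr p * (e' + e')"
        using n[OF that(1)] n[OF that(2)] by (intro mult_left_mono add_mono) auto
      finally have "C * Jpow ?N p (dif (\<lambda>x. \<phi> k x - \<phi> l x)) \<le> C * (2 powr p * (e' + e'))"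
        using C(1) by (intro mult_left_mono) auto
      also have "\<dots> = e" using C(1) by (simp add: e'_def)
      finally show ?thesis using C(2)[OF test_functions_diff[OF \<phi>(1)[of k] \<phi>(1)[of l]]] by linarith
    qed
    then show "\<exists>n. \<forall>k\<ge>n. \<forall>l\<ge>n. En (\<lambda>x. \<phi> k x - \<phi> l x) \<le> e" by blast
  qed
  then obtain g where g: "approx \<phi> g" by blast
  have [measurable]: "g \<in> borel_measurable borel" by (rule approx_measurable[OF g])
  have l: "AE x in lborel. (\<lambda>k. ?d k x) \<longlonglongrightarrow> u x - g x"
    by (intro AE_I2 tendsto_intros approxD(5)[OF g])
  have "(\<lambda>x. u x - g x) \<in> borel_measurable lborel" by measurable
  note F = Lpow_Fatou[OF Pd order_refl lim2 l this p1(3)]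
  have "(\<integral>x. \<bar>u x - g x\<bar> powr p \<partial>lborel) = 0"
    using F(2) Jpow_nonneg[of lborel p "\<lambda>x. u x - g x"] unfolding Jpow_def by (rule antisym)
  then have "AE x in lborel. \<bar>u x - g x\<bar> powr p = 0"
    by (subst (asm) integral_nonneg_eq_0_iff_AE) (use LpowD(2)[OF F(1)] in auto)
  then have "AE x in lborel. u x = g x" by eventually_elim simp
  with g show ?thesis by blast
qed

lemma pairing_integral:
  assumes [measurable]: "u \<in> borel_measurable borel" "w \<in> borel_measurable borel"
  shows "(\<integral>(x, y). signed_powr p (u y - u x) * (w y - w x) / norm (y - x) powr r \<partial>(lborel \<Otimes>\<^sub>M lborel))
    = (\<integral>z. signed_powr p (dif u z) * dif w z \<partial>kern r)"
proof -
  have "(\<integral>z. signed_powr p (dif u z) * dif w z \<partial>kern r) = (\<integral>z. wt r z *\<^sub>R (signed_powr p (dif u z) * dif w z) \<partial>lborel)"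
    unfolding kern_def by (rule integral_density) auto
  also have "(\<lambda>z. wt r z *\<^sub>R (signed_powr p (dif u z) * dif w z))
      = (\<lambda>(x, y). signed_powr p (u y - u x) * (w y - w x) / norm (y - x) powr r)"
    by (auto simp: wt_def dif_def)
  finally show ?thesis by (simp add: lborel_prod)
qed

lemma open_AE_nonempty:
  assumes "open S" and "AE x in lborel. x \<notin> S"
  shows "S = ({} :: 'b::euclidean_space set)"
proof (rule ccontr)
  assume "S \<noteq> {}"
  then have "\<not> negligible S" using assms(1) open_not_negligible by blast
  moreover have "S \<in> null_sets lborel"
    using assms by (subst AE_iff_null_sets) auto
  then have "negligible S" by (metis negligible_iff_null_sets null_sets_completionI)
  ultimately show False by simp
qed

text \<open>Both integrals ignore null sets, so \<open>u\<close> may be exchanged for its continuous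
  version. For the latter, being nonzero somewhere is the same as not vanishing almost
  everywhere.\<close>

lemma eigenvalues_iff:
  assumes r: "r = \<alpha> * p"
  shows "lam \<in> eigenvalues \<Omega> \<alpha> p \<longleftrightarrow> (\<exists>g. eigen g lam)"
proof
  have s: "real DIM('a) + (\<alpha> - real DIM('a) / p) * p = r" using r p1 by (simp add: algebra_simps)
  {
    assume "lam \<in> eigenvalues \<Omega> \<alpha> p"
    then obtain u where u: "u \<in> frac_sobolev_0 \<Omega> (\<alpha> - real DIM('a) / p) p" "\<not> (AE x in lborel. u x = 0)"
      and eq: "\<And>w. w \<in> test \<Longrightarrow> (\<integral>(x, y). signed_powr p (u y - u x) * (w y - w x) / norm (y - x) powr r \<partial>(lborel \<Otimes>\<^sub>M lborel))
        = lam * (\<integral>x. signed_powr p (u x) * w x \<partial>lborel)"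
      unfolding eigenvalues_def is_eigenfunction_def r by blast
    have [measurable]: "u \<in> borel_measurable borel" using u(1) by (simp add: frac_sobolev_0_def frac_sobolev_def)
    obtain \<phi> g where g: "approx \<phi> g" "AE x in lborel. u x = g x" using frac_sobolev_0_approx[OF s u(1)] by blast
    have [measurable]: "g \<in> borel_measurable borel" by (rule approx_measurable[OF g(1)])
    have "\<exists>x. g x \<noteq> 0"
    proof (rule ccontr)
      assume "\<not> ?thesis"
      then have "AE x in lborel. u x = 0" using g(2) by simp
      with u(2) show False by simp
    qed
    moreover have "weak_eq g lam w" if w: "w \<in> test" for w
    proof -
      have [measurable]: "w \<in> borel_measurable borel" using w by auto
      have "(\<integral>z. signed_powr p (dif g z) * dif w z \<partial>kern r) = (\<integral>z. signed_powr p (dif u z) * dif w z \<partial>kern r)"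
      proof (rule integral_cong_AE)
        have "AE z in lborel. dif g z = dif u z"
          using AE_pair_lborel[OF g(2)] by eventually_elim (simp add: dif_def)
        then show "AE z in kern r. signed_powr p (dif g z) * dif w z = signed_powr p (dif u z) * dif w z"
          unfolding kern_def by (subst AE_density) auto
      qed measurable
      also have "\<dots> = lam * (\<integral>x. signed_powr p (u x) * w x \<partial>lborel)"
        using eq[OF w] pairing_integral[of u w] by simp
      also have "(\<integral>x. signed_powr p (u x) * w x \<partial>lborel) = (\<integral>x. signed_powr p (g x) * w x \<partial>lborel)"
        by (rule integral_cong_AE) (use g(2) in auto)
      finally show ?thesis unfolding weak_eq_def .
    qed
    ultimately show "\<exists>g. eigen g lam" using g(1) unfolding eigen_def by blast
  next
    assume "\<exists>g. eigen g lam"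
    then obtain g \<phi> where g: "approx \<phi> g" "\<exists>x. g x \<noteq> 0" "\<And>w. w \<in> test \<Longrightarrow> weak_eq g lam w"
      unfolding eigen_def by blast
    note m = approx_measurable[OF g(1)]
    have "\<not> (AE x in lborel. g x = 0)"
    proof
      assume "AE x in lborel. g x = 0"
      moreover have "open {x. g x \<noteq> 0}"
        by (intro open_Collect_neq approx_continuous[OF g(1)] continuous_on_const)
      ultimately have "{x. g x \<noteq> 0} = {}" by (intro open_AE_nonempty) auto
      with g(2) show False by blast
    qed
    moreover have "(\<integral>(x, y). signed_powr p (g y - g x) * (w y - w x) / norm (y - x) powr (\<alpha> * p) \<partial>(lborel \<Otimes>\<^sub>M lborel))
        = lam * (\<integral>x. signed_powr p (g x) * w x \<partial>lborel)" if w: "w \<in> test" for w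
      using g(3)[OF w, unfolded weak_eq_def] pairing_integral[OF m test_measurable[OF w]]
      unfolding r[symmetric] by simp
    ultimately have "is_eigenfunction \<Omega> \<alpha> p g lam"
      unfolding is_eigenfunction_def using approx_in_frac_sobolev_0[OF s g(1)] by blast
    then show "lam \<in> eigenvalues \<Omega> \<alpha> p" unfolding eigenvalues_def by blast
  }
qed


subsection \<open>Minimising sequences\<close>

lemma Pw_pos:
  assumes c: "continuous_on UNIV g" and L: "Lpow lborel p g" and x: "g x \<noteq> 0"
  shows "Pw g > 0"
proof -
  have "Pw g \<noteq> 0"
  proof
    assume "Pw g = 0"
    then have "AE x in lborel. \<bar>g x\<bar> powr p = 0"
      unfolding Jpow_def by (subst (asm) integral_nonneg_eq_0_iff_AE) (use LpowD(2)[OF L] in auto)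
    then have "AE x in lborel. x \<notin> {x. g x \<noteq> 0}" by eventually_elim simp
    moreover have "open {x. g x \<noteq> 0}" by (intro open_Collect_neq c continuous_on_const)
    ultimately have "{x. g x \<noteq> 0} = {}" by (intro open_AE_nonempty) auto
    with x show False by blast
  qed
  with Jpow_nonneg[of lborel p g] show ?thesis by simp
qed

lemma test_continuous: "\<phi> \<in> test \<Longrightarrow> continuous_on UNIV \<phi>"
  by (intro smooth_continuous_on test_functions_smooth)

definition lam1 :: real where
  "lam1 = Inf ((\<lambda>\<phi>. En \<phi> / Pw \<phi>) ` {\<phi> \<in> test. \<exists>x. \<phi> x \<noteq> 0})"

lemma quotients_nonempty: "(\<lambda>\<phi>. En \<phi> / Pw \<phi>) ` {\<phi> \<in> test. \<exists>x. \<phi> x \<noteq> 0} \<noteq> {}"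
proof -
  obtain c where c: "c \<in> \<Omega>" using nonempty_\<Omega> by blast
  obtain \<phi> e where "\<phi> \<in> test" "e > 0" "\<And>x. \<phi> x \<ge> 0" "{x. \<phi> x > 0} = ball c e"
    by (rule bump_exists[OF open_\<Omega> c]) (rule that)
  then have "\<phi> c > 0" by (metis centre_in_ball mem_Collect_eq)
  with \<open>\<phi> \<in> test\<close> show ?thesis by fastforce
qed

lemma quotients_bdd_below: "bdd_below ((\<lambda>\<phi>. En \<phi> / Pw \<phi>) ` {\<phi> \<in> test. \<exists>x. \<phi> x \<noteq> 0})"
  by (rule bdd_belowI[of _ 0]) (auto simp: Jpow_nonneg)

lemma lam1_nonneg: "lam1 \<ge> 0"
  unfolding lam1_def by (rule cInf_greatest[OF quotients_nonempty]) (auto simp: Jpow_nonneg)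

lemma lam1_le:
  assumes "\<phi> \<in> test" shows "lam1 * Pw \<phi> \<le> En \<phi>"
proof (cases "\<exists>x. \<phi> x \<noteq> 0")
  case True
  then have P: "Pw \<phi> > 0" using Pw_pos[OF test_continuous[OF assms] test_Lpow[OF assms]] by blast
  have "lam1 \<le> En \<phi> / Pw \<phi>"
    unfolding lam1_def by (rule cInf_lower[OF _ quotients_bdd_below]) (use True assms in auto)
  with P show ?thesis by (simp add: field_simps)
next
  case False
  then have "Pw \<phi> = 0" using p1 by (simp add: Jpow_def)
  then show ?thesis by (simp add: Jpow_nonneg)
qed

lemma lam1_greatest:
  assumes "\<And>\<phi>. \<phi> \<in> test \<Longrightarrow> lam * Pw \<phi> \<le> En \<phi>"
  shows "lam \<le> lam1"
  unfolding lam1_def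
proof (rule cInf_greatest[OF quotients_nonempty])
  fix q assume "q \<in> (\<lambda>\<phi>. En \<phi> / Pw \<phi>) ` {\<phi> \<in> test. \<exists>x. \<phi> x \<noteq> 0}"
  then obtain \<phi> x where \<phi>: "\<phi> \<in> test" "\<phi> x \<noteq> 0" "q = En \<phi> / Pw \<phi>" by blast
  then have "Pw \<phi> > 0" using Pw_pos[OF test_continuous test_Lpow] by blast
  with assms[OF \<phi>(1)] show "lam \<le> q" unfolding \<phi>(3) by (simp add: pos_le_divide_eq)
qed

lemma minimising_sequence:
  "\<exists>\<phi>. (\<forall>k. \<phi> k \<in> test \<and> Pw (\<phi> k) = 1) \<and> (\<lambda>k. En (\<phi> k)) \<longlonglongrightarrow> lam1"
proof -
  have "\<exists>\<psi>. \<psi> \<in> test \<and> Pw \<psi> = 1 \<and> En \<psi> < lam1 + inverse (real (Suc k))" for k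
  proof -
    have "Inf ((\<lambda>\<phi>. En \<phi> / Pw \<phi>) ` {\<phi> \<in> test. \<exists>x. \<phi> x \<noteq> 0}) < lam1 + inverse (real (Suc k))"
      by (simp add: lam1_def)
    from cInf_lessD[OF quotients_nonempty this] obtain \<phi> x where
      \<phi>: "\<phi> \<in> test" "\<phi> x \<noteq> 0" "En \<phi> / Pw \<phi> < lam1 + inverse (real (Suc k))" by blast
    have P: "Pw \<phi> > 0" using Pw_pos[OF test_continuous test_Lpow] \<phi> by blast
    define c where "c = (1 / Pw \<phi>) powr (1 / p)"
    have c: "\<bar>c\<bar> powr p = 1 / Pw \<phi>" using P p1 by (simp add: c_def powr_powr)
    have "Pw (\<lambda>x. c * \<phi> x) = 1" using Lpow_scale(2)[OF test_Lpow[OF \<phi>(1)], of c] c P by simp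
    moreover have "En (\<lambda>x. c * \<phi> x) = En \<phi> / Pw \<phi>"
      unfolding dif_simps using Lpow_scale(2)[OF test_fin[OF \<phi>(1)], of c] c by simp
    ultimately show ?thesis using \<phi>(3) test_functions_scale[OF \<phi>(1), of c] by (intro exI[of _ "\<lambda>x. c * \<phi> x"]) simp
  qed
  then obtain \<phi> where \<phi>: "\<And>k. \<phi> k \<in> test" "\<And>k. Pw (\<phi> k) = 1" "\<And>k. En (\<phi> k) < lam1 + inverse (real (Suc k))"
    by metis
  have "(\<lambda>k. En (\<phi> k)) \<longlonglongrightarrow> lam1"
  proof (rule tendsto_sandwich)
    show "\<forall>\<^sub>F k in sequentially. lam1 \<le> En (\<phi> k)" using lam1_le[OF \<phi>(1)] \<phi>(2) by simp
    show "\<forall>\<^sub>F k in sequentially. En (\<phi> k) \<le> lam1 + inverse (real (Suc k))" using \<phi>(3) by (simp add: less_imp_le)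
    show "(\<lambda>k. lam1 + inverse (real (Suc k))) \<longlonglongrightarrow> lam1"
      using tendsto_add[OF tendsto_const LIMSEQ_inverse_real_of_nat, of lam1] by simp
  qed simp
  with \<phi> show ?thesis by blast
qed

lemma approx_Pw_tendsto:
  assumes "approx \<phi> g"
  shows "(\<lambda>k. Pw (\<phi> k)) \<longlonglongrightarrow> Pw g"
proof -
  obtain B where B: "B > 0" "\<And>k x. \<bar>\<phi> k x\<bar> \<le> B" "\<And>x. \<bar>g x\<bar> \<le> B" "\<And>k. En (\<phi> k) \<le> B"
    by (rule approx_bounded[OF assms]) (rule that)
  show ?thesis
    by (rule Pw_tendsto[OF test_measurable[OF approxD(1)[OF assms]] approx_measurable[OF assms]
          test_functions_outside[OF approxD(1)[OF assms]] B(2) approxD(5)[OF assms]])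
qed

lemma approx_En_less:
  assumes "approx \<phi> g" and "e > 0"
  shows "eventually (\<lambda>k. En (\<phi> k) < En g + e) sequentially"
  by (rule Jpow_limsup[OF approx_fin[OF assms(1)] _ _ p1(2) assms(2)])
    (use approxD[OF assms(1)] in \<open>auto simp: dif_simps\<close>)

lemma lam1_le_approx:
  assumes g: "approx \<phi> g" shows "lam1 * Pw g \<le> En g"
proof (rule field_le_epsilon)
  fix e :: real assume "e > 0"
  from approx_En_less[OF g this] have "eventually (\<lambda>k. lam1 * Pw (\<phi> k) \<le> En g + e) sequentially"
    by eventually_elim (use lam1_le[OF approxD(1)[OF g]] in \<open>meson less_imp_le order.trans\<close>)
  then show "lam1 * Pw g \<le> En g + e"
    by (intro tendsto_upperbound[OF tendsto_mult[OF tendsto_const approx_Pw_tendsto[OF g]]]) auto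
qed

text \<open>Morrey's inequality supplies the uniform bound and the equicontinuity for Arzela-Ascoli
  on the compact closure of \<Omega>; outside \<Omega> all terms vanish. Whether the limit belongs
  to the energy space is left open here.\<close>

lemma compactness:
  assumes \<phi>: "\<And>k. \<phi> k \<in> test" and M: "\<And>k. En (\<phi> k) \<le> M"
  shows "\<exists>s g B. strict_mono (s :: nat \<Rightarrow> nat) \<and> (\<forall>x. (\<lambda>k. \<phi> (s k) x) \<longlonglongrightarrow> g x) \<and> (\<forall>k x. \<bar>\<phi> k x\<bar> \<le> B)"
proof -
  obtain K where K: "K > 0" "\<And>f M x y. hoelder f \<Longrightarrow> fin f \<Longrightarrow> En f \<le> M \<Longrightarrow> M > 0 \<Longrightarrow> \<bar>f x - f y\<bar> \<le> K * M powr (1 / p) * norm (x - y) powr \<gamma>"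
    "\<And>f M x. hoelder f \<Longrightarrow> fin f \<Longrightarrow> En f \<le> M \<Longrightarrow> M > 0 \<Longrightarrow> (\<And>x. x \<notin> \<Omega> \<Longrightarrow> f x = 0) \<Longrightarrow> \<bar>f x\<bar> \<le> K * M powr (1 / p)"
    using hoelder_bound by blast
  define M' where "M' = max 1 M"
  have M': "M' > 0" "\<And>k. En (\<phi> k) \<le> M'" using M by (auto simp: M'_def le_max_iff_disj)
  define c where "c = K * M' powr (1 / p)"
  have c: "c > 0" using K(1) M'(1) by (simp add: c_def)
  have H: "\<bar>\<phi> k x - \<phi> k y\<bar> \<le> c * norm (x - y) powr \<gamma>" for k x y
    unfolding c_def by (rule K(2)[OF test_hoelder[OF \<phi>] test_fin[OF \<phi>] M'(2,1)])
  have B: "\<bar>\<phi> k x\<bar> \<le> c" for k x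
    unfolding c_def by (rule K(3)[OF test_hoelder[OF \<phi>] test_fin[OF \<phi>] M'(2,1) test_functions_outside[OF \<phi>]])
  have cpt: "compact (closure \<Omega>)" using bounded_\<Omega> by simp
  obtain g s where gs: "continuous_on (closure \<Omega>) g" "strict_mono (s :: nat \<Rightarrow> nat)"
    "\<And>e. 0 < e \<Longrightarrow> \<exists>N. \<forall>n x. n \<ge> N \<and> x \<in> closure \<Omega> \<longrightarrow> norm (\<phi> (s n) x - g x) < e"
  proof (rule Arzela_Ascoli[OF cpt, of \<phi> c])
    show "norm (\<phi> n x) \<le> c" for n x using B by simp
    fix x :: 'a and e :: real assume e: "e > 0"
    define d where "d = (e / c) powr (1 / \<gamma>)"
    have d: "d > 0" "c * d powr \<gamma> = e" using e c \<gamma> by (simp_all add: d_def powr_powr)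
    have "norm (\<phi> n x - \<phi> n y) < e" if "norm (x - y) < d" for n y
    proof -
      have "\<bar>\<phi> n x - \<phi> n y\<bar> \<le> c * norm (x - y) powr \<gamma>" by (rule H)
      also have "\<dots> < c * d powr \<gamma>" using that c \<gamma> by (intro mult_strict_left_mono powr_less_mono2) auto
      finally show ?thesis using d(2) by simp
    qed
    with d(1) show "\<exists>d>0. \<forall>n y. y \<in> closure \<Omega> \<and> norm (x - y) < d \<longrightarrow> norm (\<phi> n x - \<phi> n y) < e" by blast
  qed blast
  have "(\<lambda>k. \<phi> (s k) x) \<longlonglongrightarrow> (if x \<in> \<Omega> then g x else 0)" for x
  proof (cases "x \<in> \<Omega>")
    case True
    then have x: "x \<in> closure \<Omega>" using closure_subset by blast
    have "(\<lambda>k. \<phi> (s k) x) \<longlonglongrightarrow> g x"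
    proof (rule LIMSEQ_I)
      fix e :: real assume "e > 0"
      from gs(3)[OF this] x show "\<exists>no. \<forall>n\<ge>no. norm (\<phi> (s n) x - g x) < e" by blast
    qed
    with True show ?thesis by simp
  next
    case False
    then show ?thesis using test_functions_outside[OF \<phi>] by simp
  qed
  with gs(2) B show ?thesis by (intro exI[of _ s] exI[of _ "\<lambda>x. if x \<in> \<Omega> then g x else 0"] exI[of _ c]) blast
qed

lemma approx_add_test:
  assumes g: "approx \<phi> g" and w: "w \<in> test"
  shows "approx (\<lambda>k x. \<phi> k x + w x) (\<lambda>x. g x + w x)"
proof -
  note D = approxD[OF g]
  have "uniform_limit UNIV (\<lambda>k x. \<phi> k x + w x) (\<lambda>x. g x + w x) sequentially"
    by (intro uniform_limit_intros D(4))
  then show ?thesis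
    unfolding approx_def using D w by (auto intro: test_functions_add)
qed

lemma approx_scale:
  assumes g: "approx \<phi> g"
  shows "approx (\<lambda>k x. c * \<phi> k x) (\<lambda>x. c * g x)"
proof -
  note D = approxD[OF g]
  have eq: "dif (\<lambda>x. c * \<phi> k x - c * g x) = (\<lambda>z. c * dif (\<lambda>x. \<phi> k x - g x) z)" for k
    by (auto simp: dif_def algebra_simps)
  have "(\<lambda>k. \<bar>c\<bar> powr p * En (\<lambda>x. \<phi> k x - g x)) \<longlonglongrightarrow> \<bar>c\<bar> powr p * 0"
    by (intro tendsto_mult tendsto_const D(3))
  then have 1: "(\<lambda>k. En (\<lambda>x. c * \<phi> k x - c * g x)) \<longlonglongrightarrow> 0"
    unfolding eq using Lpow_scale(2)[OF D(2), of c] by simp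
  have 2: "fin (\<lambda>x. c * \<phi> k x - c * g x)" for k
    unfolding eq by (rule Lpow_scale(1)[OF D(2)])
  have "uniform_limit UNIV (\<lambda>k x. c * \<phi> k x) (\<lambda>x. c * g x) sequentially"
    by (rule bounded_linear.uniform_limit[OF bounded_linear_mult_right D(4)])
  with 1 2 show ?thesis
    unfolding approx_def using D(1) by (auto intro: test_functions_scale)
qed

text \<open>The function \<open>En - lam1 * Pw\<close> is nonnegative on the closure and vanishes at
  \<open>g\<close>, so its slope at \<open>g\<close> is nonnegative in every direction. Taking
  \<open>w\<close> and \<open>- w\<close> gives equality.\<close>

lemma euler_lagrange:
  assumes g: "approx \<phi> g" and E: "En g = lam1 * Pw g" and w: "w \<in> test"
  shows "weak_eq g lam1 w"
proof -
  let ?A = "\<lambda>w. \<integral>z. signed_powr p (dif g z) * dif w z \<partial>kern r"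
  let ?B = "\<lambda>w. \<integral>x. signed_powr p (g x) * w x \<partial>lborel"
  have le: "lam1 * ?B v \<le> ?A v" if v: "v \<in> test" for v
  proof -
    define t where "t k = 1 / real (Suc k)" for k
    have t: "t k > 0" for k by (simp add: t_def)
    have l1: "(\<lambda>k. (En (\<lambda>x. g x + t k * v x) - En g) / t k) \<longlonglongrightarrow> p * ?A v"
      unfolding dif_simps t_def by (rule Jpow_slope_limit[OF approx_fin[OF g] test_fin[OF v] p1(1)])
    have "(\<lambda>k. (Pw (\<lambda>x. g x + t k * v x) - Pw g) / t k) \<longlonglongrightarrow> p * ?B v"
      unfolding t_def by (rule Jpow_slope_limit[OF approx_Lpow[OF g] test_Lpow[OF v] p1(1)])
    then have l2: "(\<lambda>k. lam1 * ((Pw (\<lambda>x. g x + t k * v x) - Pw g) / t k)) \<longlonglongrightarrow> lam1 * (p * ?B v)"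
      by (intro tendsto_mult tendsto_const)
    have "lam1 * ((Pw (\<lambda>x. g x + t k * v x) - Pw g) / t k) \<le> (En (\<lambda>x. g x + t k * v x) - En g) / t k" for k
    proof -
      have "lam1 * Pw (\<lambda>x. g x + t k * v x) \<le> En (\<lambda>x. g x + t k * v x)"
        by (rule lam1_le_approx[OF approx_add_test[OF g test_functions_scale[OF v]]])
      then have "lam1 * (Pw (\<lambda>x. g x + t k * v x) - Pw g) \<le> En (\<lambda>x. g x + t k * v x) - En g"
        using E by (simp add: right_diff_distrib)
      from divide_right_mono[OF this less_imp_le[OF t]] show ?thesis by simp
    qed
    with l1 l2 have "lam1 * (p * ?B v) \<le> p * ?A v" by (intro LIMSEQ_le[OF l2 l1]) blast
    then have "p * (lam1 * ?B v) \<le> p * ?A v" by (simp only: mult.left_commute)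
    with p1 show ?thesis by simp
  qed
  have "?A (\<lambda>x. (-1) * w x) = - ?A w" "?B (\<lambda>x. (-1) * w x) = - ?B w"
    by (simp_all add: dif_def algebra_simps flip: Bochner_Integration.integral_minus)
  with le[OF w] le[OF test_functions_scale[OF w, of "-1"]] show ?thesis
    unfolding weak_eq_def by simp
qed

text \<open>Midpoints of late terms converge pointwise to the same limit, so their p-th powers still
  integrate to nearly 1 and their energies are nearly at least \<open>lam1\<close>. In Clarkson's
  inequality this leaves no energy for the half differences, so the subsequence is Cauchy.\<close>

lemma minimising_limit:
  assumes \<phi>: "\<And>k. \<phi> k \<in> test" and P: "(\<lambda>k. Pw (\<phi> k)) \<longlonglongrightarrow> 1" and E: "(\<lambda>k. En (\<phi> k)) \<longlonglongrightarrow> lam1"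
  shows "\<exists>s g. strict_mono (s :: nat \<Rightarrow> nat) \<and> approx (\<lambda>k. \<phi> (s k)) g \<and> Pw g = 1 \<and> En g = lam1 \<and> eigen g lam1"
proof -
  obtain M where M: "\<And>k. En (\<phi> k) \<le> M"
    using convergent_imp_Bseq[OF convergentI[OF E]] unfolding Bseq_def by (metis abs_le_D1 real_norm_def)
  obtain s g0 B where s: "strict_mono (s :: nat \<Rightarrow> nat)" and pt: "\<And>x. (\<lambda>k. \<phi> (s k) x) \<longlonglongrightarrow> g0 x" and B: "\<And>k x. \<bar>\<phi> k x\<bar> \<le> B"
    using compactness[of \<phi>, OF \<phi> M] by blast
  define \<psi> where "\<psi> k = \<phi> (s k)" for k
  have \<psi>: "\<psi> k \<in> test" for k by (simp add: \<psi>_def \<phi>)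
  have [measurable]: "\<psi> k \<in> borel_measurable borel" for k using \<psi> by auto
  have P': "(\<lambda>k. Pw (\<psi> k)) \<longlonglongrightarrow> 1" and E': "(\<lambda>k. En (\<psi> k)) \<longlonglongrightarrow> lam1"
    using LIMSEQ_subseq_LIMSEQ[OF P s] LIMSEQ_subseq_LIMSEQ[OF E s] by (simp_all add: \<psi>_def o_def)
  have [measurable]: "g0 \<in> borel_measurable borel" by (rule borel_measurable_LIMSEQ_real[OF pt]) (use \<phi> in auto)
  have "(\<lambda>k. Pw (\<psi> k)) \<longlonglongrightarrow> Pw g0"
    by (rule Pw_tendsto[OF test_measurable[OF \<psi>] _ test_functions_outside[OF \<psi>]])
      (use B pt in \<open>auto simp: \<psi>_def\<close>)
  then have Pg0: "Pw g0 = 1" using P' LIMSEQ_unique by blast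
  have "\<exists>g. approx \<psi> g"
  proof (rule Cauchy_approx[OF \<psi>], rule ccontr)
    fix e :: real assume e: "e > 0" and "\<not> (\<exists>n. \<forall>k\<ge>n. \<forall>l\<ge>n. En (\<lambda>x. \<psi> k x - \<psi> l x) \<le> e)"
    then have "\<forall>n. \<exists>k l. k \<ge> n \<and> l \<ge> n \<and> En (\<lambda>x. \<psi> k x - \<psi> l x) > e" by (meson not_le)
    then obtain k l where kl: "\<And>n. k n \<ge> n" "\<And>n. l n \<ge> n" "\<And>n. En (\<lambda>x. \<psi> (k n) x - \<psi> (l n) x) > e"
      by metis
    have fk: "filterlim k at_top sequentially" and fl: "filterlim l at_top sequentially"
      by (rule filterlim_at_top_mono[OF filterlim_ident], use kl in simp)+
    \<comment> \<open>Midpoints of the pairs that violate the Cauchy condition.\<close>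
    define m where "m n x = 1 / 2 * (\<psi> (k n) x + \<psi> (l n) x)" for n x
    have mt: "m n \<in> test" for n
      unfolding m_def[abs_def] by (intro test_functions_scale test_functions_add \<psi>)
    have mlim: "(\<lambda>n. m n x) \<longlonglongrightarrow> g0 x" for x
    proof -
      have "(\<lambda>n. m n x) \<longlonglongrightarrow> 1 / 2 * (g0 x + g0 x)"
        unfolding m_def \<psi>_def
        by (intro tendsto_intros filterlim_compose[OF pt fk] filterlim_compose[OF pt fl])
      then show ?thesis by simp
    qed
    have "(\<lambda>n. Pw (m n)) \<longlonglongrightarrow> Pw g0"
    proof (rule Pw_tendsto[OF test_measurable[OF mt] _ test_functions_outside[OF mt] _ mlim])
      show "\<bar>m n x\<bar> \<le> B" for n x
        using B[of "s (k n)" x] B[of "s (l n)" x] unfolding m_def \<psi>_def by (simp add: abs_le_iff)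
    qed simp_all
    then have "(\<lambda>n. (En (\<psi> (k n)) + En (\<psi> (l n))) / 2 - lam1 * Pw (m n)) \<longlonglongrightarrow> (lam1 + lam1) / 2 - lam1 * Pw g0"
      by (intro tendsto_intros filterlim_compose[OF E' fk] filterlim_compose[OF E' fl]) simp_all
    then have "(\<lambda>n. (En (\<psi> (k n)) + En (\<psi> (l n))) / 2 - lam1 * Pw (m n)) \<longlonglongrightarrow> 0" by (simp add: Pg0)
    moreover have "(1 / 2) powr p * e \<le> (En (\<psi> (k n)) + En (\<psi> (l n))) / 2 - lam1 * Pw (m n)" for n
    proof -
      have 1: "dif (m n) = (\<lambda>z. (dif (\<psi> (k n)) z + dif (\<psi> (l n)) z) / 2)" by (auto simp: m_def dif_def field_simps)
      have 2: "Jpow (kern r) p (\<lambda>z. (dif (\<psi> (k n)) z - dif (\<psi> (l n)) z) / 2) = (1 / 2) powr p * En (\<lambda>x. \<psi> (k n) x - \<psi> (l n) x)"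
        using Lpow_scale(2)[OF test_fin[OF test_functions_diff[OF \<psi> \<psi>]], of "1 / 2" "k n" "l n"] by (simp add: dif_simps)
      have "(1 / 2) powr p * e \<le> (1 / 2) powr p * En (\<lambda>x. \<psi> (k n) x - \<psi> (l n) x)"
        using kl(3)[of n] by (intro mult_left_mono) auto
      then show ?thesis
        using Lpow_clarkson[OF test_fin[OF \<psi>] test_fin[OF \<psi>] p2, of "k n" "l n"] lam1_le[OF mt, of n] unfolding 2 1[symmetric] by linarith
    qed
    ultimately have "(1 / 2) powr p * e \<le> 0" by (intro LIMSEQ_le_const) auto
    with e show False by (simp add: mult_le_0_iff)
  qed
  then obtain g where g: "approx \<psi> g" by blast
  have Pg: "Pw g = 1" using LIMSEQ_unique[OF approx_Pw_tendsto[OF g] P'] .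
  have "AE z in kern r. (\<lambda>k. dif (\<psi> k) z) \<longlonglongrightarrow> dif g z"
    unfolding dif_def by (intro AE_I2 tendsto_intros approxD(5)[OF g])
  from Lpow_Fatou(2)[OF test_fin[OF \<psi>] order_refl E' this LpowD(1)[OF approx_fin[OF g]] p1(3)]
  have Eg: "En g = lam1" using lam1_le_approx[OF g] Pg by simp
  have "\<exists>x. g x \<noteq> 0"
  proof (rule ccontr)
    assume "\<not> ?thesis"
    then have "Pw g = 0" using p1 by (simp add: Jpow_def)
    with Pg show False by simp
  qed
  moreover have "weak_eq g lam1 w" if "w \<in> test" for w
    by (rule euler_lagrange[OF g _ that]) (simp add: Eg Pg)
  ultimately have "eigen g lam1" using g unfolding eigen_def by blast
  with s g Pg Eg show ?thesis unfolding \<psi>_def[abs_def] by blast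
qed

end

subsection \<open>Picone's inequality and eigenfunctions of constant sign\<close>

text \<open>The reverse triangle inequality for the complex numbers \<open>a + i d\<close> and
  \<open>b + i d\<close>: the smooth substitute for the absolute value is a contraction.\<close>

lemma sqrt_lipschitz:
  fixes a b d :: real
  shows "\<bar>sqrt (a\<^sup>2 + d\<^sup>2) - sqrt (b\<^sup>2 + d\<^sup>2)\<bar> \<le> \<bar>a - b\<bar>"
proof -
  have "\<bar>cmod (Complex a d) - cmod (Complex b d)\<bar> \<le> cmod (Complex a d - Complex b d)"
    by (rule norm_triangle_ineq3)
  also have "Complex a d - Complex b d = Complex (a - b) 0" by (simp add: complex_eq_iff)
  finally show ?thesis by (simp add: complex_norm)
qed

lemma sqrt_bounds:
  fixes a d :: real
  assumes "d \<ge> 0"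
  shows "d \<le> sqrt (a\<^sup>2 + d\<^sup>2)" and "\<bar>a\<bar> \<le> sqrt (a\<^sup>2 + d\<^sup>2)" and "sqrt (a\<^sup>2 + d\<^sup>2) \<le> \<bar>a\<bar> + d"
  using assms sqrt_sum_squares_le_sum_abs[of a d] by (auto intro: real_le_rsqrt)

lemma smooth_sqrt:
  assumes "smooth f" and "d > 0"
  shows "smooth (\<lambda>x. sqrt ((f x)\<^sup>2 + d\<^sup>2))"
proof -
  have pos: "(f x)\<^sup>2 + d\<^sup>2 > 0" for x using assms(2) by (simp add: add_nonneg_pos)
  have "smooth (\<lambda>x. ((f x)\<^sup>2 + d\<^sup>2) powr (1 / 2))"
    by (intro smooth_intros(5) smooth_intros(3) smooth_intros(1) smooth_power2 assms(1) pos)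
  moreover have "((f x)\<^sup>2 + d\<^sup>2) powr (1 / 2) = sqrt ((f x)\<^sup>2 + d\<^sup>2)" for x
    by (rule powr_half_sqrt) (simp add: less_imp_le[OF pos])
  ultimately show ?thesis by simp
qed

lemma tendsto_sqrt_abs:
  assumes "(f \<longlonglongrightarrow> a)" and "d \<longlonglongrightarrow> (0::real)"
  shows "(\<lambda>k. sqrt ((f k)\<^sup>2 + (d k)\<^sup>2)) \<longlonglongrightarrow> \<bar>a\<bar>"
proof -
  have "(\<lambda>k. sqrt ((f k)\<^sup>2 + (d k)\<^sup>2)) \<longlonglongrightarrow> sqrt (a\<^sup>2 + 0\<^sup>2)"
    by (intro tendsto_intros assms)
  then show ?thesis by simp
qed

text \<open>After scaling by \<open>a\<close> only the ratio \<open>\<theta> = b / a\<close>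
  remains, and the claim is \<open>powr_abs_sum_le\<close> for the decomposition
  \<open>s = (s - t) + t\<close>.\<close>

lemma picone_ge:
  fixes a b s t :: real
  assumes p: "p > 1" and "0 < b" "b \<le> a" "0 \<le> s" "0 \<le> t"
  shows "(a - b) powr (p - 1) * (s powr p * a powr (1 - p) - t powr p * b powr (1 - p)) \<le> \<bar>s - t\<bar> powr p"
proof (cases "a = b")
  case False
  define \<theta> where "\<theta> = b / a"
  have \<theta>: "0 < \<theta>" "\<theta> < 1" and b: "b = \<theta> * a" using assms False by (auto simp: \<theta>_def)
  have a: "a > 0" using assms by simp
  have "s powr p \<le> (1 - \<theta>) powr (1 - p) * \<bar>s - t\<bar> powr p + \<theta> powr (1 - p) * t powr p"
    using powr_abs_sum_le[of p \<theta> "s - t" t] \<theta> assms by simp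
  then have "(1 - \<theta>) powr (p - 1) * (s powr p - \<theta> powr (1 - p) * t powr p)
      \<le> (1 - \<theta>) powr (p - 1) * ((1 - \<theta>) powr (1 - p) * \<bar>s - t\<bar> powr p)"
    by (intro mult_left_mono) auto
  also have "\<dots> = ((1 - \<theta>) powr (p - 1) * (1 - \<theta>) powr (1 - p)) * \<bar>s - t\<bar> powr p" by simp
  also have "(1 - \<theta>) powr (p - 1) * (1 - \<theta>) powr (1 - p) = 1"
    using \<theta> by (simp only: powr_add[symmetric]) simp
  finally have *: "(1 - \<theta>) powr (p - 1) * (s powr p - \<theta> powr (1 - p) * t powr p) \<le> \<bar>s - t\<bar> powr p" by simp
  have e1: "(a - b) powr (p - 1) = (1 - \<theta>) powr (p - 1) * a powr (p - 1)"
    using \<theta> a unfolding b by (simp add: powr_mult[symmetric] algebra_simps)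
  have e2: "b powr (1 - p) = \<theta> powr (1 - p) * a powr (1 - p)" using \<theta> a unfolding b by (simp add: powr_mult)
  have e3: "a powr (p - 1) * a powr (1 - p) = 1" using a by (simp only: powr_add[symmetric]) simp
  have "(a - b) powr (p - 1) * (s powr p * a powr (1 - p) - t powr p * b powr (1 - p))
      = (1 - \<theta>) powr (p - 1) * (a powr (p - 1) * a powr (1 - p)) * (s powr p - \<theta> powr (1 - p) * t powr p)"
    unfolding e1 e2 by (simp only: right_diff_distrib mult_ac)
  also have "\<dots> = (1 - \<theta>) powr (p - 1) * (s powr p - \<theta> powr (1 - p) * t powr p)"
    unfolding e3 by simp
  finally have "(a - b) powr (p - 1) * (s powr p * a powr (1 - p) - t powr p * b powr (1 - p))
      = (1 - \<theta>) powr (p - 1) * (s powr p - \<theta> powr (1 - p) * t powr p)" .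
  with * show ?thesis by simp
qed (use p in simp)

lemma picone:
  fixes a b s t :: real
  assumes p: "p > 1" and "0 < a" "0 < b" "0 \<le> s" "0 \<le> t"
  shows "signed_powr p (a - b) * (s powr p * a powr (1 - p) - t powr p * b powr (1 - p)) \<le> \<bar>s - t\<bar> powr p"
proof (cases "b \<le> a")
  case True
  then show ?thesis using picone_ge[OF p assms(3) True assms(4,5)] signed_powr_nonneg[OF p, of "a - b"] by simp
next
  case False
  then have "signed_powr p (a - b) = - ((b - a) powr (p - 1))"
    using signed_powr_nonneg[OF p, of "b - a"] signed_powr_minus[of p "b - a"] by simp
  then show ?thesis using picone_ge[OF p assms(2) _ assms(5,4), of b] False by (simp add: algebra_simps abs_minus_commute)
qed

lemma abs_powr_lipschitz:
  fixes x y R :: real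
  assumes p: "p > 1" and "\<bar>x\<bar> \<le> R" "\<bar>y\<bar> \<le> R"
  shows "\<bar>\<bar>x\<bar> powr p - \<bar>y\<bar> powr p\<bar> \<le> p * R powr (p - 1) * \<bar>x - y\<bar>"
proof -
  have "norm (\<bar>x\<bar> powr p - \<bar>y\<bar> powr p) \<le> p * R powr (p - 1) * norm (x - y)"
  proof (rule field_differentiable_bound[where S="{-R..R}" and f'="\<lambda>t. p * signed_powr p t"])
    show "((\<lambda>t. \<bar>t\<bar> powr p) has_field_derivative p * signed_powr p z) (at z within {-R..R})" for z
      by (rule has_field_derivative_at_within[OF has_derivative_abs_powr[OF p]])
    show "norm (p * signed_powr p z) \<le> p * R powr (p - 1)" if "z \<in> {-R..R}" for z
      using that p by (auto simp: abs_mult abs_signed_powr intro!: powr_mono2)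
  qed (use assms in auto)
  then show ?thesis by simp
qed

lemma neg_powr_lipschitz:
  fixes x y e :: real
  assumes p: "p > 1" and e: "e > 0" and "x \<ge> e" "y \<ge> e"
  shows "\<bar>x powr (1 - p) - y powr (1 - p)\<bar> \<le> (p - 1) * e powr (- p) * \<bar>x - y\<bar>"
proof -
  have "norm (x powr (1 - p) - y powr (1 - p)) \<le> (p - 1) * e powr (- p) * norm (x - y)"
  proof (rule field_differentiable_bound[where S="{e..}" and f'="\<lambda>t. (1 - p) * t powr (- p)"])
    show "((\<lambda>t. t powr (1 - p)) has_field_derivative (1 - p) * z powr (- p)) (at z within {e..})" if "z \<in> {e..}" for z
      using has_field_derivative_at_within[OF has_real_derivative_powr[of z "1 - p"]] that e by simp
    show "norm ((1 - p) * z powr (- p)) \<le> (p - 1) * e powr (- p)" if "z \<in> {e..}" for z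
      using that p e by (auto simp: abs_mult intro!: mult_mono powr_mono2')
  qed (use assms in auto)
  then show ?thesis by simp
qed

lemma Jpow_two_bound:
  assumes a: "Lpow N p a" and b: "Lpow N p b" and c: "Lpow N p c" and p: "p \<ge> 1"
    and le: "\<And>z. \<bar>c z\<bar> \<le> C1 * \<bar>a z\<bar> + C2 * \<bar>b z\<bar>" and C: "C1 \<ge> 0" "C2 \<ge> 0"
  shows "Jpow N p c \<le> 2 powr p * (C1 powr p * Jpow N p a + C2 powr p * Jpow N p b)"
proof -
  have "\<bar>c z\<bar> powr p \<le> 2 powr p * (C1 powr p * \<bar>a z\<bar> powr p + C2 powr p * \<bar>b z\<bar> powr p)" for z
  proof -
    have "\<bar>c z\<bar> powr p \<le> \<bar>C1 * \<bar>a z\<bar> + C2 * \<bar>b z\<bar>\<bar> powr p"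
      using le[of z] p by (intro powr_mono2) auto
    also have "\<dots> \<le> 2 powr p * (\<bar>C1 * \<bar>a z\<bar>\<bar> powr p + \<bar>C2 * \<bar>b z\<bar>\<bar> powr p)"
      by (rule powr_abs_sum_le2[OF p])
    finally show ?thesis using C by (simp add: abs_mult powr_mult)
  qed
  then have "Jpow N p c \<le> (\<integral>z. 2 powr p * (C1 powr p * \<bar>a z\<bar> powr p + C2 powr p * \<bar>b z\<bar> powr p) \<partial>N)"
    unfolding Jpow_def
    by (intro integral_mono LpowD(2)[OF c]) (use LpowD(2)[OF a] LpowD(2)[OF b] in auto)
  also have "\<dots> = 2 powr p * (C1 powr p * Jpow N p a + C2 powr p * Jpow N p b)"
    using LpowD(2)[OF a] LpowD(2)[OF b] by (simp add: Jpow_def)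
  finally show ?thesis .
qed

context fractional
begin

text \<open>Test functions approximating the Picone quotient with bounded energies: numerator and
  denominator are smooth and Lipschitz functions of \<phi> and \<psi>, the denominator staying above
  \<open>e\<close>, so differences of \<open>w k\<close> are bounded by those of \<phi> and of
  \<psi>.\<close>

lemma picone_test:
  assumes g: "approx \<psi> g" and \<phi>: "\<phi> \<in> test" and e: "e > 0"
  shows "\<exists>w M. (\<forall>k. w k \<in> test) \<and> (\<forall>k. En (w k) \<le> M) \<and>
    (\<forall>x. (\<lambda>k. w k x) \<longlonglongrightarrow> \<bar>\<phi> x\<bar> powr p * (\<bar>g x\<bar> + e) powr (1 - p))"
proof -
  note D = approxD[OF g]
  obtain B where B: "B > 0" "\<And>x. \<bar>\<phi> x\<bar> \<le> B" "\<And>x y. \<bar>\<phi> x - \<phi> y\<bar> \<le> B * norm (x - y)"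
    by (rule test_functions_bounded_lipschitz[OF \<phi>]) (rule that)
  obtain B' where B': "B' > 0" "\<And>k x. \<bar>\<psi> k x\<bar> \<le> B'" "\<And>x. \<bar>g x\<bar> \<le> B'" "\<And>k. En (\<psi> k) \<le> B'"
    by (rule approx_bounded[OF g]) (rule that)
  define d where "d k = inverse (real (Suc k))" for k
  have d: "0 < d k" "d k \<le> 1" for k by (auto simp: d_def field_simps)
  have d0: "d \<longlonglongrightarrow> 0" unfolding d_def by (rule LIMSEQ_inverse_real_of_nat)
  define S where "S k x = sqrt ((\<phi> x)\<^sup>2 + (d k)\<^sup>2)" for k x
  define T where "T k x = sqrt ((\<psi> k x)\<^sup>2 + (d k)\<^sup>2) + e" for k x
  \<comment> \<open>Subtracting \<open>d k powr p\<close> makes \<open>w k\<close> vanish wherever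
    \<phi> does, which keeps its support inside that of \<phi>.\<close>
  define w where "w k x = (S k x powr p + - (d k powr p)) * T k x powr (1 - p)" for k x
  have S: "d k \<le> S k x" "S k x \<le> B + 1" for k x
    using sqrt_bounds(1,3)[of "d k" "\<phi> x"] d[of k] B(2)[of x] unfolding S_def by linarith+
  have T: "e \<le> T k x" for k x unfolding T_def by simp
  have Tpos: "T k x > 0" for k x using T[of k x] e by linarith
  have smS: "smooth (S k)" for k unfolding S_def by (rule smooth_sqrt[OF test_functions_smooth[OF \<phi>] d(1)])
  have smT: "smooth (T k)" for k unfolding T_def
    by (intro smooth_intros(3) smooth_intros(1) smooth_sqrt test_functions_smooth[OF D(1)] d(1))
  have wt: "w k \<in> test" for k
  proof (rule test_functionsI[OF _ \<phi>])
    show "smooth (w k)" unfolding w_def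
      by (intro smooth_intros(4) smooth_intros(3) smooth_intros(5) smooth_intros(1) smS smT Tpos)
        (meson S(1) d(1) less_le_trans)
    show "w k x = 0" if "\<phi> x = 0" for x using that d[of k] by (simp add: w_def S_def)
  qed
  define C1 where "C1 = p * (B + 1) powr (p - 1) * e powr (1 - p)"
  define C2 where "C2 = (B + 1) powr p * ((p - 1) * e powr (- p))"
  have C: "C1 \<ge> 0" "C2 \<ge> 0" using p1 by (auto simp: C1_def C2_def)
  have lip: "\<bar>w k y - w k x\<bar> \<le> C1 * \<bar>\<phi> y - \<phi> x\<bar> + C2 * \<bar>\<psi> k y - \<psi> k x\<bar>" for k x y
  proof -
    let ?F = "\<lambda>x. S k x powr p + - (d k powr p)" and ?G = "\<lambda>x. T k x powr (1 - p)"
    have "\<bar>\<bar>S k y\<bar> powr p - \<bar>S k x\<bar> powr p\<bar> \<le> p * (B + 1) powr (p - 1) * \<bar>S k y - S k x\<bar>"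
      by (rule abs_powr_lipschitz[OF p1(1)]) (use S[of k x] S[of k y] d[of k] in auto)
    also have "\<dots> \<le> p * (B + 1) powr (p - 1) * \<bar>\<phi> y - \<phi> x\<bar>"
      unfolding S_def by (intro mult_left_mono sqrt_lipschitz) (use p1 in auto)
    finally have 1: "\<bar>?F y - ?F x\<bar> \<le> p * (B + 1) powr (p - 1) * \<bar>\<phi> y - \<phi> x\<bar>"
      using S(1)[of k x] S(1)[of k y] d[of k] by simp
    have "\<bar>?G y - ?G x\<bar> \<le> (p - 1) * e powr (- p) * \<bar>T k y - T k x\<bar>"
      by (rule neg_powr_lipschitz[OF p1(1) e T T])
    also have "\<dots> \<le> (p - 1) * e powr (- p) * \<bar>\<psi> k y - \<psi> k x\<bar>"
      using sqrt_lipschitz[of "\<psi> k y" "d k" "\<psi> k x"] p1 unfolding T_def by (intro mult_left_mono) auto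
    finally have 2: "\<bar>?G y - ?G x\<bar> \<le> (p - 1) * e powr (- p) * \<bar>\<psi> k y - \<psi> k x\<bar>" .
    have 3: "\<bar>?G y\<bar> \<le> e powr (1 - p)" using T[of k y] e p1 by (auto intro!: powr_mono2')
    have "d k powr p \<le> S k x powr p" "S k x powr p \<le> (B + 1) powr p"
      using S[of k x] d[of k] p1 by (auto intro!: powr_mono2)
    then have 4: "\<bar>?F x\<bar> \<le> (B + 1) powr p" using powr_ge_zero[of "d k" p] by linarith
    have "w k y - w k x = (?F y - ?F x) * ?G y + ?F x * (?G y - ?G x)" by (simp add: w_def algebra_simps)
    then have "\<bar>w k y - w k x\<bar> \<le> \<bar>?F y - ?F x\<bar> * \<bar>?G y\<bar> + \<bar>?F x\<bar> * \<bar>?G y - ?G x\<bar>"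
      by (metis abs_mult abs_triangle_ineq)
    also have "\<dots> \<le> p * (B + 1) powr (p - 1) * \<bar>\<phi> y - \<phi> x\<bar> * e powr (1 - p)
        + (B + 1) powr p * ((p - 1) * e powr (- p) * \<bar>\<psi> k y - \<psi> k x\<bar>)"
      by (intro add_mono mult_mono 1 2 3 4) (use p1 in auto)
    also have "\<dots> = C1 * \<bar>\<phi> y - \<phi> x\<bar> + C2 * \<bar>\<psi> k y - \<psi> k x\<bar>" by (simp add: C1_def C2_def)
    finally show ?thesis .
  qed
  define M where "M = 2 powr p * (C1 powr p * En \<phi> + C2 powr p * B')"
  have M: "En (w k) \<le> M" for k
  proof -
    have "En (w k) \<le> 2 powr p * (C1 powr p * En \<phi> + C2 powr p * En (\<psi> k))"
      by (rule Jpow_two_bound[OF test_fin[OF \<phi>] test_fin[OF D(1)] test_fin[OF wt] p1(2) _ C])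
        (use lip in \<open>simp add: dif_def\<close>)
    also have "\<dots> \<le> M" unfolding M_def using B'(4) by (intro mult_left_mono add_left_mono) auto
    finally show ?thesis .
  qed
  have lim: "(\<lambda>k. w k x) \<longlonglongrightarrow> \<bar>\<phi> x\<bar> powr p * (\<bar>g x\<bar> + e) powr (1 - p)" for x
  proof -
    have "(\<lambda>k. \<bar>S k x\<bar> powr p) \<longlonglongrightarrow> \<bar>\<bar>\<phi> x\<bar>\<bar> powr p"
      unfolding S_def by (intro tendsto_abs_powr tendsto_sqrt_abs tendsto_const d0 p1)
    moreover have "(\<lambda>k. \<bar>d k\<bar> powr p) \<longlonglongrightarrow> \<bar>0\<bar> powr p" by (rule tendsto_abs_powr[OF d0 p1(3)])
    ultimately have "(\<lambda>k. \<bar>S k x\<bar> powr p + - (\<bar>d k\<bar> powr p)) \<longlonglongrightarrow> \<bar>\<phi> x\<bar> powr p + - 0"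
      by (intro tendsto_add tendsto_minus) auto
    moreover have "\<bar>S k x\<bar> = S k x" "\<bar>d k\<bar> = d k" for k using S(1)[of k x] d[of k] by auto
    ultimately have 1: "(\<lambda>k. S k x powr p + - (d k powr p)) \<longlonglongrightarrow> \<bar>\<phi> x\<bar> powr p" by simp
    have "(\<lambda>k. T k x) \<longlonglongrightarrow> \<bar>g x\<bar> + e"
      unfolding T_def by (intro tendsto_add tendsto_const tendsto_sqrt_abs D(5) d0)
    then have "(\<lambda>k. T k x powr (1 - p)) \<longlonglongrightarrow> (\<bar>g x\<bar> + e) powr (1 - p)"
      by (rule tendsto_powr[OF _ tendsto_const]) (use e in linarith)
    with 1 show ?thesis unfolding w_def by (rule tendsto_mult)
  qed
  from wt M lim show ?thesis by blast
qed

text \<open>The equation is tested with the eigenfunction itself, as a limit of its approximating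
  test functions.\<close>

lemma eigen_energy:
  assumes "eigen g lam"
  shows "En g = lam * Pw g" and "Pw g > 0" and "lam1 \<le> lam"
proof -
  obtain \<phi> x where g: "approx \<phi> g" and x: "g x \<noteq> 0" and eq: "\<And>w. w \<in> test \<Longrightarrow> weak_eq g lam w"
    using assms unfolding eigen_def by blast
  obtain B where B: "B > 0" "\<And>k x. \<bar>\<phi> k x\<bar> \<le> B" "\<And>x. \<bar>g x\<bar> \<le> B" "\<And>k. En (\<phi> k) \<le> B"
    by (rule approx_bounded[OF g]) (rule that)
  have "weak_eq g lam g"
    by (rule weak_eq_limit(1)[OF g eq[OF approxD(1)[OF g]] approxD(1)[OF g] B(4) approxD(5)[OF g]])
  then show E: "En g = lam * Pw g"
    unfolding weak_eq_def Jpow_def by (simp add: signed_powr_mult_self p1)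
  show P: "Pw g > 0" by (rule Pw_pos[OF approx_continuous[OF g] approx_Lpow[OF g] x])
  from lam1_le_approx[OF g] E P show "lam1 \<le> lam" by simp
qed

lemma wt_pos: "fst z \<noteq> snd z \<Longrightarrow> wt r z > 0"
  by (simp add: wt_def)

text \<open>Testing with \<open>|\<phi>|\<^sup>p / (g + e)\<^sup>p\<^sup>-\<^sup>1\<close>: by Picone's inequality the integrand of the energy
  of \<open>|\<phi>|\<close> dominates the one of the pairing, and the difference stays integrable as \<open>e\<close> tends to 0.\<close>

lemma picone_energy:
  assumes eig: "eigen g lam" and nn: "\<And>x. g x \<ge> 0" and \<phi>: "\<phi> \<in> test" and e: "e > 0"
  defines "v \<equiv> \<lambda>x. \<bar>\<phi> x\<bar> powr p * (g x + e) powr (1 - p)"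
  defines "Dp \<equiv> \<lambda>z. \<bar>dif (\<lambda>x. \<bar>\<phi> x\<bar>) z\<bar> powr p - signed_powr p (dif g z) * dif v z"
  shows "\<And>z. Dp z \<ge> 0" and "integrable (kern r) Dp"
    and "(\<integral>z. Dp z \<partial>kern r) + lam * (\<integral>x. signed_powr p (g x) * v x \<partial>lborel) \<le> En \<phi>"
    and "integrable lborel (\<lambda>x. signed_powr p (g x) * v x)" and "\<And>x. signed_powr p (g x) * v x \<ge> 0"
proof -
  obtain \<psi> where g: "approx \<psi> g" and eq: "\<And>w. w \<in> test \<Longrightarrow> weak_eq g lam w"
    using eig unfolding eigen_def by blast
  obtain w M where w: "\<And>k. w k \<in> test" "\<And>k. En (w k) \<le> M"
    "\<And>x. (\<lambda>k. w k x) \<longlonglongrightarrow> \<bar>\<phi> x\<bar> powr p * (\<bar>g x\<bar> + e) powr (1 - p)"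
    using picone_test[OF g \<phi> e] by blast
  have lim: "(\<lambda>k. w k x) \<longlonglongrightarrow> v x" for x using w(3)[of x] nn[of x] by (simp add: v_def)
  note W = weak_eq_limit[OF g eq[OF w(1)] w(1,2) lim]
  have [measurable]: "\<phi> \<in> borel_measurable borel" "g \<in> borel_measurable borel" "v \<in> borel_measurable borel"
    using \<phi> approx_measurable[OF g] W(4) by auto
  have absm: "(\<lambda>x. \<bar>\<phi> x\<bar>) \<in> borel_measurable borel" by measurable
  have A: "fin (\<lambda>x. \<bar>\<phi> x\<bar>)" "En (\<lambda>x. \<bar>\<phi> x\<bar>) \<le> En \<phi>"
    by (rule Lpow_contract[OF test_fin[OF \<phi>]]; use p1 absm in \<open>auto simp: dif_def\<close>)+
  show "Dp z \<ge> 0" for z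
  proof -
    let ?x = "fst z" and ?y = "snd z"
    \<comment> \<open>Picone's inequality for the shifted values; the shift by \<open>e\<close>
      keeps the denominators positive and cancels in the difference of \<open>g\<close>.\<close>
    have "signed_powr p ((g ?y + e) - (g ?x + e)) * (\<bar>\<phi> ?y\<bar> powr p * (g ?y + e) powr (1 - p) - \<bar>\<phi> ?x\<bar> powr p * (g ?x + e) powr (1 - p))
        \<le> \<bar>\<bar>\<phi> ?y\<bar> - \<bar>\<phi> ?x\<bar>\<bar> powr p"
      by (rule picone[OF p1(1)]) (use nn[of ?x] nn[of ?y] e in auto)
    then show ?thesis by (simp add: Dp_def dif_def v_def)
  qed
  have i1: "integrable (kern r) (\<lambda>z. signed_powr p (dif g z) * dif v z)"
    by (rule Lpow_pairing_integrable[OF approx_fin[OF g] W(2) p1(1)])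
  note i2 = LpowD(2)[OF A(1)]
  show "integrable (kern r) Dp" unfolding Dp_def by (rule Bochner_Integration.integrable_diff[OF i2 i1])
  have "(\<integral>z. Dp z \<partial>kern r) = En (\<lambda>x. \<bar>\<phi> x\<bar>) - (\<integral>z. signed_powr p (dif g z) * dif v z \<partial>kern r)"
    unfolding Dp_def Jpow_def by (rule Bochner_Integration.integral_diff[OF i2 i1])
  with W(1) A(2) show "(\<integral>z. Dp z \<partial>kern r) + lam * (\<integral>x. signed_powr p (g x) * v x \<partial>lborel) \<le> En \<phi>"
    unfolding weak_eq_def by simp
  obtain B where B: "B > 0" "\<And>x. \<bar>\<phi> x\<bar> \<le> B" "\<And>x y. \<bar>\<phi> x - \<phi> y\<bar> \<le> B * norm (x - y)"
    by (rule test_functions_bounded_lipschitz[OF \<phi>]) (rule that)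
  have "Lpow lborel p v"
  proof (rule bounded_Lpow(1))
    show "v x = 0" if "x \<notin> \<Omega>" for x using test_functions_outside[OF \<phi> that] p1 by (simp add: v_def)
    show "\<bar>v x\<bar> \<le> B powr p * e powr (1 - p)" for x
    proof -
      have "\<bar>\<phi> x\<bar> powr p \<le> B powr p" using B(2)[of x] p1 by (intro powr_mono2) auto
      moreover have "(g x + e) powr (1 - p) \<le> e powr (1 - p)"
        using nn[of x] e p1 by (intro powr_mono2') auto
      ultimately have "\<bar>\<phi> x\<bar> powr p * (g x + e) powr (1 - p) \<le> B powr p * e powr (1 - p)"
        by (intro mult_mono) auto
      then show ?thesis by (simp add: v_def)
    qed
  qed measurable
  then show "integrable lborel (\<lambda>x. signed_powr p (g x) * v x)"
    by (rule Lpow_pairing_integrable[OF approx_Lpow[OF g] _ p1(1)])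
  show "signed_powr p (g x) * v x \<ge> 0" for x
    using nn[of x] by (simp add: v_def signed_powr_def)
qed

end

lemma negligible_borel: "S \<in> sets borel \<Longrightarrow> negligible S \<longleftrightarrow> S \<in> null_sets lborel"
  for S :: "'a::euclidean_space set"
  unfolding negligible_iff_null_sets by (rule null_sets_completion_iff) simp

lemma open_pos_emeasure:
  assumes "open S" and "S \<noteq> {}"
  shows "emeasure lborel (S :: 'a::euclidean_space set) \<noteq> 0"
  using open_not_negligible[OF assms] negligible_borel[of S] assms(1) by (auto simp: null_sets_def)

context fractional
begin

text \<open>After multiplication by \<open>e\<^sup>p\<^sup>-\<^sup>1\<close> the bound of \<open>picone_energy\<close> tends to 0, whereas the integrand tends to a
  function that is positive on \<open>{g > 0} \<times> {g = 0, \<phi> \<noteq> 0}\<close>.\<close>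

lemma eigen_zero_set:
  assumes eig: "eigen g lam" and nn: "\<And>x. g x \<ge> 0" and \<phi>: "\<phi> \<in> test"
  shows "{y. g y = 0 \<and> \<phi> y \<noteq> 0} \<in> null_sets lborel"
proof -
  obtain \<psi> x0 where g: "approx \<psi> g" and x0: "g x0 \<noteq> 0" using eig unfolding eigen_def by blast
  have lam: "lam \<ge> 0" using eigen_energy(3)[OF eig] lam1_nonneg by linarith
  have [measurable]: "\<phi> \<in> borel_measurable borel" "g \<in> borel_measurable borel"
    using \<phi> approx_measurable[OF g] by auto
  define e where "e k = inverse (real (Suc k))" for k
  have e: "e k > 0" for k by (simp add: e_def)
  have e0: "e \<longlonglongrightarrow> 0" unfolding e_def by (rule LIMSEQ_inverse_real_of_nat)
  define v where "v k x = \<bar>\<phi> x\<bar> powr p * (g x + e k) powr (1 - p)" for k x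
  define Dp where "Dp k z = \<bar>dif (\<lambda>x. \<bar>\<phi> x\<bar>) z\<bar> powr p - signed_powr p (dif g z) * dif (v k) z" for k z
  note Pe = picone_energy[OF eig nn \<phi> e, folded v_def, folded Dp_def]
  \<comment> \<open>The limit of \<open>e^(p-1) v\<close>: where \<open>g\<close> vanishes the
    powers of \<open>e\<close> cancel exactly, elsewhere the factor \<open>e^(p-1)\<close>
    wins.\<close>
  define h where "h y = (if g y = 0 then \<bar>\<phi> y\<bar> powr p else 0)" for y
  have [measurable]: "h \<in> borel_measurable borel" unfolding h_def by measurable
  have ep: "(\<lambda>k. e k powr (p - 1)) \<longlonglongrightarrow> 0"
    using tendsto_abs_powr[OF e0, of "p - 1"] p1 e by (simp add: less_imp_le)
  have vlim: "(\<lambda>k. e k powr (p - 1) * v k y) \<longlonglongrightarrow> h y" for y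
  proof (cases "g y = 0")
    case True
    have "e k powr (p - 1) * v k y = \<bar>\<phi> y\<bar> powr p" for k
    proof -
      have "e k powr (p - 1) * e k powr (1 - p) = 1" using e[of k] by (simp only: powr_add[symmetric]) simp
      then show ?thesis using True by (simp add: v_def mult.left_commute)
    qed
    with True show ?thesis by (simp add: h_def)
  next
    case False
    have "(\<lambda>k. (g y + e k) powr (1 - p)) \<longlonglongrightarrow> (g y + 0) powr (1 - p)"
      by (rule tendsto_powr[OF tendsto_add[OF tendsto_const e0] tendsto_const]) (use False in simp)
    then have "(\<lambda>k. e k powr (p - 1) * (\<bar>\<phi> y\<bar> powr p * (g y + e k) powr (1 - p))) \<longlonglongrightarrow> 0 * (\<bar>\<phi> y\<bar> powr p * (g y + 0) powr (1 - p))"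
      by (intro tendsto_mult ep tendsto_const)
    with False show ?thesis by (simp add: v_def h_def)
  qed
  define G where "G z = - (signed_powr p (dif g z) * dif h z)" for z
  have [measurable]: "G \<in> borel_measurable borel" unfolding G_def by measurable
  have lim: "(\<lambda>k. e k powr (p - 1) * Dp k z) \<longlonglongrightarrow> G z" for z
  proof -
    have "(\<lambda>k. e k powr (p - 1) * \<bar>dif (\<lambda>x. \<bar>\<phi> x\<bar>) z\<bar> powr p
        - signed_powr p (dif g z) * (e k powr (p - 1) * v k (snd z) - e k powr (p - 1) * v k (fst z)))
      \<longlonglongrightarrow> 0 * \<bar>dif (\<lambda>x. \<bar>\<phi> x\<bar>) z\<bar> powr p - signed_powr p (dif g z) * (h (snd z) - h (fst z))"
      by (intro tendsto_diff tendsto_mult tendsto_const ep vlim)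
    moreover have "e k powr (p - 1) * \<bar>dif (\<lambda>x. \<bar>\<phi> x\<bar>) z\<bar> powr p
        - signed_powr p (dif g z) * (e k powr (p - 1) * v k (snd z) - e k powr (p - 1) * v k (fst z))
      = e k powr (p - 1) * Dp k z" for k
      by (simp add: Dp_def dif_def algebra_simps)
    ultimately show ?thesis by (simp add: G_def dif_def)
  qed
  have f0: "0 \<le> e k powr (p - 1) * Dp k z" for k z
    by (rule mult_nonneg_nonneg[OF powr_ge_zero Pe(1)])
  have fi: "integrable (kern r) (\<lambda>z. e k powr (p - 1) * Dp k z)" for k using Pe(2) by simp
  have fle: "(\<integral>z. e k powr (p - 1) * Dp k z \<partial>kern r) \<le> e k powr (p - 1) * En \<phi>" for k
  proof -
    have "0 \<le> lam * (\<integral>x. signed_powr p (g x) * v k x \<partial>lborel)"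
      by (rule mult_nonneg_nonneg[OF lam Bochner_Integration.integral_nonneg[OF Pe(5)]])
    then have "(\<integral>z. Dp k z \<partial>kern r) \<le> En \<phi>" using Pe(3)[of k] by linarith
    then show ?thesis by (simp add: mult_left_mono)
  qed
  have "(\<lambda>k. e k powr (p - 1) * En \<phi>) \<longlonglongrightarrow> 0 * En \<phi>" by (intro tendsto_mult ep tendsto_const)
  then have Ml: "(\<lambda>k. e k powr (p - 1) * En \<phi>) \<longlonglongrightarrow> 0" by simp
  have Gm: "G \<in> borel_measurable (kern r)" by measurable
  note F = Fatou_bounded[OF fi f0 fle Ml AE_I2[OF lim] Gm]
  have G0: "G z \<ge> 0" for z by (rule LIMSEQ_le_const[OF lim]) (use f0 in blast)
  have "(\<integral>z. G z \<partial>kern r) = 0"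
    by (rule antisym[OF F(2) Bochner_Integration.integral_nonneg[OF G0]])
  then have "AE z in kern r. G z = 0"
    by (subst (asm) integral_nonneg_eq_0_iff_AE) (use F(1) G0 in auto)
  then have AE: "AE z in lborel. 0 < wt r z \<longrightarrow> G z = 0"
    unfolding kern_def by (subst (asm) AE_density) auto
  let ?P = "{x. g x > 0}" and ?Z = "{y. g y = 0 \<and> \<phi> y \<noteq> 0}"
  \<comment> \<open>At such a pair \<open>G\<close> equals \<open>g(x)^(p-1) |\<phi> y|^p\<close>,
    which is positive. So the product is null, and since its first factor is open and nonempty, the
    second one is null.\<close>
  have AEn: "AE z in lborel. z \<notin> ?P \<times> ?Z"
    using AE
  proof eventually_elim
    case (elim z)
    show ?case
    proof
      assume "z \<in> ?P \<times> ?Z"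
      then have z: "g (fst z) > 0" "g (snd z) = 0" "\<phi> (snd z) \<noteq> 0" by (auto simp: mem_Times_iff)
      then have "fst z \<noteq> snd z" by auto
      then have "G z = 0" using elim wt_pos by blast
      moreover have "signed_powr p (dif g z) = - (g (fst z) powr (p - 1))"
        using z signed_powr_minus[of p "g (fst z)"] signed_powr_nonneg[OF p1(1), of "g (fst z)"] by (simp add: dif_def)
      ultimately show False using z by (simp add: G_def dif_def h_def)
    qed
  qed
  have sP: "?P \<in> sets lborel" "?Z \<in> sets lborel" by measurable
  have "?P \<times> ?Z \<in> sets lborel"
    using pair_measureI[OF sP] unfolding lborel_prod .
  with AEn have "emeasure lborel (?P \<times> ?Z) = 0"
    using AE_iff_null_sets null_setsD1 by blast
  then have "emeasure lborel ?P * emeasure lborel ?Z = 0"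
    using lborel.emeasure_pair_measure_Times[OF sP] unfolding lborel_prod by simp
  moreover have "emeasure lborel ?P \<noteq> 0"
  proof (rule open_pos_emeasure)
    show "open ?P" by (intro open_Collect_less continuous_on_const approx_continuous[OF g])
    show "?P \<noteq> {}" using x0 nn[of x0] by (auto intro!: exI[of _ x0])
  qed
  ultimately have "emeasure lborel ?Z = 0" by simp
  with sP(2) show ?thesis by (simp add: null_sets_def)
qed

text \<open>Bump functions around the points of \<Omega> show that the zero set is locally
  negligible, hence negligible.\<close>

lemma eigen_positive:
  assumes eig: "eigen g lam" and nn: "\<And>x. g x \<ge> 0"
  shows "AE x in lborel. x \<in> \<Omega> \<longrightarrow> g x > 0"
proof -
  obtain \<psi> where g: "approx \<psi> g" using eig unfolding eigen_def by blast
  have [measurable]: "g \<in> borel_measurable borel" by (rule approx_measurable[OF g])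
  let ?Z = "{x \<in> \<Omega>. g x = 0}"
  have Zm: "?Z \<in> sets borel" by measurable
  have "negligible ?Z"
  proof (rule locally_negligible_alt[THEN iffD2, OF ballI])
    fix x assume x: "x \<in> ?Z"
    then have "x \<in> \<Omega>" by simp
    then obtain \<phi> d where \<phi>: "\<phi> \<in> test" "d > 0" "\<And>y. \<phi> y \<ge> 0" "{y. \<phi> y > 0} = ball x d"
      by (rule bump_exists[OF open_\<Omega>]) (rule that)
    have [measurable]: "\<phi> \<in> borel_measurable borel" using \<phi>(1) by auto
    have m: "{y. g y = 0 \<and> \<phi> y \<noteq> 0} \<in> sets borel" by measurable
    have "negligible {y. g y = 0 \<and> \<phi> y \<noteq> 0}"
      using eigen_zero_set[OF eig nn \<phi>(1)] negligible_borel[OF m] by simp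
    moreover have "?Z \<inter> ball x d \<subseteq> {y. g y = 0 \<and> \<phi> y \<noteq> 0}"
      unfolding \<phi>(4)[symmetric] by auto
    ultimately have "negligible (?Z \<inter> ball x d)" by (rule negligible_subset)
    moreover have "openin (top_of_set ?Z) (?Z \<inter> ball x d)" by (simp add: openin_open_Int)
    ultimately show "\<exists>U. openin (top_of_set ?Z) U \<and> x \<in> U \<and> negligible U"
      using x \<phi>(2) by (intro exI[of _ "?Z \<inter> ball x d"]) auto
  qed
  then have "?Z \<in> null_sets lborel" using negligible_borel[OF Zm] by simp
  from AE_not_in[OF this] show ?thesis
    by eventually_elim (use nn in \<open>force simp: less_le\<close>)
qed

text \<open>The nonnegative Picone remainder is dropped. As \<open>e\<close> tends to 0,
  \<open>g^(p-1) |\<phi>|^p (g + e)^(1-p)\<close> tends to \<open>|\<phi>|^p\<close> almost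
  everywhere, by positivity of \<open>g\<close>. Fatou's lemma makes \<open>lam\<close> a lower
  bound of all Rayleigh quotients.\<close>

lemma nonneg_eigen_le:
  assumes eig: "eigen g lam" and nn: "\<And>x. g x \<ge> 0"
  shows "lam \<le> lam1"
proof (rule lam1_greatest)
  fix \<phi> assume \<phi>: "\<phi> \<in> test"
  obtain \<psi> where g: "approx \<psi> g" using eig unfolding eigen_def by blast
  have lam: "lam \<ge> 0" using eigen_energy(3)[OF eig] lam1_nonneg by linarith
  have [measurable]: "\<phi> \<in> borel_measurable borel" "g \<in> borel_measurable borel"
    using \<phi> approx_measurable[OF g] by auto
  define e where "e k = inverse (real (Suc k))" for k
  have e: "e k > 0" for k by (simp add: e_def)
  have e0: "e \<longlonglongrightarrow> 0" unfolding e_def by (rule LIMSEQ_inverse_real_of_nat)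
  define f where "f k x = lam * (signed_powr p (g x) * (\<bar>\<phi> x\<bar> powr p * (g x + e k) powr (1 - p)))" for k x
  note Pe = picone_energy[OF eig nn \<phi> e]
  have fi: "integrable lborel (f k)" for k unfolding f_def by (intro integrable_mult_right Pe(4))
  have f0: "0 \<le> f k x" for k x unfolding f_def by (intro mult_nonneg_nonneg[OF lam] Pe(5))
  have fle: "(\<integral>x. f k x \<partial>lborel) \<le> En \<phi>" for k
  proof -
    have "(\<integral>x. f k x \<partial>lborel) = lam * (\<integral>x. signed_powr p (g x) * (\<bar>\<phi> x\<bar> powr p * (g x + e k) powr (1 - p)) \<partial>lborel)"
      unfolding f_def by simp
    moreover have "0 \<le> (\<integral>z. \<bar>dif (\<lambda>x. \<bar>\<phi> x\<bar>) z\<bar> powr p - signed_powr p (dif g z)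
        * dif (\<lambda>x. \<bar>\<phi> x\<bar> powr p * (g x + e k) powr (1 - p)) z \<partial>kern r)"
      by (rule Bochner_Integration.integral_nonneg[OF Pe(1)])
    ultimately show ?thesis using Pe(3)[of k] by linarith
  qed
  have lim: "AE x in lborel. (\<lambda>k. f k x) \<longlonglongrightarrow> lam * \<bar>\<phi> x\<bar> powr p"
    using eigen_positive[OF eig nn]
  proof eventually_elim
    case (elim x)
    show ?case
    proof (cases "x \<in> \<Omega>")
      case True
      then have gx: "g x > 0" using elim by simp
      have "(\<lambda>k. (g x + e k) powr (1 - p)) \<longlonglongrightarrow> (g x + 0) powr (1 - p)"
        by (rule tendsto_powr[OF tendsto_add[OF tendsto_const e0] tendsto_const]) (use gx in simp)
      then have "(\<lambda>k. f k x) \<longlonglongrightarrow> lam * (signed_powr p (g x) * (\<bar>\<phi> x\<bar> powr p * (g x + 0) powr (1 - p)))"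
        unfolding f_def by (intro tendsto_mult tendsto_const)
      also have "signed_powr p (g x) * (\<bar>\<phi> x\<bar> powr p * (g x + 0) powr (1 - p)) = \<bar>\<phi> x\<bar> powr p * (g x powr (p - 1) * g x powr (1 - p))"
        using signed_powr_nonneg[OF p1(1), of "g x"] gx by simp
      also have "g x powr (p - 1) * g x powr (1 - p) = 1" using gx by (simp only: powr_add[symmetric]) simp
      finally show ?thesis by simp
    next
      case False
      then show ?thesis using test_functions_outside[OF \<phi> False] p1 by (simp add: f_def)
    qed
  qed
  have "(\<lambda>x. lam * \<bar>\<phi> x\<bar> powr p) \<in> borel_measurable lborel" by measurable
  from Fatou_bounded(2)[OF fi f0 fle tendsto_const lim this]
  show "lam * Pw \<phi> \<le> En \<phi>" by (simp add: Jpow_def)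
qed

subsection \<open>Isolation of the first eigenvalue\<close>

text \<open>Let \<open>w\<close> be the negative part. The equation gives
  \<open>En w \<le> \<Lambda> Pw w\<close>, so Morrey's inequality bounds \<open>|w|^p\<close> by
  \<open>K^p \<Lambda> Pw w\<close>. Integrating over {g < 0} and cancelling \<open>Pw w\<close>
  leaves the lower bound \<open>1 / (K^p \<Lambda>)\<close> for its measure.\<close>

lemma negative_set_measure:
  assumes \<Lambda>: "\<Lambda> > 0"
  shows "\<exists>c>0. \<forall>g lam. eigen g lam \<longrightarrow> lam \<le> \<Lambda> \<longrightarrow> (\<exists>x. g x < 0) \<longrightarrow> c \<le> measure lborel {x. g x < 0}"
proof -
  obtain K where K: "K > 0" "\<And>f M x. hoelder f \<Longrightarrow> fin f \<Longrightarrow> En f \<le> M \<Longrightarrow> M > 0 \<Longrightarrow> (\<And>x. x \<notin> \<Omega> \<Longrightarrow> f x = 0) \<Longrightarrow> \<bar>f x\<bar> \<le> K * M powr (1 / p)"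
    using hoelder_bound by blast
  have "1 / (K powr p * \<Lambda>) \<le> measure lborel {x. g x < 0}"
    if eig: "eigen g lam" and le: "lam \<le> \<Lambda>" and neg: "g x0 < 0" for g lam x0
  proof -
    obtain \<psi> where g: "approx \<psi> g" and eq: "\<And>w. w \<in> test \<Longrightarrow> weak_eq g lam w" using eig unfolding eigen_def by blast
    note D = approxD[OF g]
    obtain B where B: "B > 0" "\<And>k x. \<bar>\<psi> k x\<bar> \<le> B" "\<And>x. \<bar>g x\<bar> \<le> B" "\<And>k. En (\<psi> k) \<le> B"
      by (rule approx_bounded[OF g]) (rule that)
    have [measurable]: "g \<in> borel_measurable borel" by (rule approx_measurable[OF g])
    define w where "w x = max (- g x) 0" for x
    have [measurable]: "w \<in> borel_measurable borel" unfolding w_def by measurable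
    define d where "d k = inverse (real (Suc k))" for k
    have d: "d k > 0" for k by (simp add: d_def)
    have d0: "d \<longlonglongrightarrow> 0" unfolding d_def by (rule LIMSEQ_inverse_real_of_nat)
    \<comment> \<open>The negative part as \<open>(|\<psi>| - \<psi>) / 2\<close> with the absolute
      value regularised, so that it is smooth and vanishes with \<psi>.\<close>
    define u where "u k x = 1 / 2 * ((sqrt ((\<psi> k x)\<^sup>2 + (d k)\<^sup>2) + - d k) - \<psi> k x)" for k x
    have ut: "u k \<in> test" for k
    proof (rule test_functionsI[OF _ D(1)])
      show "smooth (u k)" unfolding u_def
        by (intro smooth_intros(4) smooth_diff smooth_intros(3) smooth_intros(1) smooth_sqrt test_functions_smooth[OF D(1)] d)
      show "u k x = 0" if "\<psi> k x = 0" for x using that d[of k] by (simp add: u_def)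
    qed
    have uE: "En (u k) \<le> B" for k
    proof -
      have "\<bar>dif (u k) z\<bar> \<le> \<bar>dif (\<psi> k) z\<bar>" for z
      proof -
        let ?a = "\<psi> k (snd z)" and ?b = "\<psi> k (fst z)"
        let ?A = "sqrt (?a\<^sup>2 + (d k)\<^sup>2)" and ?B = "sqrt (?b\<^sup>2 + (d k)\<^sup>2)"
        have "2 * dif (u k) z = ((?A - ?B) - (?a - ?b))" by (simp add: u_def dif_def field_simps)
        moreover have "\<bar>(?A - ?B) - (?a - ?b)\<bar> \<le> 2 * \<bar>?a - ?b\<bar>"
          by (rule order.trans[OF abs_triangle_ineq4]) (use sqrt_lipschitz[of ?a "d k" ?b] in simp)
        ultimately have "\<bar>2 * dif (u k) z\<bar> \<le> 2 * \<bar>?a - ?b\<bar>" by metis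
        then have "\<bar>dif (u k) z\<bar> \<le> \<bar>?a - ?b\<bar>" unfolding abs_mult by simp
        then show ?thesis unfolding dif_def[of "\<psi> k"] .
      qed
      then have "En (u k) \<le> En (\<psi> k)"
        using test_measurable[OF ut] p1 by (intro Lpow_contract(2)[OF test_fin[OF D(1)]]) auto
      with B(4)[of k] show ?thesis by linarith
    qed
    have ul: "(\<lambda>k. u k x) \<longlonglongrightarrow> w x" for x
    proof -
      have "(\<lambda>k. u k x) \<longlonglongrightarrow> 1 / 2 * ((\<bar>g x\<bar> + - 0) - g x)"
        unfolding u_def by (intro tendsto_mult tendsto_diff tendsto_add tendsto_minus tendsto_const tendsto_sqrt_abs D(5) d0)
      also have "1 / 2 * ((\<bar>g x\<bar> + - 0) - g x) = w x" by (simp add: w_def)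
      finally show ?thesis .
    qed
    note W = weak_eq_limit[OF g eq[OF ut] ut uE ul]
    have out: "w x = 0" if "x \<notin> \<Omega>" for x using approx_outside[OF g that] by (simp add: w_def)
    have lip: "\<bar>w x - w y\<bar> \<le> \<bar>g x - g y\<bar>" for x y by (auto simp: w_def)
    have hw: "hoelder w"
      using approx_hoelder[OF g] lip unfolding hoelder_def by (meson order.trans)
    have Lw: "Lpow lborel p w"
      by (rule bounded_Lpow(1)[of w B]) (use out B(1,3) in \<open>auto simp: w_def abs_le_iff\<close>)
    have Pw_w: "Pw w > 0"
      by (rule Pw_pos[OF hoelder_continuous[OF hw] Lw, of x0]) (use neg in \<open>simp add: w_def\<close>)
    have E: "En w \<le> lam * Pw w"
    proof -
      have i: "integrable (kern r) (\<lambda>z. signed_powr p (dif g z) * dif w z)"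
        by (rule Lpow_pairing_integrable[OF approx_fin[OF g] W(2) p1(1)])
      \<comment> \<open>Differences of \<open>w\<close> are no larger than those of \<open>g\<close>
        and never have the same sign, since \<open>w\<close> is a decreasing function of
        \<open>g\<close>.\<close>
      have pt: "\<bar>dif w z\<bar> powr p \<le> - (signed_powr p (dif g z) * dif w z)" for z
      proof -
        have le: "\<bar>dif w z\<bar> \<le> \<bar>dif g z\<bar>" using lip by (simp add: dif_def)
        have "\<bar>dif w z\<bar> powr p = \<bar>dif w z\<bar> powr (p - 1) * \<bar>dif w z\<bar> powr 1"
          by (simp only: powr_add[symmetric]) simp
        also have "\<dots> \<le> \<bar>dif g z\<bar> powr (p - 1) * \<bar>dif w z\<bar>"
          using le p1 by (auto intro!: mult_right_mono powr_mono2)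
        also have "\<dots> = \<bar>signed_powr p (dif g z) * dif w z\<bar>" by (simp add: abs_mult abs_signed_powr p1)
        also have "\<dots> = - (signed_powr p (dif g z) * dif w z)"
        proof -
          have "dif g z * dif w z \<le> 0" unfolding dif_def w_def
            by (cases "g (fst z) \<le> g (snd z)") (auto intro: mult_nonneg_nonpos mult_nonpos_nonneg)
          then have "signed_powr p (dif g z) * dif w z \<le> 0"
            by (simp add: signed_powr_def mult.assoc mult_nonneg_nonpos)
          then show ?thesis by simp
        qed
        finally show ?thesis .
      qed
      have "En w \<le> (\<integral>z. - (signed_powr p (dif g z) * dif w z) \<partial>kern r)"
        unfolding Jpow_def by (rule integral_mono[OF LpowD(2)[OF W(2)]]) (use i pt in auto)
      also have "\<dots> = - (lam * (\<integral>x. signed_powr p (g x) * w x \<partial>lborel))"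
        using W(1) unfolding weak_eq_def by simp
      also have "(\<integral>x. signed_powr p (g x) * w x \<partial>lborel) = (\<integral>x. - (\<bar>w x\<bar> powr p) \<partial>lborel)"
      proof (rule Bochner_Integration.integral_cong[OF refl])
        fix x
        show "signed_powr p (g x) * w x = - (\<bar>w x\<bar> powr p)"
          using signed_powr_mult_self[OF p1(3), of "g x"] p1 by (cases "g x < 0") (auto simp: w_def)
      qed
      also have "- (lam * (\<integral>x. - (\<bar>w x\<bar> powr p) \<partial>lborel)) = lam * Pw w" by (simp add: Jpow_def)
      finally show ?thesis .
    qed
    also have "lam * Pw w \<le> \<Lambda> * Pw w" using le Pw_w by (intro mult_right_mono) auto
    finally have E': "En w \<le> \<Lambda> * Pw w" .
    have M: "\<Lambda> * Pw w > 0" using \<Lambda> Pw_w by simp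
    have neg_sub: "{x. g x < 0} \<subseteq> \<Omega>" using approx_outside[OF g] by force
    have nm: "{x. g x < 0} \<in> sets lborel" by measurable
    have fm: "emeasure lborel {x. g x < 0} < \<infinity>"
      using emeasure_mono[OF neg_sub, of lborel] emeasure_\<Omega> sets_\<Omega> by (auto intro: le_less_trans)
    have "\<bar>w x\<bar> powr p \<le> K powr p * (\<Lambda> * Pw w) * indicator {x. g x < 0} x" for x
    proof (cases "g x < 0")
      case True
      have "\<bar>w x\<bar> powr p \<le> (K * (\<Lambda> * Pw w) powr (1 / p)) powr p"
        using K(2)[OF hw W(2) E' M out, of x] p1 by (intro powr_mono2) auto
      also have "\<dots> = K powr p * (\<Lambda> * Pw w)" using K(1) \<Lambda> Pw_w p1 by (simp add: powr_mult powr_powr)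
      finally show ?thesis using True by simp
    qed (use p1 in \<open>simp add: w_def\<close>)
    then have "Pw w \<le> (\<integral>x. K powr p * (\<Lambda> * Pw w) * indicator {x. g x < 0} x \<partial>lborel)"
      unfolding Jpow_def
      by (intro integral_mono LpowD(2)[OF Lw] integrable_mult_right integrable_real_indicator nm fm) auto
    also have "\<dots> = K powr p * (\<Lambda> * Pw w) * measure lborel {x. g x < 0}" by simp
    finally have "Pw w * 1 \<le> Pw w * (K powr p * \<Lambda> * measure lborel {x. g x < 0})" by (simp add: mult_ac)
    then have "1 \<le> K powr p * \<Lambda> * measure lborel {x. g x < 0}" using Pw_w by simp
    then show ?thesis using K(1) \<Lambda> by (simp add: divide_le_eq mult_ac)
  qed
  moreover have "1 / (K powr p * \<Lambda>) > 0" using K(1) \<Lambda> by simp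
  ultimately show ?thesis by blast
qed

lemma eigen_scale:
  assumes eig: "eigen g lam" and c: "c \<noteq> 0"
  shows "eigen (\<lambda>x. c * g x) lam"
proof -
  have "weak_eq (\<lambda>x. c * g x) lam w" if "weak_eq g lam w" for w
    using that unfolding weak_eq_def dif_simps signed_powr_scale
    by (simp add: mult.assoc)
  with eig c show ?thesis unfolding eigen_def using approx_scale by fastforce
qed

text \<open>The regularised absolute values of the approximants have no more energy, so they again
  form a minimising sequence, whose limit is \<open>|f|\<close>. Equality of the energies forces
  equality of the integrands almost everywhere; but \<open>||a| - |b||\<close> is strictly less than
  \<open>|a - b|\<close> for opposite signs. So the open set {f > 0} \<times> {f < 0} is null, hence
  empty.\<close>

lemma first_eigenfunction_sign:
  assumes f: "approx \<phi> f" and P: "Pw f = 1" and E: "En f = lam1" and \<phi>: "(\<lambda>k. En (\<phi> k)) \<longlonglongrightarrow> lam1"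
  shows "eigen (\<lambda>x. \<bar>f x\<bar>) lam1" and "(\<forall>x. f x \<ge> 0) \<or> (\<forall>x. f x \<le> 0)"
proof -
  note D = approxD[OF f]
  define d where "d k = inverse (real (Suc k))" for k
  have d: "d k > 0" for k by (simp add: d_def)
  have d0: "d \<longlonglongrightarrow> 0" unfolding d_def by (rule LIMSEQ_inverse_real_of_nat)
  define u where "u k x = sqrt ((\<phi> k x)\<^sup>2 + (d k)\<^sup>2) + - d k" for k x
  have ut: "u k \<in> test" for k
  proof (rule test_functionsI[OF _ D(1)])
    show "smooth (u k)" unfolding u_def
      by (intro smooth_intros(3) smooth_intros(1) smooth_sqrt test_functions_smooth[OF D(1)] d)
    show "u k x = 0" if "\<phi> k x = 0" for x using that d[of k] by (simp add: u_def)
  qed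
  have uE: "En (u k) \<le> En (\<phi> k)" for k
  proof (rule Lpow_contract(2)[OF test_fin[OF D(1)]])
    show "dif (u k) \<in> borel_measurable (kern r)" using test_measurable[OF ut] by measurable
    show "\<bar>dif (u k) z\<bar> \<le> \<bar>dif (\<phi> k) z\<bar>" for z
      using sqrt_lipschitz[of "\<phi> k (snd z)" "d k" "\<phi> k (fst z)"] by (simp add: u_def dif_def)
  qed (use p1 in simp)
  have ul: "(\<lambda>k. u k x) \<longlonglongrightarrow> \<bar>f x\<bar>" for x
  proof -
    have "(\<lambda>k. u k x) \<longlonglongrightarrow> \<bar>f x\<bar> + - 0"
      unfolding u_def by (intro tendsto_add tendsto_minus tendsto_sqrt_abs D(5) d0)
    then show ?thesis by simp
  qed
  have [measurable]: "f \<in> borel_measurable borel" by (rule approx_measurable[OF f])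
  obtain B where B: "B > 0" "\<And>k x. \<bar>\<phi> k x\<bar> \<le> B" "\<And>x. \<bar>f x\<bar> \<le> B" "\<And>k. En (\<phi> k) \<le> B"
    by (rule approx_bounded[OF f]) (rule that)
  have "(\<lambda>k. Pw (u k)) \<longlonglongrightarrow> Pw (\<lambda>x. \<bar>f x\<bar>)"
  proof (rule Pw_tendsto[OF test_measurable[OF ut] _ test_functions_outside[OF ut] _ ul])
    show "\<bar>u k x\<bar> \<le> B" for k x
      using sqrt_bounds(1,3)[of "d k" "\<phi> k x"] d[of k] B(2)[of k x] unfolding u_def by linarith
  qed simp_all
  then have uP: "(\<lambda>k. Pw (u k)) \<longlonglongrightarrow> 1" using P by (simp add: Jpow_def)
  have uE': "(\<lambda>k. En (u k)) \<longlonglongrightarrow> lam1"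
  proof (rule tendsto_sandwich[OF _ _ _ \<phi>])
    show "\<forall>\<^sub>F k in sequentially. lam1 * Pw (u k) \<le> En (u k)" using lam1_le[OF ut] by simp
    show "(\<lambda>k. lam1 * Pw (u k)) \<longlonglongrightarrow> lam1" using tendsto_mult[OF tendsto_const uP, of lam1] by simp
  qed (use uE in simp)
  obtain s h where s: "strict_mono (s :: nat \<Rightarrow> nat)" "approx (\<lambda>k. u (s k)) h" "En h = lam1" "eigen h lam1"
    using minimising_limit[of u, OF ut uP uE'] by blast
  have h: "h = (\<lambda>x. \<bar>f x\<bar>)"
  proof
    fix x
    have "(\<lambda>k. u (s k) x) \<longlonglongrightarrow> \<bar>f x\<bar>" using LIMSEQ_subseq_LIMSEQ[OF ul s(1)] by (simp add: o_def)
    then show "h x = \<bar>f x\<bar>" using approxD(5)[OF s(2)] LIMSEQ_unique by blast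
  qed
  show "eigen (\<lambda>x. \<bar>f x\<bar>) lam1" using s(4) h by simp
  let ?a = "\<lambda>x. \<bar>f x\<bar>"
  have i: "integrable (kern r) (\<lambda>z. \<bar>dif f z\<bar> powr p)" "integrable (kern r) (\<lambda>z. \<bar>dif ?a z\<bar> powr p)"
    using LpowD(2)[OF approx_fin[OF f]] LpowD(2)[OF approx_fin[OF s(2)]] h by auto
  have "(\<integral>z. \<bar>dif f z\<bar> powr p - \<bar>dif ?a z\<bar> powr p \<partial>kern r) = En f - En ?a"
    unfolding Jpow_def by (rule Bochner_Integration.integral_diff[OF i])
  then have "(\<integral>z. \<bar>dif f z\<bar> powr p - \<bar>dif ?a z\<bar> powr p \<partial>kern r) = 0" using E s(3) h by simp
  moreover have "\<bar>dif ?a z\<bar> powr p \<le> \<bar>dif f z\<bar> powr p" for z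
    using p1 by (intro powr_mono2) (auto simp: dif_def)
  ultimately have "AE z in kern r. \<bar>dif f z\<bar> powr p - \<bar>dif ?a z\<bar> powr p = 0"
    using i by (subst (asm) integral_nonneg_eq_0_iff_AE) auto
  then have "AE z in lborel. 0 < wt r z \<longrightarrow> \<bar>dif f z\<bar> powr p - \<bar>dif ?a z\<bar> powr p = 0"
    unfolding kern_def by (subst (asm) AE_density) auto
  then have "AE z in lborel. z \<notin> {x. f x > 0} \<times> {x. f x < 0}"
  proof eventually_elim
    case (elim z)
    show ?case
    proof
      assume "z \<in> {x. f x > 0} \<times> {x. f x < 0}"
      then have z: "f (fst z) > 0" "f (snd z) < 0" by (auto simp: mem_Times_iff)
      then have "fst z \<noteq> snd z" by auto
      then have "\<bar>dif f z\<bar> powr p = \<bar>dif ?a z\<bar> powr p" using elim wt_pos by fastforce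
      moreover have "\<bar>dif ?a z\<bar> powr p < \<bar>dif f z\<bar> powr p"
        using z p1 by (intro powr_less_mono2) (auto simp: dif_def)
      ultimately show False by simp
    qed
  qed
  moreover have "open ({x. f x > 0} \<times> {x. f x < 0})"
    by (intro open_Times open_Collect_less continuous_on_const approx_continuous[OF f])
  ultimately have "{x. f x > 0} \<times> {x. f x < 0} = {}" by (intro open_AE_nonempty)
  then show "(\<forall>x. f x \<ge> 0) \<or> (\<forall>x. f x \<le> 0)" by (auto simp: not_less[symmetric])
qed

lemma lam1_eigen: "\<exists>g. eigen g lam1"
proof -
  obtain \<phi> where \<phi>: "\<And>k. \<phi> k \<in> test" "\<And>k. Pw (\<phi> k) = 1" "(\<lambda>k. En (\<phi> k)) \<longlonglongrightarrow> lam1"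
    using minimising_sequence by blast
  then show ?thesis using minimising_limit[of \<phi>] by auto
qed

lemma no_eigen_sequence:
  assumes eig: "\<And>k. eigen (g k) (lam k)" and lim: "lam \<longlonglongrightarrow> lam1" and gt: "\<And>k. lam k > lam1"
  shows False
proof -
  define c where "c k = (1 / Pw (g k)) powr (1 / p)" for k
  have c: "c k \<noteq> 0" for k using eigen_energy(2)[OF eig[of k]] by (simp add: c_def)
  define h where "h k x = c k * g k x" for k x
  have heig: "eigen (h k) (lam k)" for k unfolding h_def by (rule eigen_scale[OF eig c])
  have hP: "Pw (h k) = 1" for k
  proof -
    obtain \<psi> where "approx \<psi> (g k)" using eig[of k] unfolding eigen_def by blast
    from Lpow_scale(2)[OF approx_Lpow[OF this], of "c k"]
    have "Pw (\<lambda>x. c k * g k x) = 1" using eigen_energy(2)[OF eig[of k]] p1 by (simp add: c_def powr_powr)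
    moreover have "h k = (\<lambda>x. c k * g k x)" by (auto simp: h_def)
    ultimately show ?thesis by simp
  qed
  define d where "d k = inverse (real (Suc k))" for k
  have d: "d k > 0" for k by (simp add: d_def)
  have d0: "d \<longlonglongrightarrow> 0" unfolding d_def by (rule LIMSEQ_inverse_real_of_nat)
  \<comment> \<open>Diagonal choice: \<open>minimising_limit\<close> is stated for test functions,
    so each normalised eigenfunction is replaced by one within \<open>d k\<close> in every
    respect.\<close>
  have "\<exists>\<phi>. \<phi> \<in> test \<and> En \<phi> < lam k + d k \<and> \<bar>Pw \<phi> - 1\<bar> < d k \<and> (\<forall>x. \<bar>\<phi> x - h k x\<bar> < d k)" for k
  proof -
    obtain \<psi> where \<psi>: "approx \<psi> (h k)" using heig[of k] unfolding eigen_def by blast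
    have 1: "eventually (\<lambda>j. En (\<psi> j) < En (h k) + d k) sequentially" by (rule approx_En_less[OF \<psi> d])
    have 2: "eventually (\<lambda>j. dist (Pw (\<psi> j)) (Pw (h k)) < d k) sequentially"
      by (rule tendstoD[OF approx_Pw_tendsto[OF \<psi>] d])
    have 3: "eventually (\<lambda>j. \<forall>x\<in>UNIV. dist (\<psi> j x) (h k x) < d k) sequentially"
      by (rule uniform_limitD[OF approxD(4)[OF \<psi>] d])
    from eventually_happens[OF eventually_conj[OF 1 eventually_conj[OF 2 3]]] obtain j where
      "En (\<psi> j) < En (h k) + d k" "dist (Pw (\<psi> j)) (Pw (h k)) < d k" "\<forall>x. dist (\<psi> j x) (h k x) < d k"
      by auto
    then show ?thesis using approxD(1)[OF \<psi>, of j] eigen_energy(1)[OF heig[of k]] hP[of k]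
      by (intro exI[of _ "\<psi> j"]) (simp add: dist_real_def)
  qed
  then obtain \<phi> where \<phi>: "\<And>k. \<phi> k \<in> test" "\<And>k. En (\<phi> k) < lam k + d k" "\<And>k. \<bar>Pw (\<phi> k) - 1\<bar> < d k"
    "\<And>k x. \<bar>\<phi> k x - h k x\<bar> < d k" by metis
  have P1: "(\<lambda>k. Pw (\<phi> k)) \<longlonglongrightarrow> 1"
    by (rule LIM_zero_cancel, rule Lim_null_comparison[OF _ d0]) (use \<phi>(3) in \<open>simp add: less_imp_le\<close>)
  have E1: "(\<lambda>k. En (\<phi> k)) \<longlonglongrightarrow> lam1"
  proof (rule tendsto_sandwich)
    show "\<forall>\<^sub>F k in sequentially. lam1 * Pw (\<phi> k) \<le> En (\<phi> k)" using lam1_le[OF \<phi>(1)] by simp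
    show "\<forall>\<^sub>F k in sequentially. En (\<phi> k) \<le> lam k + d k" using \<phi>(2) by (simp add: less_imp_le)
    show "(\<lambda>k. lam1 * Pw (\<phi> k)) \<longlonglongrightarrow> lam1" using tendsto_mult[OF tendsto_const P1, of lam1] by simp
    show "(\<lambda>k. lam k + d k) \<longlonglongrightarrow> lam1" using tendsto_add[OF lim d0] by simp
  qed
  obtain s f where s: "strict_mono (s :: nat \<Rightarrow> nat)" and f: "approx (\<lambda>k. \<phi> (s k)) f" and Pf: "Pw f = 1" and Ef: "En f = lam1"
    using minimising_limit[of \<phi>, OF \<phi>(1) P1 E1] by blast
  have Es: "(\<lambda>k. En (\<phi> (s k))) \<longlonglongrightarrow> lam1" using LIMSEQ_subseq_LIMSEQ[OF E1 s] by (simp add: o_def)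
  note sign = first_eigenfunction_sign[OF f Pf Ef Es]
  obtain \<sigma> where \<sigma>: "\<sigma> = 1 \<or> \<sigma> = (-1::real)" "\<And>x. \<sigma> * f x = \<bar>f x\<bar>"
  proof (cases "\<forall>x. f x \<ge> 0")
    case True
    then show ?thesis by (intro that[of 1]) auto
  next
    case False
    then have "\<forall>x. f x \<le> 0" using sign(2) by blast
    then show ?thesis by (intro that[of "-1"]) auto
  qed
  \<comment> \<open>Multiplied by the sign of \<open>f\<close>, the eigenfunctions converge to
    \<open>|f|\<close>, so that only their negative sets need attention.\<close>
  define q where "q k x = \<sigma> * h (s k) x" for k x
  have qeig: "eigen (q k) (lam (s k))" for k unfolding q_def by (rule eigen_scale[OF heig]) (use \<sigma>(1) in auto)
  have hl: "(\<lambda>k. h (s k) x) \<longlonglongrightarrow> f x" for x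
  proof -
    have "(\<lambda>k. d (s k)) \<longlonglongrightarrow> 0" using LIMSEQ_subseq_LIMSEQ[OF d0 s] by (simp add: o_def)
    then have "(\<lambda>k. \<phi> (s k) x - h (s k) x) \<longlonglongrightarrow> 0"
      by (rule Lim_null_comparison[rotated]) (use \<phi>(4) in \<open>simp add: less_imp_le\<close>)
    from tendsto_diff[OF approxD(5)[OF f, of x] this] show ?thesis by simp
  qed
  have ql: "(\<lambda>k. q k x) \<longlonglongrightarrow> \<bar>f x\<bar>" for x
    unfolding q_def \<sigma>(2)[symmetric] by (intro tendsto_mult tendsto_const hl)
  have qm: "q k \<in> borel_measurable borel" "\<And>x. x \<notin> \<Omega> \<Longrightarrow> q k x = 0" for k
    using qeig[of k] unfolding eigen_def by (auto intro: approx_measurable approx_outside)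
  note [measurable] = qm(1)
  \<comment> \<open>Almost every point of \<Omega> has \<open>|f| > 0\<close>, hence eventually
    \<open>q k x > 0\<close>; pointwise convergence is enough for the measures to tend to 0.\<close>
  have "(\<lambda>k. \<integral>x. indicator {x. q k x < 0} x \<partial>lborel) \<longlonglongrightarrow> (\<integral>x. (0::real) \<partial>(lborel :: 'a measure))"
  proof (rule integral_dominated_convergence)
    show "integrable lborel (indicator \<Omega> :: 'a \<Rightarrow> real)"
      using emeasure_\<Omega> by (intro integrable_real_indicator) auto
    show "AE x in lborel. (\<lambda>k. indicator {x. q k x < 0} x) \<longlonglongrightarrow> (0::real)"
      using eigen_positive[OF sign(1) abs_ge_zero]
    proof eventually_elim
      case (elim x)
      show ?case
      proof (cases "x \<in> \<Omega>")
        case True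
        then have "eventually (\<lambda>k. q k x > 0) sequentially" using order_tendstoD(1)[OF ql] elim by blast
        then have "eventually (\<lambda>k. (0::real) = indicator {x. q k x < 0} x) sequentially" by eventually_elim auto
        then show ?thesis by (rule Lim_transform_eventually[OF tendsto_const])
      next
        case False
        then show ?thesis using qm(2) by simp
      qed
    qed
    show "AE x in lborel. norm (indicator {x. q k x < 0} x :: real) \<le> indicator \<Omega> x" for k
    proof (intro AE_I2)
      fix x
      have "x \<in> \<Omega>" if "q k x < 0" using that qm(2)[of x k] by (cases "x \<in> \<Omega>") auto
      then show "norm (indicator {x. q k x < 0} x :: real) \<le> indicator \<Omega> x" by (auto simp: indicator_def)
    qed
  qed auto
  then have ml: "(\<lambda>k. measure lborel {x. q k x < 0}) \<longlonglongrightarrow> 0" by simp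
  \<comment> \<open>The bound \<open>lam1 + 1\<close> serves all late eigenvalues with one
    \<epsilon>. For some \<open>k\<close> the negative set is then too small to be nonempty.\<close>
  obtain \<epsilon> where \<epsilon>: "\<epsilon> > 0" "\<And>g l x. eigen g l \<Longrightarrow> l \<le> lam1 + 1 \<Longrightarrow> g x < 0 \<Longrightarrow> \<epsilon> \<le> measure lborel {x. g x < 0}"
    using negative_set_measure[of "lam1 + 1"] lam1_nonneg by (auto simp: add_nonneg_pos)
  have "(\<lambda>k. lam (s k)) \<longlonglongrightarrow> lam1" using LIMSEQ_subseq_LIMSEQ[OF lim s] by (simp add: o_def)
  then have "eventually (\<lambda>k. lam (s k) < lam1 + 1) sequentially" by (rule order_tendstoD(2)) simp
  from eventually_happens[OF eventually_conj[OF this order_tendstoD(2)[OF ml \<epsilon>(1)]]]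
  obtain k where k: "lam (s k) < lam1 + 1" "measure lborel {x. q k x < 0} < \<epsilon>" by auto
  have "q k x \<ge> 0" for x using \<epsilon>(2)[OF qeig[of k], of x] k by force
  from nonneg_eigen_le[OF qeig this] gt[of "s k"] show False by simp
qed

text \<open>An isolated point belongs to the set, whence the need for a first eigenfunction. All
  eigenvalues are at least \<open>lam1\<close>, so others could accumulate only from above.\<close>

lemma lam1_isolated: "lam1 isolated_in {lam. \<exists>g. eigen g lam}"
proof (rule ccontr)
  assume "\<not> ?thesis"
  then have "\<forall>e>0. \<exists>l. (\<exists>g. eigen g l) \<and> dist lam1 l < e \<and> l \<noteq> lam1"
    using lam1_eigen unfolding isolated_in_dist_Ex_iff by blast
  then have "\<exists>l. (\<exists>g. eigen g l) \<and> dist lam1 l < inverse (real (Suc k)) \<and> l \<noteq> lam1" for k by simp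
  then obtain lam g where lam: "\<And>k. eigen (g k) (lam k)" "\<And>k. dist lam1 (lam k) < inverse (real (Suc k))" "\<And>k. lam k \<noteq> lam1"
    by metis
  have "lam \<longlonglongrightarrow> lam1"
    by (rule LIM_zero_cancel, rule Lim_null_comparison[OF _ LIMSEQ_inverse_real_of_nat])
      (use lam(2) in \<open>simp add: dist_real_def abs_minus_commute less_imp_le\<close>)
  moreover have "lam k > lam1" for k using eigen_energy(3)[OF lam(1)[of k]] lam(3)[of k] by simp
  ultimately show False using no_eigen_sequence[of g lam, OF lam(1)] by blast
qed

lemma first_eigenvalue_eq:
  assumes "r = \<alpha> * p"
  shows "first_eigenvalue \<Omega> \<alpha> p = lam1"
proof -
  have "rayleigh_quotient \<alpha> p \<phi> = En \<phi> / Pw \<phi>" if "\<phi> \<in> test" for \<phi>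
    using set_integrable_diff_quotient(2)[OF test_measurable[OF that], of UNIV r p]
    unfolding rayleigh_quotient_def assms[symmetric]
    by (simp add: set_lebesgue_integral_def Jpow_def)
  then show ?thesis unfolding first_eigenvalue_def lam1_def by (intro arg_cong[where f=Inf] image_cong) auto
qed

end

theorem theorem19:
  fixes \<Omega> :: "(real ^ 'n) set" and \<alpha> p :: real
  assumes "open \<Omega>" and "connected \<Omega>" and "\<Omega> \<noteq> {}" and "bounded \<Omega>"
    and "p \<ge> 2"
    and "2 * real CARD('n) < \<alpha> * p" and "\<alpha> * p < real CARD('n) + p"
  shows "first_eigenvalue \<Omega> \<alpha> p isolated_in eigenvalues \<Omega> \<alpha> p"
proof -
  interpret fractional \<Omega> "\<alpha> * p" p "(\<alpha> * p - 2 * real DIM(real ^ 'n)) / p"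
    by unfold_locales (use assms in auto)
  have "eigenvalues \<Omega> \<alpha> p = {lam. \<exists>g. eigen g lam}"
    using eigenvalues_iff[OF refl] by blast
  then show ?thesis using lam1_isolated first_eigenvalue_eq[OF refl] by simp
qed

end
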